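(* Let $d:\widetilde{\mathrm{Cont}}_0(\mathbb{R}\mathrm{P}^{2n-1},\xi_{\mathrm{st}})\times\widetilde{\mathrm{Cont}}_0(\mathbb{R}\mathrm{P}^{2n-1},\xi_{\mathrm{st}})\to[0,+\infty]$ be a function such that: (i) $d(\phi_0,\phi_1)>0$ if and only if there is a non-negative and somewhere positive path from $\phi_0$ to $\phi_1$; (ii) $d(\phi_0,\phi_2)\ge d(\phi_0,\phi_1)+d(\phi_1,\phi_2)$ whenever $\phi_0\le\phi_1\le\phi_2$; (iii) $d$ is bi-invariant. Then $d(\phi_0,\phi_1)=+\infty$ if there is a non-negative and somewhere positive path from $\phi_0$ to $\phi_1$, and $d(\phi_0,\phi_1)=0$ otherwise.
   Context: The standard contact form $\alpha_0$ on $\mathbb{R}\mathrm{P}^{2n-1}$ is induced by the restriction to $S^{2n-1}$ of $\lambda_0=\frac12\sum_j(x_j\mathrm{d}y_j-y_j\mathrm{d}x_j)$ (which is invariant under $z\mapsto-z$), and $\xi_{\mathrm{st}}=\ker\alpha_0$. $\mathrm{Cont}_0(\mathbb{R}\mathrm{P}^{2n-1},\xi_{\mathrm{st}})$ is the identity component of its contactomorphism group and $\widetilde{\mathrm{Cont}}_0$ its universal cover (homotopy classes with fixed ends of paths starting at $\mathrm{id}$, a group). A smooth path $\phi_t$ in the group (or its lift to the universal cover) with $\frac{\mathrm{d}}{\mathrm{d}t}\phi_t=X_t(\phi_t)$ has contact Hamiltonian $H_t=\alpha_0(X_t)$; it is non-negative if $H\ge0$, positive if $H>0$ everywhere, and somewhere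 positive if $H$ takes a positive value somewhere. $\phi_0\le\phi_1$ means there exists a non-negative path from $\phi_0$ to $\phi_1$ (this is a partial order). Bi-invariance of $d$ means $d(\psi\phi_0\chi,\psi\phi_1\chi)=d(\phi_0,\phi_1)$ for all $\psi,\chi,\phi_0,\phi_1$. *)

theory Defs
  imports "HOL-Analysis.Analysis"
begin

primrec Ck_on :: "nat \<Rightarrow> 'a set \<Rightarrow> ('a::real_normed_vector \<Rightarrow> 'b::real_normed_vector) \<Rightarrow> bool" where
  "Ck_on 0 U f = continuous_on U f"
| "Ck_on (Suc k) U f = (f differentiable_on U \<and>
      (\<forall>v. Ck_on k U (\<lambda>x. frechet_derivative f (at x) v)))"

definition smooth_on :: "'a set \<Rightarrow> ('a::real_normed_vector \<Rightarrow> 'b::real_normed_vector) \<Rightarrow> bool" where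
  "smooth_on U f \<longleftrightarrow> open U \<and> (\<forall>k. Ck_on k U f)"

definition smooth_ext :: "'a set \<Rightarrow> ('a::real_normed_vector \<Rightarrow> 'b::real_normed_vector) \<Rightarrow> ('a \<Rightarrow> 'b) \<Rightarrow> bool" where
  "smooth_ext A f g \<longleftrightarrow> (\<exists>U. open U \<and> A \<subseteq> U \<and> smooth_on U g \<and> (\<forall>x\<in>A. g x = f x))"

definition Sph :: "(complex^'n) set" where
  "Sph = {z. norm z = 1}"

text \<open>lambda_0 = 1/2 sum_j (x_j dy_j - y_j dx_j) at the point z, applied to the vector v.\<close>
definition lam0 :: "complex^'n \<Rightarrow> complex^'n \<Rightarrow> real" where
  "lam0 z v = (1/2) * (\<Sum>j\<in>UNIV. Im (cnj (z $ j) * (v $ j)))"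

section \<open>Contact isotopies of RP^{2n-1} starting at the identity (via their lifts)\<close>

definition contact_path :: "(real \<Rightarrow> complex^'n \<Rightarrow> complex^'n) \<Rightarrow> bool" where
  "contact_path p \<longleftrightarrow>
     (\<forall>x\<in>Sph. p 0 x = x) \<and>
     (\<forall>t\<in>{0..1}. \<forall>x\<in>Sph. p t (- x) = - p t x) \<and>
     (\<forall>t\<in>{0..1}. bij_betw (p t) Sph Sph \<and> (\<exists>g. smooth_ext Sph (inv_into Sph (p t)) g)) \<and>
     (\<exists>P. smooth_ext ({0..1} \<times> Sph) (\<lambda>(t,x). p t x) P \<and>
        (\<forall>t\<in>{0..1}. \<forall>x\<in>Sph. \<forall>v. inner x v = 0 \<and> lam0 x v = 0 \<longrightarrow>
            lam0 (p t x) (frechet_derivative P (at (t,x)) (0,v)) = 0))"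

text \<open>Contact Hamiltonian H_t(p_t x) = alpha_0(d/dt p_t x).\<close>
definition ham :: "(real \<Rightarrow> complex^'n \<Rightarrow> complex^'n) \<Rightarrow> real \<Rightarrow> complex^'n \<Rightarrow> real" where
  "ham p t x = lam0 (p t x) (vector_derivative (\<lambda>s. p s x) (at t within {0..1}))"

definition path_homotopic :: "(real \<Rightarrow> complex^'n \<Rightarrow> complex^'n) \<Rightarrow> (real \<Rightarrow> complex^'n \<Rightarrow> complex^'n) \<Rightarrow> bool" where
  "path_homotopic p q \<longleftrightarrow> (\<exists>K :: real \<Rightarrow> real \<Rightarrow> complex^'n \<Rightarrow> complex^'n.
     (\<forall>s\<in>{0..1}. contact_path (K s)) \<and>
     (\<forall>t\<in>{0..1}. \<forall>x\<in>Sph. K 0 t x = p t x \<and> K 1 t x = q t x) \<and>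
     (\<forall>s\<in>{0..1}. \<forall>x\<in>Sph. K s 1 x = p 1 x) \<and>
     (\<exists>G. smooth_ext ({0..1} \<times> {0..1} \<times> Sph) (\<lambda>(s,t,x). K s t x) G))"

definition cls :: "(real \<Rightarrow> complex^'n \<Rightarrow> complex^'n) \<Rightarrow> (real \<Rightarrow> complex^'n \<Rightarrow> complex^'n) set" where
  "cls p = {q. contact_path q \<and> path_homotopic p q}"

definition UCont :: "(real \<Rightarrow> complex^'n \<Rightarrow> complex^'n) set set" where
  "UCont = cls ` {p. contact_path p}"

definition cmult :: "(real \<Rightarrow> complex^'n \<Rightarrow> complex^'n) set \<Rightarrow> (real \<Rightarrow> complex^'n \<Rightarrow> complex^'n) set
     \<Rightarrow> (real \<Rightarrow> complex^'n \<Rightarrow> complex^'n) set" where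
  "cmult A B = cls (\<lambda>t x. (SOME a. a \<in> A) t ((SOME b. b \<in> B) t x))"

text \<open>A path in the cover from A to B is A followed by right translation by a contact isotopy p
  starting at id; its contact Hamiltonian is that of p.\<close>
definition nonneg_path_between :: "(real \<Rightarrow> complex^'n \<Rightarrow> complex^'n) set \<Rightarrow> (real \<Rightarrow> complex^'n \<Rightarrow> complex^'n) set \<Rightarrow> bool" where
  "nonneg_path_between A B \<longleftrightarrow> (\<exists>p. contact_path p \<and>
      (\<forall>t\<in>{0..1}. \<forall>x\<in>Sph. ham p t x \<ge> 0) \<and> cmult (cls p) A = B)"

definition nnsp_path_between :: "(real \<Rightarrow> complex^'n \<Rightarrow> complex^'n) set \<Rightarrow> (real \<Rightarrow> complex^'n \<Rightarrow> complex^'n) set \<Rightarrow> bool" where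
  "nnsp_path_between A B \<longleftrightarrow> (\<exists>p. contact_path p \<and>
      (\<forall>t\<in>{0..1}. \<forall>x\<in>Sph. ham p t x \<ge> 0) \<and>
      (\<exists>t\<in>{0..1}. \<exists>x\<in>Sph. ham p t x > 0) \<and> cmult (cls p) A = B)"

abbreviation cleq :: "(real \<Rightarrow> complex^'n \<Rightarrow> complex^'n) set \<Rightarrow> (real \<Rightarrow> complex^'n \<Rightarrow> complex^'n) set \<Rightarrow> bool" where
  "cleq A B \<equiv> nonneg_path_between A B"

end

theory Submission
  imports Defs
begin

text \<open>
  It suffices to show \<open>d(id, p) = \<infinity>\<close> for a non-negative isotopy \<open>p\<close> whose Hamiltonian is positive at a
  point \<open>e\<close> of the sphere. Near \<open>e\<close> there is an explicit compactly supported isotopy \<open>\<phi>\<close> which is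
  non-negative and somewhere positive, so \<open>d(id, \<phi>) > 0\<close>. The linear symplectic dilations
  \<open>(x, y, w) \<mapsto> (x/l, l y, w)\<close>, where \<open>x + i y\<close> is the coordinate along \<open>e\<close>, act by contactomorphisms of the
  projective space. Conjugation by them does not change \<open>d(id, \<phi>)\<close>, but for small \<open>l\<close> it squeezes \<open>\<phi>\<close> into a
  small neighbourhood of \<open>e\<close> and makes it so slow that the \<open>N\<close>-th power of the conjugate lies below \<open>p\<close>.
  The reverse triangle inequality then gives \<open>d(id, p) \<ge> N d(id, \<phi>)\<close> for every \<open>N\<close>.
\<close>

section \<open>Smooth functions\<close>

text \<open>In the chart \<open>Re (h z) = 1\<close> the dilation is the Heisenberg dilation (y, w)
  \<mapsto> (l^2 y, l w). It contracts compact sets of the chart to \<open>e\<close>, and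
  conjugation by it multiplies Hamiltonians there by a factor of order l^2; this is why the support
  of \<phi> has to be compact in the chart. The scale l may depend on N, because the conjugates have
  the same distance from id for every l. Positivity of the Hamiltonian of p is known at one point
  and, by continuity, for a short time. Therefore the whole N-th power is run inside that time
  interval by means of a cutoff \<beta>, and p is factored as (p \<omega>^-N) \<omega>^N with both
  factors non-negative. As d lives on the universal cover, a dilation must come with a path to the
  identity, and conjugation by this path is deformed into conjugation by its end point. The isotopy
  \<phi> needs two constructions. For n \<ge> 2 the contact condition is a real constraint, met by
  an explicit Hamiltonian flow. For n = 1 the contact planes vanish and an isotopy of the circle
  suffices.\<close>

lemma has_derivative_frechet:
  assumes "f differentiable_on U" "open U" "x \<in> U"
  shows "(f has_derivative frechet_derivative f (at x)) (at x)"
  using assms differentiable_on_eq_differentiable_at frechet_derivative_works by blast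

section \<open>Calculus of C^k maps\<close>

lemma Ck_on_cong:
  assumes "open U" "\<And>x. x \<in> U \<Longrightarrow> f x = g x" "Ck_on k U f"
  shows "Ck_on k U g"
  using assms
proof (induction k arbitrary: f g)
  case 0
  then show ?case using continuous_on_cong by fastforce
next
  case (Suc k)
  have d: "(g has_derivative frechet_derivative f (at x)) (at x)" if "x \<in> U" for x
  proof (rule has_derivative_transform_within_open)
    show "(f has_derivative frechet_derivative f (at x)) (at x)"
      using Suc.prems that has_derivative_frechet by auto
  qed (use Suc.prems that in auto)
  then have e: "frechet_derivative f (at x) = frechet_derivative g (at x)" if "x \<in> U" for x
    using that frechet_derivative_at by blast
  have "g differentiable_on U"
    by (meson d differentiable_at_withinI differentiable_def differentiable_on_def)
  moreover have "Ck_on k U (\<lambda>x. frechet_derivative g (at x) v)" for v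
    by (rule Suc.IH[of "\<lambda>x. frechet_derivative f (at x) v"]) (use Suc.prems e in auto)
  ultimately show ?case by simp
qed

text \<open>Lets a derivative be exhibited in any convenient form in place of the chosen
  \<open>frechet_derivative\<close>.\<close>

lemma Ck_on_SucI:
  assumes "open U" "\<And>x. x \<in> U \<Longrightarrow> (f has_derivative f' x) (at x)" "\<And>v. Ck_on k U (\<lambda>x. f' x v)"
  shows "Ck_on (Suc k) U f"
proof -
  have "f differentiable_on U"
    by (meson assms(2) differentiable_at_withinI differentiable_def differentiable_on_def)
  moreover have "Ck_on k U (\<lambda>x. frechet_derivative f (at x) v)" for v
    by (rule Ck_on_cong[OF assms(1) _ assms(3)[of v]]) (metis assms(2) frechet_derivative_at)
  ultimately show ?thesis by simp
qed

lemma Ck_on_SucD: "Ck_on (Suc k) U f \<Longrightarrow> Ck_on k U f"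
proof (induction k arbitrary: f)
  case 0
  then show ?case by (simp add: differentiable_imp_continuous_on)
next
  case (Suc k)
  then show ?case by (metis Ck_on.simps(2))
qed

lemma Ck_on_subset:
  assumes "open U" "open V" "V \<subseteq> U" "Ck_on k U f"
  shows "Ck_on k V f"
  using assms(4)
proof (induction k arbitrary: f)
  case 0
  then show ?case using assms continuous_on_subset by auto
next
  case (Suc k)
  then show ?case using assms differentiable_on_subset by auto
qed

text \<open>Serves to glue the piecewise defined maps \<open>loc\<close> and \<open>slide\<close>
  from their smooth pieces.\<close>

lemma Ck_on_local:
  assumes "open U" "\<And>x. x \<in> U \<Longrightarrow> \<exists>V. open V \<and> x \<in> V \<and> Ck_on k V f"
  shows "Ck_on k U f"
  using assms(2)
proof (induction k arbitrary: f)
  case 0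
  have "isCont f x" if "x \<in> U" for x
    using 0[OF that] by (auto simp: continuous_on_eq_continuous_at)
  then show ?case by (simp add: continuous_at_imp_continuous_on)
next
  case (Suc k)
  have "f differentiable (at x)" if "x \<in> U" for x
    using Suc.prems[OF that] by (auto simp: differentiable_on_eq_differentiable_at)
  then have "f differentiable_on U"
    by (simp add: assms(1) differentiable_on_eq_differentiable_at)
  moreover have "Ck_on k U (\<lambda>x. frechet_derivative f (at x) v)" for v
    by (rule Suc.IH) (use Suc.prems in fastforce)
  ultimately show ?case by simp
qed

lemma Ck_on_const: "Ck_on k U (\<lambda>x. c)"
proof (induction k arbitrary: c)
  case (Suc k)
  then show ?case by (auto simp: frechet_derivative_const)
qed simp

lemma Ck_on_bounded_linear: "open U \<Longrightarrow> bounded_linear f \<Longrightarrow> Ck_on k U f"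
  by (cases k) (auto intro!: Ck_on_SucI Ck_on_const bounded_linear_imp_has_derivative
      simp: linear_continuous_on simp del: Ck_on.simps(2))

lemma Ck_on_add:
  assumes "open U" "Ck_on k U f" "Ck_on k U g"
  shows "Ck_on k U (\<lambda>x. f x + g x)"
  using assms(2,3)
proof (induction k arbitrary: f g)
  case 0
  then show ?case by (simp add: continuous_on_add)
next
  case (Suc k)
  show ?case
    by (rule Ck_on_SucI[OF assms(1), where f'="\<lambda>x v. frechet_derivative f (at x) v + frechet_derivative g (at x) v"])
      (use Suc assms(1) in \<open>auto intro!: has_derivative_add has_derivative_frechet\<close>)
qed

lemma Ck_on_bilinear:
  assumes "open U" "bounded_bilinear B" "Ck_on k U f" "Ck_on k U g"
  shows "Ck_on k U (\<lambda>x. B (f x) (g x))"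
  using assms(3,4)
proof (induction k arbitrary: f g)
  case 0
  then show ?case by (simp add: bounded_bilinear.continuous_on[OF assms(2)])
next
  case (Suc k)
  have "Ck_on k U f" "Ck_on k U g" using Suc.prems Ck_on_SucD by blast+
  show ?case
    by (rule Ck_on_SucI[OF assms(1), where f'="\<lambda>x v. B (f x) (frechet_derivative g (at x) v) + B (frechet_derivative f (at x) v) (g x)"])
      (use Suc assms(1) \<open>Ck_on k U f\<close> \<open>Ck_on k U g\<close> in
        \<open>auto intro!: bounded_bilinear.FDERIV[OF assms(2)] has_derivative_frechet Ck_on_add\<close>)
qed

lemma Ck_on_sum:
  assumes "open U" "\<And>i. i \<in> I \<Longrightarrow> Ck_on k U (f i)"
  shows "Ck_on k U (\<lambda>x. \<Sum>i\<in>I. f i x)"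
  using assms(2)
  by (induction I rule: infinite_finite_induct) (auto intro!: Ck_on_add Ck_on_const assms(1))

text \<open>In the chain rule the derivative of the outer map is evaluated at a vector that moves
  with the point, while \<open>Ck_on\<close> speaks of fixed directions only. Expansion in a basis
  reduces the former to the latter, which is why composition is proved with a Euclidean space in the
  middle.\<close>

lemma has_derivative_basis:
  fixes f :: "'a::euclidean_space \<Rightarrow> 'b::real_normed_vector"
  assumes "(f has_derivative f') F"
  shows "f' v = (\<Sum>b\<in>Basis. (v \<bullet> b) *\<^sub>R f' b)"
proof -
  have "f' (\<Sum>b\<in>Basis. (v \<bullet> b) *\<^sub>R b) = (\<Sum>b\<in>Basis. (v \<bullet> b) *\<^sub>R f' b)"
    by (subst linear_sum[OF has_derivative_linear[OF assms]])
      (simp add: linear_scale[OF has_derivative_linear[OF assms]])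
  then show ?thesis by (simp add: euclidean_representation)
qed

lemma Ck_on_compose:
  fixes f :: "'a::real_normed_vector \<Rightarrow> 'b::euclidean_space" and g :: "'b \<Rightarrow> 'c::real_normed_vector"
  assumes "open U" "open V" "f ` U \<subseteq> V" "Ck_on k U f" "Ck_on k V g"
  shows "Ck_on k U (\<lambda>x. g (f x))"
  using assms(4,5)
proof (induction k arbitrary: g)
  case 0
  then show ?case using assms continuous_on_compose2 by (metis Ck_on.simps(1))
next
  case (Suc k)
  have f: "Ck_on k U f" using Suc.prems Ck_on_SucD by blast
  have df: "(f has_derivative frechet_derivative f (at x)) (at x)" if "x \<in> U" for x
    using Suc.prems has_derivative_frechet assms(1) that by auto
  have dg: "(g has_derivative frechet_derivative g (at (f x))) (at (f x))" if "x \<in> U" for x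
    using Suc.prems has_derivative_frechet[of g V "f x"] assms(2,3) that by auto
  show ?case
  proof (rule Ck_on_SucI[OF assms(1)])
    fix x assume x: "x \<in> U"
    show "((\<lambda>x. g (f x)) has_derivative
      (\<lambda>v. \<Sum>b\<in>Basis. (frechet_derivative f (at x) v \<bullet> b) *\<^sub>R frechet_derivative g (at (f x)) b)) (at x)"
      using diff_chain_at[OF df[OF x] dg[OF x]]
      by (simp add: o_def has_derivative_basis[OF dg[OF x], symmetric])
  next
    fix v
    show "Ck_on k U (\<lambda>x. \<Sum>b\<in>Basis. (frechet_derivative f (at x) v \<bullet> b) *\<^sub>R frechet_derivative g (at (f x)) b)"
    proof (intro Ck_on_sum assms(1) Ck_on_bilinear[OF _ bounded_bilinear_scaleR]
        Ck_on_bilinear[OF _ bounded_bilinear_inner] Ck_on_const)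
      fix b :: 'b
      show "Ck_on k U (\<lambda>x. frechet_derivative f (at x) v)" using Suc.prems by simp
      show "Ck_on k U (\<lambda>x. frechet_derivative g (at (f x)) b)"
        by (rule Suc.IH[OF f]) (use Suc.prems in simp)
    qed
  qed
qed

section \<open>Smooth maps on open sets\<close>

lemma smooth_onI: "open U \<Longrightarrow> (\<And>k. Ck_on k U f) \<Longrightarrow> smooth_on U f"
  by (simp add: smooth_on_def)

lemma smooth_on_open: "smooth_on U f \<Longrightarrow> open U"
  by (simp add: smooth_on_def)

lemma smooth_on_has_derivative:
  assumes "smooth_on U f" "x \<in> U"
  shows "(f has_derivative frechet_derivative f (at x)) (at x)"
  using assms has_derivative_frechet[of f U x] Ck_on.simps(2) unfolding smooth_on_def by blast

lemma smooth_on_continuous_on: "smooth_on U f \<Longrightarrow> continuous_on U f"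
  by (metis Ck_on.simps(1) smooth_on_def)

lemma smooth_on_frechet_derivative:
  "smooth_on U f \<Longrightarrow> smooth_on U (\<lambda>x. frechet_derivative f (at x) v)"
  unfolding smooth_on_def using Ck_on.simps(2) by blast

lemma smooth_on_cong:
  "smooth_on U f \<Longrightarrow> (\<And>x. x \<in> U \<Longrightarrow> f x = g x) \<Longrightarrow> smooth_on U g"
  unfolding smooth_on_def using Ck_on_cong by blast

lemma smooth_on_subset: "smooth_on U f \<Longrightarrow> open V \<Longrightarrow> V \<subseteq> U \<Longrightarrow> smooth_on V f"
  unfolding smooth_on_def using Ck_on_subset by blast

lemma smooth_on_local:
  assumes "open U" "\<And>x. x \<in> U \<Longrightarrow> \<exists>V. x \<in> V \<and> smooth_on V f"
  shows "smooth_on U f"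
  using assms unfolding smooth_on_def by (meson Ck_on_local)

lemma smooth_on_const: "open U \<Longrightarrow> smooth_on U (\<lambda>x. c)"
  by (simp add: smooth_on_def Ck_on_const)

lemma smooth_on_bounded_linear: "open U \<Longrightarrow> bounded_linear f \<Longrightarrow> smooth_on U f"
  by (simp add: smooth_on_def Ck_on_bounded_linear)

lemma smooth_on_compose:
  fixes f :: "'a::real_normed_vector \<Rightarrow> 'b::euclidean_space" and g :: "'b \<Rightarrow> 'c::real_normed_vector"
  assumes "smooth_on V g" "smooth_on U f" "\<And>x. x \<in> U \<Longrightarrow> f x \<in> V"
  shows "smooth_on U (\<lambda>x. g (f x))"
  using assms Ck_on_compose[of U V f _ g] by (simp add: smooth_on_def image_subset_iff)

lemma smooth_on_bilinear:
  assumes "bounded_bilinear B" "smooth_on U f" "smooth_on U g"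
  shows "smooth_on U (\<lambda>x. B (f x) (g x))"
  using assms Ck_on_bilinear[OF _ assms(1), of U _ f g] by (simp add: smooth_on_def)

lemma smooth_on_linear_compose:
  fixes f :: "'a::real_normed_vector \<Rightarrow> 'b::euclidean_space"
  assumes "bounded_linear L" "smooth_on U f"
  shows "smooth_on U (\<lambda>x. L (f x))"
  by (rule smooth_on_compose[OF smooth_on_bounded_linear[OF open_UNIV assms(1)] assms(2)]) simp

lemma smooth_on_add: "smooth_on U f \<Longrightarrow> smooth_on U g \<Longrightarrow> smooth_on U (\<lambda>x. f x + g x)"
  by (simp add: smooth_on_def Ck_on_add)

lemma smooth_on_minus:
  fixes f :: "'a::real_normed_vector \<Rightarrow> 'b::euclidean_space"
  shows "smooth_on U f \<Longrightarrow> smooth_on U (\<lambda>x. - f x)"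
  by (rule smooth_on_linear_compose[OF bounded_linear_minus[OF bounded_linear_ident]])

lemma smooth_on_diff:
  fixes f :: "'a::real_normed_vector \<Rightarrow> 'b::euclidean_space"
  shows "smooth_on U f \<Longrightarrow> smooth_on U g \<Longrightarrow> smooth_on U (\<lambda>x. f x - g x)"
  using smooth_on_add[OF _ smooth_on_minus] by fastforce

lemma smooth_on_id: "open U \<Longrightarrow> smooth_on U (\<lambda>x. x)"
  by (simp add: smooth_on_bounded_linear bounded_linear_ident)

lemma smooth_on_mult:
  fixes f :: "'a::real_normed_vector \<Rightarrow> 'b::real_normed_algebra"
  shows "smooth_on U f \<Longrightarrow> smooth_on U g \<Longrightarrow> smooth_on U (\<lambda>x. f x * g x)"
  using smooth_on_bilinear[OF bounded_bilinear_mult] .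

lemma smooth_on_scaleR: "smooth_on U f \<Longrightarrow> smooth_on U g \<Longrightarrow> smooth_on U (\<lambda>x. f x *\<^sub>R g x)"
  using smooth_on_bilinear[OF bounded_bilinear_scaleR] .

lemma smooth_on_inner: "smooth_on U f \<Longrightarrow> smooth_on U g \<Longrightarrow> smooth_on U (\<lambda>x. f x \<bullet> g x)"
  using smooth_on_bilinear[OF bounded_bilinear_inner] .

lemma smooth_on_fst:
  fixes f :: "'a::real_normed_vector \<Rightarrow> 'b::euclidean_space \<times> 'c::euclidean_space"
  shows "smooth_on U f \<Longrightarrow> smooth_on U (\<lambda>x. fst (f x))"
  by (rule smooth_on_linear_compose[OF bounded_linear_fst])

lemma smooth_on_snd:
  fixes f :: "'a::real_normed_vector \<Rightarrow> 'b::euclidean_space \<times> 'c::euclidean_space"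
  shows "smooth_on U f \<Longrightarrow> smooth_on U (\<lambda>x. snd (f x))"
  by (rule smooth_on_linear_compose[OF bounded_linear_snd])

lemma smooth_on_Pair:
  fixes f :: "'a::real_normed_vector \<Rightarrow> 'b::euclidean_space" and g :: "'a \<Rightarrow> 'c::euclidean_space"
  assumes "smooth_on U f" "smooth_on U g"
  shows "smooth_on U (\<lambda>x. (f x, g x))"
proof -
  \<comment> \<open>A pair is the sum of its images under the two linear embeddings.\<close>
  have "smooth_on U (\<lambda>x. (f x, 0::'c) + (0::'b, g x))"
    by (intro smooth_on_add smooth_on_linear_compose[OF _ assms(1)] smooth_on_linear_compose[OF _ assms(2)]
        bounded_linear_Pair bounded_linear_ident bounded_linear_zero)
  then show ?thesis by simp
qed

section \<open>Smoothness of elementary functions and of flat functions\<close>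

lemma Ck_on_real_SucI:
  fixes f :: "real \<Rightarrow> real"
  assumes "open U" "\<And>x. x \<in> U \<Longrightarrow> (f has_real_derivative f' x) (at x)" "Ck_on k U f'"
  shows "Ck_on (Suc k) U f"
  by (rule Ck_on_SucI[OF assms(1) has_field_derivative_imp_has_derivative[OF assms(2)]])
    (use assms in \<open>auto intro!: Ck_on_bilinear[OF _ bounded_bilinear_mult] Ck_on_const\<close>)

lemma smooth_on_exp: "smooth_on UNIV (exp :: real \<Rightarrow> real)"
proof (rule smooth_onI)
  show "Ck_on k UNIV (exp :: real \<Rightarrow> real)" for k
  proof (induction k)
    case (Suc k)
    show ?case by (rule Ck_on_real_SucI[OF _ DERIV_exp Suc]) simp
  qed (auto intro: continuous_intros)
qed simp

lemma smooth_on_sin: "smooth_on UNIV (sin :: real \<Rightarrow> real)"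
  and smooth_on_cos: "smooth_on UNIV (cos :: real \<Rightarrow> real)"
proof -
  have "Ck_on k UNIV (sin :: real \<Rightarrow> real) \<and> Ck_on k UNIV (cos :: real \<Rightarrow> real)" for k
  proof (induction k)
    case (Suc k)
    have "Ck_on k UNIV (\<lambda>x::real. (-1) * sin x)"
      using Suc by (intro Ck_on_bilinear[OF _ bounded_bilinear_mult] Ck_on_const) auto
    then have "Ck_on k UNIV (\<lambda>x::real. - sin x)" by simp
    then show ?case using Suc Ck_on_real_SucI[OF open_UNIV DERIV_sin] Ck_on_real_SucI[OF open_UNIV DERIV_cos]
      by blast
  qed (auto intro: continuous_intros)
  then show "smooth_on UNIV (sin :: real \<Rightarrow> real)" "smooth_on UNIV (cos :: real \<Rightarrow> real)"
    by (auto simp: smooth_on_def)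
qed

lemma smooth_on_inverse: "smooth_on (- {0}) (inverse :: real \<Rightarrow> real)"
proof (rule smooth_onI)
  show "Ck_on k (- {0}) (inverse :: real \<Rightarrow> real)" for k
  proof (induction k)
    case (Suc k)
    show ?case
    proof (rule Ck_on_real_SucI)
      show "Ck_on k (- {0}) (\<lambda>x::real. (-1) * (inverse x * inverse x))"
        using Suc by (intro Ck_on_bilinear[OF _ bounded_bilinear_mult] Ck_on_const) auto
      show "(inverse has_real_derivative (-1) * (inverse x * inverse x)) (at x)" if "x \<in> - {0}" for x :: real
        using DERIV_inverse[of x UNIV] that by (simp add: power2_eq_square numeral_2_eq_2)
    qed auto
  qed (auto intro!: continuous_intros)
qed auto

lemma smooth_on_sqrt: "smooth_on {0<..} (sqrt :: real \<Rightarrow> real)"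
proof (rule smooth_onI)
  show "Ck_on k {0<..} (sqrt :: real \<Rightarrow> real)" for k
  proof (induction k)
    case (Suc k)
    show ?case
    proof (rule Ck_on_real_SucI)
      have "Ck_on k {0<..} (\<lambda>x::real. inverse (sqrt x))"
        by (rule Ck_on_compose[of _ "- {0}"])
          (use smooth_on_inverse Suc in \<open>auto simp: smooth_on_def\<close>)
      then show "Ck_on k {0<..} (\<lambda>x::real. inverse (sqrt x) * (1/2))"
        by (intro Ck_on_bilinear[OF _ bounded_bilinear_mult] Ck_on_const) auto
      show "(sqrt has_real_derivative inverse (sqrt x) * (1/2)) (at x)" if "x \<in> {0<..}" for x :: real
        using DERIV_real_sqrt[of x] that by simp
    qed auto
  qed (auto intro!: continuous_intros)
qed auto

text \<open>The flat function exp (-1/x) together with its multiples by powers of 1/x. Derivatives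
  of members of this family are linear combinations of members, so one induction over the order
  proves all of them smooth, also at 0.\<close>

definition flatE :: "nat \<Rightarrow> real \<Rightarrow> real" where
  "flatE n x = (if x > 0 then inverse x ^ n * exp (- inverse x) else 0)"

text \<open>With y = 1/x this is the decay of y^n / exp y at infinity.\<close>

lemma tendsto_flatE: "(flatE n \<longlongrightarrow> 0) (at 0)"
proof -
  have "((\<lambda>x::real. inverse x ^ n * exp (- inverse x)) \<longlongrightarrow> 0) (at_right 0)"
    using filterlim_compose[OF tendsto_power_div_exp_0[of n] filterlim_inverse_at_top_right]
    by (simp add: exp_minus divide_inverse)
  then have "(flatE n \<longlongrightarrow> 0) (at_right 0)"
    by (rule Lim_transform_eventually) (auto simp: flatE_def eventually_at_right_less eventually_at_filter)
  moreover have "(flatE n \<longlongrightarrow> 0) (at_left 0)"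
    by (rule Lim_transform_eventually[OF tendsto_const]) (auto simp: flatE_def eventually_at_filter)
  ultimately show ?thesis by (simp add: filterlim_split_at_real)
qed

lemma flatE_has_derivative:
  "(flatE n has_real_derivative flatE (n+2) x - real n * flatE (n+1) x) (at x)"
proof -
  consider "x > 0" | "x < 0" | "x = 0" by linarith
  then show ?thesis
  proof cases
    case 1
    have d: "((\<lambda>x. inverse x ^ n * exp (- inverse x)) has_real_derivative
        flatE (n+2) x - real n * flatE (n+1) x) (at x)"
    proof (cases n)
      case 0
      then show ?thesis using 1
        by (auto intro!: derivative_eq_intros simp: flatE_def field_simps power2_eq_square)
    next
      case (Suc m)
      then show ?thesis using 1
        by (auto intro!: derivative_eq_intros simp: flatE_def field_simps power2_eq_square)
          (cases m; simp)
    qed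
    show ?thesis
      by (rule DERIV_cong_ev[OF refl _ refl, THEN iffD2, OF _ d])
        (use 1 eventually_nhds_in_open[of "{0<..}" x] in \<open>auto simp: flatE_def elim!: eventually_mono\<close>)
  next
    case 2
    have d: "((\<lambda>x. 0) has_real_derivative flatE (n+2) x - real n * flatE (n+1) x) (at x)"
      using 2 by (auto simp: flatE_def)
    show ?thesis
      by (rule DERIV_cong_ev[OF refl _ refl, THEN iffD2, OF _ d])
        (use 2 eventually_nhds_in_open[of "{..<0}" x] in \<open>auto simp: flatE_def elim!: eventually_mono\<close>)
  next
    case 3
    \<comment> \<open>The difference quotient of \<open>flatE n\<close> at 0 is
      \<open>flatE (Suc n)\<close> itself.\<close>
    have "((\<lambda>h. (flatE n (0 + h) - flatE n 0) / h) \<longlongrightarrow> 0) (at 0)"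
      by (rule Lim_transform_eventually[OF tendsto_flatE[of "Suc n"]])
        (auto simp: flatE_def field_simps eventually_at_filter)
    then show ?thesis using 3 by (simp add: DERIV_def flatE_def)
  qed
qed

lemma smooth_on_flatE: "smooth_on UNIV (flatE n)"
proof (rule smooth_onI)
  show "Ck_on k UNIV (flatE n)" for k
  proof (induction k arbitrary: n)
    case 0
    show ?case using flatE_has_derivative DERIV_isCont
      by (simp add: continuous_on_eq_continuous_at) blast
  next
    case (Suc k)
    have "Ck_on k UNIV (\<lambda>x. flatE (n+2) x + (- real n) * flatE (n+1) x)"
      by (intro Ck_on_add Ck_on_bilinear[OF _ bounded_bilinear_mult] Ck_on_const Suc open_UNIV)
    then show ?case using Ck_on_real_SucI[OF open_UNIV flatE_has_derivative] by simp
  qed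
qed simp

section \<open>Contact isotopies and the universal cover\<close>

abbreviation extends_to :: "(real \<Rightarrow> complex^'n \<Rightarrow> complex^'n) \<Rightarrow> (real \<times> (complex^'n) \<Rightarrow> complex^'n) \<Rightarrow> bool" where
  "extends_to p P \<equiv> smooth_ext ({0..1} \<times> Sph) (\<lambda>(t,x). p t x) P"

lemma smooth_extI: "smooth_on U f \<Longrightarrow> A \<subseteq> U \<Longrightarrow> smooth_ext A f f"
  unfolding smooth_ext_def using smooth_on_open by blast

lemma smooth_ext_UNIV: "smooth_on UNIV f \<Longrightarrow> smooth_ext A f f"
  using smooth_extI by blast

lemma smooth_ext_cong: "smooth_ext A f g \<Longrightarrow> (\<And>x. x \<in> A \<Longrightarrow> f x = f' x) \<Longrightarrow> smooth_ext A f' g"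
  by (simp add: smooth_ext_def)

lemma smooth_ext_compose:
  fixes f :: "'a::real_normed_vector \<Rightarrow> 'b::euclidean_space" and g :: "'b \<Rightarrow> 'c::real_normed_vector"
  assumes "smooth_ext B g G" "smooth_ext A f F" "\<And>x. x \<in> A \<Longrightarrow> f x \<in> B"
  shows "smooth_ext A (\<lambda>x. g (f x)) (\<lambda>x. G (F x))"
proof -
  obtain U where U: "open U" "A \<subseteq> U" "smooth_on U F" "\<forall>x\<in>A. F x = f x"
    using assms(2) by (auto simp: smooth_ext_def)
  obtain V where V: "open V" "B \<subseteq> V" "smooth_on V G" "\<forall>x\<in>B. G x = g x"
    using assms(1) by (auto simp: smooth_ext_def)
  have "open (F -` V \<inter> U)"
    using continuous_on_open_vimage[OF U(1)] smooth_on_continuous_on[OF U(3)] V(1) by blast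
  then have o: "open (U \<inter> F -` V)" by (simp add: Int_commute)
  have "smooth_on (U \<inter> F -` V) (\<lambda>x. G (F x))"
    by (rule smooth_on_compose[OF V(3) smooth_on_subset[OF U(3) o]]) auto
  moreover have "A \<subseteq> U \<inter> F -` V" using U V assms(3) by fastforce
  ultimately show ?thesis using o U V assms(3) unfolding smooth_ext_def by fastforce
qed

lemma smooth_ext_binary:
  assumes "smooth_ext A f F" "smooth_ext A g G"
    and "\<And>U. smooth_on U F \<Longrightarrow> smooth_on U G \<Longrightarrow> smooth_on U (\<lambda>x. B (F x) (G x))"
  shows "smooth_ext A (\<lambda>x. B (f x) (g x)) (\<lambda>x. B (F x) (G x))"
proof -
  obtain U where U: "open U" "A \<subseteq> U" "smooth_on U F" "\<forall>x\<in>A. F x = f x"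
    using assms(1) by (auto simp: smooth_ext_def)
  obtain V where V: "open V" "A \<subseteq> V" "smooth_on V G" "\<forall>x\<in>A. G x = g x"
    using assms(2) by (auto simp: smooth_ext_def)
  have "smooth_on (U \<inter> V) (\<lambda>x. B (F x) (G x))"
    by (rule assms(3)) (use U V in \<open>auto intro: smooth_on_subset\<close>)
  then show ?thesis using U V unfolding smooth_ext_def
    by (intro exI[of _ "U \<inter> V"]) auto
qed

lemma smooth_ext_Pair:
  fixes F :: "'a::real_normed_vector \<Rightarrow> 'b::euclidean_space" and G :: "'a \<Rightarrow> 'c::euclidean_space"
  shows "smooth_ext A f F \<Longrightarrow> smooth_ext A g G \<Longrightarrow> smooth_ext A (\<lambda>x. (f x, g x)) (\<lambda>x. (F x, G x))"
  by (rule smooth_ext_binary) (simp_all add: smooth_on_Pair)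

lemma smooth_ext_add:
  "smooth_ext A f F \<Longrightarrow> smooth_ext A g G \<Longrightarrow> smooth_ext A (\<lambda>x. f x + g x) (\<lambda>x. F x + G x)"
  by (rule smooth_ext_binary) (simp_all add: smooth_on_add)

lemma smooth_ext_diff:
  fixes F :: "'a::real_normed_vector \<Rightarrow> 'b::euclidean_space"
  shows "smooth_ext A f F \<Longrightarrow> smooth_ext A g G \<Longrightarrow> smooth_ext A (\<lambda>x. f x - g x) (\<lambda>x. F x - G x)"
  by (rule smooth_ext_binary) (simp_all add: smooth_on_diff)

lemma smooth_ext_has_derivative:
  assumes "smooth_ext A f F" "x \<in> A"
  shows "(F has_derivative frechet_derivative F (at x)) (at x)"
  using assms smooth_on_has_derivative[of _ F x] unfolding smooth_ext_def by blast

lemma smooth_on_map_fst: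
  assumes "smooth_on UNIV \<beta>"
  shows "smooth_on UNIV (\<lambda>(t::real, x::'a::euclidean_space). (\<beta> t :: real, x))"
  unfolding case_prod_unfold
  by (intro smooth_on_Pair smooth_on_compose[OF assms] smooth_on_fst smooth_on_snd smooth_on_id open_UNIV UNIV_I)

text \<open>\<open>contact_path\<close> freed from its starting point: the homotopy in
  \<open>cls_conj\<close> is built from families such as \<open>a (f s t)\<close>, which begin at
  \<open>a s\<close> and not at the identity.\<close>

definition contact_family :: "(real \<Rightarrow> complex^'n \<Rightarrow> complex^'n) \<Rightarrow> bool" where
  "contact_family p \<longleftrightarrow>
     (\<forall>t\<in>{0..1}. \<forall>x\<in>Sph. p t (- x) = - p t x) \<and>
     (\<forall>t\<in>{0..1}. bij_betw (p t) Sph Sph \<and> (\<exists>g. smooth_ext Sph (inv_into Sph (p t)) g)) \<and>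
     (\<exists>P. extends_to p P \<and>
        (\<forall>t\<in>{0..1}. \<forall>x\<in>Sph. \<forall>v. inner x v = 0 \<and> lam0 x v = 0 \<longrightarrow>
            lam0 (p t x) (frechet_derivative P (at (t,x)) (0,v)) = 0))"

lemma contact_path_iff: "contact_path p \<longleftrightarrow> (\<forall>x\<in>Sph. p 0 x = x) \<and> contact_family p"
  by (simp add: contact_path_def contact_family_def)

lemma contact_path_family: "contact_path p \<Longrightarrow> contact_family p"
  by (simp add: contact_path_iff)

lemma contact_family_Sph:
  "contact_family p \<Longrightarrow> t \<in> {0..1} \<Longrightarrow> x \<in> Sph \<Longrightarrow> p t x \<in> Sph"
  using bij_betwE[of "p t" Sph Sph] by (simp add: contact_family_def)

lemma contact_family_smooth:
  assumes "contact_family p"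
  obtains P where "extends_to p P"
proof -
  have "\<exists>P. extends_to p P"
    using assms unfolding contact_family_def by blast
  then show ?thesis using that by blast
qed

text \<open>Follow the great circle through \<open>x\<close> in direction \<open>v\<close> and
  differentiate the constant norm of its image. The contact condition tests only vectors tangent to
  the sphere, so composing isotopies requires that an extension sends tangent vectors to tangent
  vectors.\<close>

lemma Sph_tangent:
  fixes F :: "real \<times> (complex^'n) \<Rightarrow> complex^'n"
  assumes "(F has_derivative F') (at (t, x))" "x \<in> Sph" "inner x v = 0"
    and "\<And>y. y \<in> Sph \<Longrightarrow> F (t, y) \<in> Sph"
  shows "inner (F (t, x)) (F' (0, v)) = 0"
proof (cases "v = 0")
  case True
  then show ?thesis using linear_0[OF has_derivative_linear[OF assms(1)]] by (simp add: zero_prod_def)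
next
  case False
  define g where "g s = cos (norm v * s) *\<^sub>R x + (sin (norm v * s) / norm v) *\<^sub>R v" for s :: real
  have nx: "inner x x = 1" using assms(2) by (simp add: Sph_def norm_eq_sqrt_inner)
  have "inner (g s) (g s) = 1" for s
  proof -
    have "inner (g s) (g s) = (cos (norm v * s))\<^sup>2 * inner x x + (sin (norm v * s) / norm v)\<^sup>2 * inner v v"
      using assms(3) by (simp add: g_def inner_add_left inner_add_right inner_commute power2_eq_square)
    also have "\<dots> = 1" using False nx by (simp add: dot_square_norm power_divide)
    finally show ?thesis .
  qed
  then have g1: "g s \<in> Sph" for s by (simp add: Sph_def norm_eq_sqrt_inner)
  have g0: "g 0 = x" by (simp add: g_def)
  have dg: "(g has_vector_derivative v) (at 0)"
    unfolding g_def using False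
    by (auto intro!: derivative_eq_intros has_vector_derivative_real_field simp: field_simps)
  have "((\<lambda>s. (t, g s)) has_derivative (\<lambda>s. (0, s *\<^sub>R v))) (at 0)"
    using dg by (intro has_derivative_Pair has_derivative_const) (simp add: has_vector_derivative_def)
  from has_derivative_compose[OF this, of F F'] assms(1) g0
  have "((\<lambda>s. F (t, g s)) has_derivative (\<lambda>s. F' (0, s *\<^sub>R v))) (at 0)" by simp
  then have "((\<lambda>s. inner (F (t, g s)) (F (t, g s))) has_derivative
     (\<lambda>s. inner (F (t, g 0)) (F' (0, s *\<^sub>R v)) + inner (F' (0, s *\<^sub>R v)) (F (t, g 0)))) (at 0)"
    by (intro has_derivative_inner)
  moreover have "inner (F (t, g s)) (F (t, g s)) = 1" for s
    using assms(4)[OF g1] by (simp add: Sph_def norm_eq_sqrt_inner)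
  ultimately have "((\<lambda>s::real. 1::real) has_derivative
     (\<lambda>s. inner (F (t, g 0)) (F' (0, s *\<^sub>R v)) + inner (F' (0, s *\<^sub>R v)) (F (t, g 0)))) (at 0)" by simp
  then have "(\<lambda>s. inner (F (t, g 0)) (F' (0, s *\<^sub>R v)) + inner (F' (0, s *\<^sub>R v)) (F (t, g 0))) = (\<lambda>s. 0)"
    using has_derivative_unique[OF _ has_derivative_const] by blast
  then have "inner (F (t, g 0)) (F' (0, 1 *\<^sub>R v)) + inner (F' (0, 1 *\<^sub>R v)) (F (t, g 0)) = 0" by meson
  then show ?thesis using g0 by (simp add: inner_commute)
qed

lemma contact_family_compose:
  assumes p: "contact_family p" and q: "contact_family q"
  shows "contact_family (\<lambda>t x. p t (q t x))"
proof -
  obtain P where P: "extends_to p P"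
      "\<And>t x v. t\<in>{0..1} \<Longrightarrow> x\<in>Sph \<Longrightarrow> inner x v = 0 \<Longrightarrow> lam0 x v = 0 \<Longrightarrow>
            lam0 (p t x) (frechet_derivative P (at (t,x)) (0,v)) = 0"
    using p unfolding contact_family_def by blast
  obtain Q where Q: "extends_to q Q"
      "\<And>t x v. t\<in>{0..1} \<Longrightarrow> x\<in>Sph \<Longrightarrow> inner x v = 0 \<Longrightarrow> lam0 x v = 0 \<Longrightarrow>
            lam0 (q t x) (frechet_derivative Q (at (t,x)) (0,v)) = 0"
    using q unfolding contact_family_def by blast
  have Qv: "Q (t, x) = q t x" if "t \<in> {0..1}" "x \<in> Sph" for t x
    using Q(1) that by (auto simp: smooth_ext_def)
  let ?R = "\<lambda>y. P (fst y, Q y)"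
  have R: "smooth_ext ({0..1} \<times> Sph) (\<lambda>(t,x). p t (q t x)) ?R"
  proof (rule smooth_ext_cong)
    show "smooth_ext ({0..1} \<times> Sph) (\<lambda>y. (\<lambda>(t,x). p t x) (fst y, (\<lambda>(t,x). q t x) y)) ?R"
    proof (rule smooth_ext_compose[OF P(1)])
      show "smooth_ext ({0..1} \<times> Sph) (\<lambda>y. (fst y, (\<lambda>(t,x). q t x) y)) (\<lambda>y. (fst y, Q y))"
        by (rule smooth_ext_Pair[OF smooth_ext_UNIV[OF smooth_on_fst[OF smooth_on_id]] Q(1)]) auto
    qed (use contact_family_Sph[OF q] in auto)
  qed auto
  have "lam0 (p t (q t x)) (frechet_derivative ?R (at (t,x)) (0,v)) = 0"
    if t: "t \<in> {0..1}" and x: "x \<in> Sph" and v: "inner x v = 0" "lam0 x v = 0" for t x v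
  proof -
    have qx: "q t x \<in> Sph" using contact_family_Sph[OF q] t x by auto
    have dQ: "(Q has_derivative frechet_derivative Q (at (t,x))) (at (t,x))"
      using smooth_ext_has_derivative[OF Q(1)] t x by auto
    have dP: "(P has_derivative frechet_derivative P (at (t, q t x))) (at (t, Q (t,x)))"
      using smooth_ext_has_derivative[OF P(1)] t qx Qv[OF t x] by auto
    have "((\<lambda>y. (fst y, Q y)) has_derivative (\<lambda>u. (fst u, frechet_derivative Q (at (t,x)) u))) (at (t,x))"
      by (intro has_derivative_Pair has_derivative_fst has_derivative_ident dQ)
    from has_derivative_compose[OF this, of P] dP
    have "(?R has_derivative (\<lambda>u. frechet_derivative P (at (t, q t x)) (fst u, frechet_derivative Q (at (t,x)) u))) (at (t,x))"
      by simp
    from fun_cong[OF frechet_derivative_at[OF this], of "(0,v)"]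
    have e: "frechet_derivative ?R (at (t,x)) (0,v)
        = frechet_derivative P (at (t, q t x)) (0, frechet_derivative Q (at (t,x)) (0,v))"
      by simp
    \<comment> \<open>The contact condition of \<open>p\<close> may be applied to the image vector
      only once this vector is known to be tangent to the sphere at \<open>q t x\<close>.\<close>
    have "inner (q t x) (frechet_derivative Q (at (t,x)) (0,v)) = 0"
      using Sph_tangent[OF dQ x v(1)] Qv[OF t] contact_family_Sph[OF q t] x by simp
    then show ?thesis unfolding e using P(2)[OF t qx] Q(2)[OF t x v] by blast
  qed
  moreover have "bij_betw (\<lambda>x. p t (q t x)) Sph Sph \<and>
      (\<exists>g. smooth_ext Sph (inv_into Sph (\<lambda>x. p t (q t x))) g)" if t: "t \<in> {0..1}" for t
  proof -
    have bp: "bij_betw (p t) Sph Sph" and bq: "bij_betw (q t) Sph Sph"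
      using p q t unfolding contact_family_def by blast+
    obtain g1 where g1: "smooth_ext Sph (inv_into Sph (p t)) g1"
      using p t unfolding contact_family_def by blast
    obtain g2 where g2: "smooth_ext Sph (inv_into Sph (q t)) g2"
      using q t unfolding contact_family_def by blast
    have "smooth_ext Sph (inv_into Sph (\<lambda>x. p t (q t x))) (\<lambda>x. g2 (g1 x))"
    proof (rule smooth_ext_cong[OF smooth_ext_compose[OF g2 g1]])
      show "inv_into Sph (p t) x \<in> Sph" if "x \<in> Sph" for x
        by (metis bij_betw_imp_surj_on bp inv_into_into that)
      show "inv_into Sph (q t) (inv_into Sph (p t) x) = inv_into Sph (\<lambda>x. p t (q t x)) x" if "x \<in> Sph" for x
        using inv_into_comp[of "p t" "q t" Sph x] bp bq that by (simp add: bij_betw_def o_def)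
    qed
    moreover have "bij_betw (\<lambda>x. p t (q t x)) Sph Sph"
      using bij_betw_trans[OF bq bp] by (simp add: o_def)
    ultimately show ?thesis by blast
  qed
  moreover have "p t (q t (- x)) = - p t (q t x)" if "t \<in> {0..1}" "x \<in> Sph" for t x
    using p q contact_family_Sph[OF q that] that unfolding contact_family_def by simp
  ultimately show ?thesis unfolding contact_family_def using R by blast
qed

lemma contact_path_compose:
  "contact_path p \<Longrightarrow> contact_path q \<Longrightarrow> contact_path (\<lambda>t x. p t (q t x))"
  using contact_family_compose[of p q] by (simp add: contact_path_iff)

lemma contact_family_reparam:
  assumes p: "contact_family p" and b: "smooth_on UNIV \<beta>" "\<And>t. t \<in> {0..1} \<Longrightarrow> \<beta> t \<in> {0..1}"
  shows "contact_family (\<lambda>t. p (\<beta> t))"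
proof -
  obtain P where P: "extends_to p P"
      "\<And>t x v. t\<in>{0..1} \<Longrightarrow> x\<in>Sph \<Longrightarrow> inner x v = 0 \<Longrightarrow> lam0 x v = 0 \<Longrightarrow>
            lam0 (p t x) (frechet_derivative P (at (t,x)) (0,v)) = 0"
    using p unfolding contact_family_def by blast
  let ?R = "\<lambda>y. P ((\<lambda>(t, x). (\<beta> t, x)) y)"
  have R: "smooth_ext ({0..1} \<times> Sph) (\<lambda>(t,x). p (\<beta> t) x) ?R"
    by (rule smooth_ext_cong[OF smooth_ext_compose[OF P(1) smooth_ext_UNIV[OF smooth_on_map_fst[OF b(1)]]]])
      (use b in auto)
  have "lam0 (p (\<beta> t) x) (frechet_derivative ?R (at (t,x)) (0,v)) = 0"
    if t: "t \<in> {0..1}" and x: "x \<in> Sph" and v: "inner x v = 0" "lam0 x v = 0" for t x v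
  proof -
    have bt: "\<beta> t \<in> {0..1}" using b(2) t by blast
    have "(\<beta> has_derivative frechet_derivative \<beta> (at t)) (at t)"
      using smooth_on_has_derivative[OF b(1)] by auto
    then have "(\<beta> has_derivative frechet_derivative \<beta> (at t)) (at (fst (t,x)))" by simp
    from has_derivative_compose[OF has_derivative_fst[OF has_derivative_ident] this]
    have "((\<lambda>(t, x). (\<beta> t, x)) has_derivative (\<lambda>u. (frechet_derivative \<beta> (at t) (fst u), snd u))) (at (t,x))"
      unfolding case_prod_unfold by (intro has_derivative_Pair has_derivative_snd has_derivative_ident)
    from has_derivative_compose[OF this, of P] smooth_ext_has_derivative[OF P(1), of "(\<beta> t, x)"]
    have "(?R has_derivative (\<lambda>u. frechet_derivative P (at (\<beta> t, x)) (frechet_derivative \<beta> (at t) (fst u), snd u))) (at (t,x))"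
      using bt x by simp
    from fun_cong[OF frechet_derivative_at[OF this], of "(0,v)"]
    have e: "frechet_derivative ?R (at (t,x)) (0,v)
        = frechet_derivative P (at (\<beta> t, x)) (frechet_derivative \<beta> (at t) 0, v)"
      by simp
    have "frechet_derivative \<beta> (at t) 0 = 0"
      using linear_0[OF has_derivative_linear[OF smooth_on_has_derivative[OF b(1)]]] by simp
    then show ?thesis unfolding e using P(2)[OF bt x v] by simp
  qed
  then show ?thesis using p R b(2) unfolding contact_family_def by blast
qed

section \<open>Homotopy classes and their product\<close>

lemma path_homotopic_cong:
  assumes "contact_path p" "\<And>t x. t \<in> {0..1} \<Longrightarrow> x \<in> Sph \<Longrightarrow> p t x = q t x"
  shows "path_homotopic p q"
proof -
  obtain P where P: "extends_to p P"
    using assms unfolding contact_path_def by blast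
  have "smooth_ext ({0..1} \<times> {0..1} \<times> Sph) (\<lambda>(s::real,t,x). p t x) (\<lambda>y. P (snd y))"
    by (rule smooth_ext_cong[OF smooth_ext_compose[OF P smooth_ext_UNIV[OF smooth_on_snd[OF smooth_on_id]]]])
      auto
  then show ?thesis unfolding path_homotopic_def using assms by (intro exI[of _ "\<lambda>s. p"]) auto
qed

lemma path_homotopic_sym:
  fixes p q :: "real \<Rightarrow> complex^'n \<Rightarrow> complex^'n"
  assumes "path_homotopic p q"
  shows "path_homotopic q p"
proof -
  obtain K :: "real \<Rightarrow> real \<Rightarrow> complex^'n \<Rightarrow> complex^'n" and G where K: "\<forall>s\<in>{0..1}. contact_path (K s)"
     "\<forall>t\<in>{0..1}. \<forall>x\<in>Sph. K 0 t x = p t x \<and> K 1 t x = q t x"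
     "\<forall>s\<in>{0..1}. \<forall>x\<in>Sph. K s 1 x = p 1 x"
     and G: "smooth_ext ({0..1} \<times> {0..1} \<times> Sph) (\<lambda>(s,t,x). K s t x) G"
    using assms unfolding path_homotopic_def by blast
  have "smooth_on UNIV (\<lambda>s::real. 1 - s)"
    by (intro smooth_on_diff smooth_on_const smooth_on_id) auto
  note smooth_ext_UNIV[OF smooth_on_map_fst[OF this]]
  from smooth_ext_compose[OF G this]
  have "smooth_ext ({0..1} \<times> {0..1} \<times> Sph) (\<lambda>(s,t,x). K (1 - s) t x) (\<lambda>y. G ((\<lambda>(s,x). (1-s,x)) y))"
    by (rule smooth_ext_cong) auto
  moreover have "K (1 - s) 1 x = q 1 x" if "s \<in> {0..1}" "x \<in> Sph" for s x
    using K that by (metis atLeastAtMost_iff diff_ge_0_iff_ge diff_le_eq le_add_same_cancel1 order_refl zero_le_one)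
  ultimately show ?thesis unfolding path_homotopic_def using K
    by (intro exI[of _ "\<lambda>s. K (1 - s)"]) auto
qed

text \<open>The standard monotone cutoff, constant 0 up to time 0 and constant 1 from time 1 on. The
  two flat functions in the denominator never vanish together.\<close>

definition smooth_step :: "real \<Rightarrow> real" where
  "smooth_step t = flatE 0 t * inverse (flatE 0 t + flatE 0 (1 - t))"

lemma flatE_nonneg: "flatE n t \<ge> 0" by (simp add: flatE_def)

lemma flatE_pos: "t > 0 \<Longrightarrow> flatE n t > 0" by (simp add: flatE_def)

lemma flatE_zero: "t \<le> 0 \<Longrightarrow> flatE n t = 0" by (simp add: flatE_def)

lemma smooth_step_denom: "flatE 0 t + flatE 0 (1 - t) > 0"
  using flatE_nonneg[of 0 t] flatE_nonneg[of 0 "1-t"] flatE_pos[of t 0] flatE_pos[of "1-t" 0]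
  by (cases "t > 0") auto

lemma smooth_on_smooth_step: "smooth_on UNIV smooth_step"
proof -
  have "smooth_on UNIV (\<lambda>t. flatE 0 (1 - t))"
    by (intro smooth_on_compose[OF smooth_on_flatE] smooth_on_diff smooth_on_const smooth_on_id) auto
  then have "smooth_on UNIV (\<lambda>t. flatE 0 t * inverse (flatE 0 t + flatE 0 (1 - t)))"
    using smooth_step_denom
    by (intro smooth_on_mult smooth_on_flatE smooth_on_compose[OF smooth_on_inverse] smooth_on_add)
      (auto simp: less_imp_neq[THEN not_sym])
  then show ?thesis by (simp add: smooth_step_def[abs_def])
qed

lemma smooth_step_0: "t \<le> 0 \<Longrightarrow> smooth_step t = 0"
  by (simp add: smooth_step_def flatE_zero)

lemma smooth_step_1: "t \<ge> 1 \<Longrightarrow> smooth_step t = 1"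
  using smooth_step_denom[of t] by (simp add: smooth_step_def flatE_zero)

lemma smooth_step_range: "0 \<le> smooth_step t" "smooth_step t \<le> 1"
  using smooth_step_denom[of t] flatE_nonneg[of 0 t] flatE_nonneg[of 0 "1-t"]
  by (simp_all add: smooth_step_def divide_inverse[symmetric] divide_le_eq)

text \<open>In the quotient rule the mixed terms cancel and a sum of products of flat functions
  remains. Monotonicity is what keeps reparametrised Hamiltonians non-negative.\<close>

lemma smooth_step_deriv_nonneg:
  assumes "(smooth_step has_real_derivative D) (at t)"
  shows "D \<ge> 0"
proof -
  let ?E = "flatE 0 t + flatE 0 (1 - t)"
  have d1: "(flatE 0 has_real_derivative flatE 2 t) (at t)"
    using flatE_has_derivative[of 0 t] by (simp add: numeral_2_eq_2)
  have "(flatE 0 has_real_derivative flatE 2 (1 - t)) (at (1 - t))"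
    using flatE_has_derivative[of 0 "1-t"] by (simp add: numeral_2_eq_2)
  then have d2: "((\<lambda>t. flatE 0 (1 - t)) has_real_derivative - flatE 2 (1 - t)) (at t)"
    using DERIV_chain2[of "flatE 0" "flatE 2 (1-t)" "\<lambda>t. 1 - t" t "-1" UNIV] DERIV_diff[OF DERIV_const DERIV_ident, of 1 t UNIV]
    by simp
  have "((\<lambda>t. flatE 0 t / (flatE 0 t + flatE 0 (1 - t))) has_real_derivative
      (flatE 2 t * ?E - flatE 0 t * (flatE 2 t + - flatE 2 (1 - t))) / (?E * ?E)) (at t)"
    by (intro DERIV_divide DERIV_add d1 d2) (use smooth_step_denom[of t] in auto)
  then have "D = (flatE 2 t * ?E - flatE 0 t * (flatE 2 t + - flatE 2 (1 - t))) / (?E * ?E)"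
    using assms DERIV_unique by (fastforce simp: smooth_step_def[abs_def] divide_inverse)
  also have "\<dots> = (flatE 2 t * flatE 0 (1 - t) + flatE 0 t * flatE 2 (1 - t)) / (?E * ?E)"
    by (simp add: algebra_simps)
  also have "\<dots> \<ge> 0"
    by (intro divide_nonneg_nonneg add_nonneg_nonneg mult_nonneg_nonneg flatE_nonneg)
  finally show ?thesis .
qed

lemma smooth_on_affine: "smooth_on UNIV (\<lambda>t::real. a * t + b :: real)"
  by (intro smooth_on_add smooth_on_mult smooth_on_const smooth_on_id open_UNIV)

lemma smooth_on_affine_step: "smooth_on UNIV (\<lambda>t. smooth_step (a * t + b))"
  by (rule smooth_on_compose[OF smooth_on_smooth_step smooth_on_affine]) simp

text \<open>The extensions of the two homotopies agree only on the sphere, so they cannot be glued piecewise;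
  instead they are added and the common middle path is subtracted.\<close>

lemma path_homotopic_trans:
  fixes p q r :: "real \<Rightarrow> complex^'n \<Rightarrow> complex^'n"
  assumes "path_homotopic p q" "path_homotopic q r"
  shows "path_homotopic p r"
proof -
  obtain K :: "real \<Rightarrow> real \<Rightarrow> complex^'n \<Rightarrow> complex^'n" and G where K: "\<forall>s\<in>{0..1}. contact_path (K s)"
     "\<forall>t\<in>{0..1}. \<forall>x\<in>Sph. K 0 t x = p t x \<and> K 1 t x = q t x"
     "\<forall>s\<in>{0..1}. \<forall>x\<in>Sph. K s 1 x = p 1 x"
     and G: "smooth_ext ({0..1} \<times> {0..1} \<times> Sph) (\<lambda>(s,t,x). K s t x) G"
    using assms(1) unfolding path_homotopic_def by blast
  obtain L :: "real \<Rightarrow> real \<Rightarrow> complex^'n \<Rightarrow> complex^'n" and H where L: "\<forall>s\<in>{0..1}. contact_path (L s)"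
     "\<forall>t\<in>{0..1}. \<forall>x\<in>Sph. L 0 t x = q t x \<and> L 1 t x = r t x"
     "\<forall>s\<in>{0..1}. \<forall>x\<in>Sph. L s 1 x = q 1 x"
     and H: "smooth_ext ({0..1} \<times> {0..1} \<times> Sph) (\<lambda>(s,t,x). L s t x) H"
    using assms(2) unfolding path_homotopic_def by blast
  define b1 where "b1 s = smooth_step (2 * s + 0)" for s :: real
  define b2 where "b2 s = smooth_step (2 * s + (-1))" for s :: real
  have sb: "smooth_on UNIV b1" "smooth_on UNIV b2" "smooth_on UNIV (\<lambda>s::real. 1::real)"
    unfolding b1_def b2_def by (rule smooth_on_affine_step smooth_on_const open_UNIV)+
  have rng: "b1 s \<in> {0..1}" "b2 s \<in> {0..1}" for s using smooth_step_range by (auto simp: b1_def b2_def)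
  have b12: "b1 s = 1" if "s \<ge> 1/2" for s using that smooth_step_1 by (auto simp: b1_def)
  have b20: "b2 s = 0" if "s \<le> 1/2" for s using that smooth_step_0 by (auto simp: b2_def)
  have b0: "b1 0 = 0" "b2 1 = 1" using smooth_step_1 smooth_step_0 by (auto simp: b2_def b1_def)
  define M where "M s = (if s \<le> 1/2 then K (b1 s) else L (b2 s))" for s
  let ?A = "{0..1} \<times> {0..1} \<times> Sph :: (real \<times> real \<times> (complex^'n)) set"
  have e: "smooth_ext ?A (\<lambda>y. (\<lambda>(s,t,x). K s t x) ((\<lambda>(s,x). (b s, x)) y)) (\<lambda>y. G ((\<lambda>(s,x). (b s, x)) y))"
    if "smooth_on UNIV b" "\<And>s. s \<in> {0..1} \<Longrightarrow> b s \<in> {0..1}" for b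
    by (rule smooth_ext_compose[OF G smooth_ext_UNIV[OF smooth_on_map_fst[OF that(1)]]])
      (use that(2) in \<open>simp add: case_prod_unfold mem_Times_iff\<close>)
  have f: "smooth_ext ?A (\<lambda>y. (\<lambda>(s,t,x). L s t x) ((\<lambda>(s,x). (b s, x)) y)) (\<lambda>y. H ((\<lambda>(s,x). (b s, x)) y))"
    if "smooth_on UNIV b" "\<And>s. s \<in> {0..1} \<Longrightarrow> b s \<in> {0..1}" for b
    by (rule smooth_ext_compose[OF H smooth_ext_UNIV[OF smooth_on_map_fst[OF that(1)]]])
      (use that(2) in \<open>simp add: case_prod_unfold mem_Times_iff\<close>)
  \<comment> \<open>For s \<le> 1/2 the second summand extends \<open>q\<close> since
    \<open>b2 s = 0\<close>, for s \<ge> 1/2 the first one does since \<open>b1 s = 1\<close>. The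
    subtracted term is \<open>G\<close> at parameter 1, which extends \<open>q\<close> as
    well.\<close>
  have "smooth_ext ?A (\<lambda>(s,t,x). M s t x)
      (\<lambda>y. G ((\<lambda>(s,x). (b1 s, x)) y) + H ((\<lambda>(s,x). (b2 s, x)) y) - G ((\<lambda>(s,x). (1, x)) y))"
    by (rule smooth_ext_cong[OF smooth_ext_diff[OF smooth_ext_add[OF e[OF sb(1)] f[OF sb(2)]] e[OF sb(3)]]])
      (use rng K L b12 b20 in \<open>auto simp: M_def\<close>)
  moreover have "contact_path (M s)" if "s \<in> {0..1}" for s
    using K(1) L(1) rng by (auto simp: M_def)
  moreover have "M 0 t x = p t x \<and> M 1 t x = r t x" if "t \<in> {0..1}" "x \<in> Sph" for t x
    using K L that b0 by (auto simp: M_def)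
  moreover have "M s 1 x = p 1 x" if "s \<in> {0..1}" "x \<in> Sph" for s x
  proof -
    have "q 1 x = p 1 x" using K that by (metis atLeastAtMost_iff order_refl zero_le_one)
    then show ?thesis using K L that rng by (auto simp: M_def)
  qed
  ultimately show ?thesis unfolding path_homotopic_def by blast
qed

lemma cls_eqI:
  assumes "path_homotopic p q"
  shows "cls p = cls q"
proof -
  have "path_homotopic p r \<longleftrightarrow> path_homotopic q r" for r
    using path_homotopic_trans[OF assms, of r] path_homotopic_trans[OF path_homotopic_sym[OF assms], of r] by blast
  then show ?thesis by (simp add: cls_def)
qed

lemma cls_cong:
  assumes "contact_path p" "\<And>t x. t \<in> {0..1} \<Longrightarrow> x \<in> Sph \<Longrightarrow> p t x = q t x"
  shows "cls p = cls q"
  using cls_eqI[OF path_homotopic_cong[OF assms]] by simp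

lemma path_homotopic_compose:
  fixes p q p' q' :: "real \<Rightarrow> complex^'n \<Rightarrow> complex^'n"
  assumes "path_homotopic p p'" "path_homotopic q q'" "contact_path q"
  shows "path_homotopic (\<lambda>t x. p t (q t x)) (\<lambda>t x. p' t (q' t x))"
proof -
  obtain K :: "real \<Rightarrow> real \<Rightarrow> complex^'n \<Rightarrow> complex^'n" and G where K: "\<forall>s\<in>{0..1}. contact_path (K s)"
     "\<forall>t\<in>{0..1}. \<forall>x\<in>Sph. K 0 t x = p t x \<and> K 1 t x = p' t x"
     "\<forall>s\<in>{0..1}. \<forall>x\<in>Sph. K s 1 x = p 1 x"
     and G: "smooth_ext ({0..1} \<times> {0..1} \<times> Sph) (\<lambda>(s,t,x). K s t x) G"
    using assms(1) unfolding path_homotopic_def by blast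
  obtain L :: "real \<Rightarrow> real \<Rightarrow> complex^'n \<Rightarrow> complex^'n" and H where L: "\<forall>s\<in>{0..1}. contact_path (L s)"
     "\<forall>t\<in>{0..1}. \<forall>x\<in>Sph. L 0 t x = q t x \<and> L 1 t x = q' t x"
     "\<forall>s\<in>{0..1}. \<forall>x\<in>Sph. L s 1 x = q 1 x"
     and H: "smooth_ext ({0..1} \<times> {0..1} \<times> Sph) (\<lambda>(s,t,x). L s t x) H"
    using assms(2) unfolding path_homotopic_def by blast
  have S: "L s t x \<in> Sph" if "s \<in> {0..1}" "t \<in> {0..1}" "x \<in> Sph" for s t x
    using contact_family_Sph contact_path_family L(1) that by blast
  define J where "J s t x = K s t (L s t x)" for s t x
  let ?A = "{0..1} \<times> {0..1} \<times> Sph :: (real \<times> real \<times> (complex^'n)) set"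
  have "smooth_ext ?A (\<lambda>y. (fst y, fst (snd y), (\<lambda>(s,t,x). L s t x) y)) (\<lambda>y. (fst y, fst (snd y), H y))"
    by (intro smooth_ext_Pair[OF smooth_ext_UNIV smooth_ext_Pair[OF smooth_ext_UNIV H]]
        smooth_on_fst smooth_on_snd smooth_on_id) auto
  then have "smooth_ext ?A (\<lambda>y. (\<lambda>(s,t,x). K s t x) (fst y, fst (snd y), (\<lambda>(s,t,x). L s t x) y))
      (\<lambda>y. G (fst y, fst (snd y), H y))"
    by (rule smooth_ext_compose[OF G]) (use S in auto)
  then have "smooth_ext ?A (\<lambda>(s,t,x). J s t x) (\<lambda>y. G (fst y, fst (snd y), H y))"
    by (rule smooth_ext_cong) (auto simp: J_def)
  moreover have "contact_path (J s)" if "s \<in> {0..1}" for s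
    unfolding J_def[abs_def] using K(1) L(1) that contact_path_compose by blast
  moreover have "J 0 t x = p t (q t x) \<and> J 1 t x = p' t (q' t x)" if "t \<in> {0..1}" "x \<in> Sph" for t x
    using K L S[of 0 t x] S[of 1 t x] that by (auto simp: J_def)
  moreover have "J s 1 x = p 1 (q 1 x)" if "s \<in> {0..1}" "x \<in> Sph" for s x
    using K L S[of s 1 x] that by (auto simp: J_def)
  ultimately show ?thesis unfolding path_homotopic_def by blast
qed

text \<open>The representatives picked by \<open>SOME\<close> are harmless because homotopies of
  both factors can be composed pointwise.\<close>

lemma cmult_cls:
  assumes "contact_path p" "contact_path q"
  shows "cmult (cls p) (cls q) = cls (\<lambda>t x. p t (q t x))"
proof -
  define a where "a = (SOME a. a \<in> cls p)"
  define b where "b = (SOME b. b \<in> cls q)"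
  have "p \<in> cls p" "q \<in> cls q" using assms path_homotopic_cong by (auto simp: cls_def)
  then have "a \<in> cls p" "b \<in> cls q" unfolding a_def b_def by (metis someI)+
  then have "path_homotopic (\<lambda>t x. p t (q t x)) (\<lambda>t x. a t (b t x))"
    using assms path_homotopic_compose by (auto simp: cls_def)
  then show ?thesis unfolding cmult_def a_def[symmetric] b_def[symmetric] using cls_eqI by blast
qed

lemma UCont_iff: "A \<in> UCont \<longleftrightarrow> (\<exists>p. contact_path p \<and> A = cls p)"
  by (auto simp: UCont_def)

text \<open>The straight line from t to \<beta> t stays in the unit interval and fixes 0 and 1, so
  running \<open>p\<close> along it is a homotopy with fixed ends.\<close>

lemma cls_reparam:
  fixes p :: "real \<Rightarrow> complex^'n \<Rightarrow> complex^'n"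
  assumes p: "contact_path p" and b: "smooth_on UNIV \<beta>" "\<And>t. t \<in> {0..1} \<Longrightarrow> \<beta> t \<in> {0..1}" "\<beta> 0 = 0" "\<beta> 1 = 1"
  shows "cls (\<lambda>t. p (\<beta> t)) = cls p"
proof -
  obtain P where P: "extends_to p P"
    by (rule contact_family_smooth[OF contact_path_family[OF p]])
  define f where "f s t = (1 - s) * t + s * \<beta> t" for s t :: real
  have f: "f s t \<in> {0..1}" if "s \<in> {0..1}" "t \<in> {0..1}" for s t
  proof -
    have "0 \<le> f s t" using that b(2)[OF that(2)] by (auto simp: f_def)
    moreover have "f s t \<le> (1 - s) * 1 + s * 1"
      unfolding f_def by (intro add_mono mult_left_mono) (use that b(2)[OF that(2)] in auto)
    ultimately show ?thesis by simp
  qed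
  have sf: "smooth_on UNIV (f s)" for s
    unfolding f_def by (intro smooth_on_add smooth_on_mult smooth_on_const smooth_on_id b open_UNIV)
  have "smooth_on UNIV (\<lambda>y :: real \<times> real \<times> (complex^'n). (f (fst y) (fst (snd y)), snd (snd y)))"
    unfolding f_def by (intro smooth_on_Pair smooth_on_add smooth_on_mult smooth_on_const smooth_on_id
        smooth_on_diff smooth_on_fst smooth_on_snd smooth_on_compose[OF b(1)] open_UNIV) auto
  from smooth_ext_compose[OF P smooth_ext_UNIV[OF this]]
  have "smooth_ext ({0..1} \<times> {0..1} \<times> Sph) (\<lambda>(s,t,x). p (f s t) x)
     (\<lambda>y. P (f (fst y) (fst (snd y)), snd (snd y)))"
    by (rule smooth_ext_cong) (use f in auto)
  moreover have "contact_path (\<lambda>t. p (f s t))" if "s \<in> {0..1}" for s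
    using p contact_family_reparam[OF contact_path_family[OF p] sf[of s]] f[OF that] b
    by (auto simp: contact_path_iff f_def)
  ultimately have "path_homotopic p (\<lambda>t. p (\<beta> t))"
    unfolding path_homotopic_def by (intro exI[of _ "\<lambda>s t. p (f s t)"]) (use b in \<open>auto simp: f_def\<close>)
  then show ?thesis using cls_eqI by blast
qed

lemma contact_path_reparam:
  assumes p: "contact_path p" and b: "smooth_on UNIV \<beta>" "\<And>t. t \<in> {0..1} \<Longrightarrow> \<beta> t \<in> {0..1}" "\<beta> 0 = 0"
  shows "contact_path (\<lambda>t. p (\<beta> t))"
  using contact_family_reparam[OF contact_path_family[OF p] b(1,2)] p b(3) by (simp add: contact_path_iff)

text \<open>Push the time of the conjugating path towards its end: \<open>f s t\<close> moves from t
  to 1 as s grows. Every intermediate path starts at the identity because \<open>p 0\<close> does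
  and \<open>a s\<close> inverts \<open>b s\<close>, and at t = 1 nothing moves because
  \<open>f s 1 = 1\<close>. Hence conjugation by a class can be carried out with its end map
  alone.\<close>

lemma cls_conj:
  fixes p a b :: "real \<Rightarrow> complex^'n \<Rightarrow> complex^'n"
  assumes p: "contact_path p" and a: "contact_path a" and b: "contact_path b"
    and inv: "\<And>t x. t \<in> {0..1} \<Longrightarrow> x \<in> Sph \<Longrightarrow> a t (b t x) = x"
  shows "contact_path (\<lambda>t x. a 1 (p t (b 1 x)))" (is ?t1)
    "cls (\<lambda>t x. a t (p t (b t x))) = cls (\<lambda>t x. a 1 (p t (b 1 x)))" (is ?t2)
proof -
  obtain P where P: "extends_to p P"
    by (rule contact_family_smooth[OF contact_path_family[OF p]])
  obtain A where A: "extends_to a A"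
    by (rule contact_family_smooth[OF contact_path_family[OF a]])
  obtain B where B: "extends_to b B"
    by (rule contact_family_smooth[OF contact_path_family[OF b]])
  note pab = p[THEN contact_path_family] a[THEN contact_path_family] b[THEN contact_path_family]
  define f where "f s t = (1 - s) * t + s" for s t :: real
  have f: "f s t \<in> {0..1}" if "s \<in> {0..1}" "t \<in> {0..1}" for s t
  proof -
    have "0 \<le> f s t" using that by (auto simp: f_def)
    moreover have "f s t \<le> (1 - s) * 1 + s"
      unfolding f_def by (intro add_mono mult_left_mono) (use that in auto)
    ultimately show ?thesis by simp
  qed
  have sf: "smooth_on UNIV (f s)" for s
    unfolding f_def by (rule smooth_on_affine)
  define J where "J s t x = a (f s t) (p t (b (f s t) x))" for s t x
  have J: "contact_path (J s)" if "s \<in> {0..1}" for s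
  proof -
    have "contact_family (J s)" unfolding J_def[abs_def]
      by (rule contact_family_compose[OF contact_family_reparam[OF pab(2) sf]
            contact_family_compose[OF pab(1) contact_family_reparam[OF pab(3) sf]]])
        (rule f[OF that], assumption)+
    moreover have "J s 0 x = x" if "x \<in> Sph" for x
      using inv[of s x] p contact_family_Sph[OF pab(3), of s x] that \<open>s \<in> {0..1}\<close>
      by (auto simp: J_def f_def contact_path_iff)
    ultimately show ?thesis by (simp add: contact_path_iff)
  qed
  have J1: "J 1 = (\<lambda>t x. a 1 (p t (b 1 x)))" by (intro ext) (simp add: J_def f_def)
  show ?t1 using J[of 1] J1 by simp
  let ?A = "{0..1} \<times> {0..1} \<times> Sph :: (real \<times> real \<times> (complex^'n)) set"
  have sf2: "smooth_on UNIV (\<lambda>y :: real \<times> real \<times> (complex^'n). f (fst y) (fst (snd y)))"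
    unfolding f_def by (intro smooth_on_Pair smooth_on_add smooth_on_mult smooth_on_const smooth_on_id
        smooth_on_diff smooth_on_fst smooth_on_snd open_UNIV)
  have "smooth_on UNIV (\<lambda>y :: real \<times> real \<times> (complex^'n). (f (fst y) (fst (snd y)), snd (snd y)))"
    by (intro smooth_on_Pair sf2 smooth_on_snd smooth_on_id open_UNIV)
  from smooth_ext_compose[OF B smooth_ext_UNIV[OF this]]
  have "smooth_ext ?A (\<lambda>(s,t,x). b (f s t) x) (\<lambda>y. B (f (fst y) (fst (snd y)), snd (snd y)))"
    (is "smooth_ext _ _ ?B") by (rule smooth_ext_cong) (use f in auto)
  then have "smooth_ext ?A (\<lambda>y. (fst (snd y), (\<lambda>(s,t,x). b (f s t) x) y)) (\<lambda>y. (fst (snd y), ?B y))"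
    by (intro smooth_ext_Pair[OF smooth_ext_UNIV] smooth_on_fst smooth_on_snd smooth_on_id) auto
  from smooth_ext_compose[OF P this]
  have "smooth_ext ?A (\<lambda>(s,t,x). p t (b (f s t) x)) (\<lambda>y. P (fst (snd y), ?B y))" (is "smooth_ext _ _ ?P")
    by (rule smooth_ext_cong) (use f contact_family_Sph[OF pab(3)] in auto)
  then have "smooth_ext ?A (\<lambda>y. (f (fst y) (fst (snd y)), (\<lambda>(s,t,x). p t (b (f s t) x)) y))
     (\<lambda>y. (f (fst y) (fst (snd y)), ?P y))"
    by (intro smooth_ext_Pair[OF smooth_ext_UNIV] sf2) auto
  from smooth_ext_compose[OF A this]
  have "smooth_ext ?A (\<lambda>(s,t,x). J s t x) (\<lambda>y. A (f (fst y) (fst (snd y)), ?P y))"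
    by (rule smooth_ext_cong) (use f contact_family_Sph[OF pab(1)] contact_family_Sph[OF pab(3)] in \<open>auto simp: J_def\<close>)
  then have g: "\<exists>G. smooth_ext ?A (\<lambda>(s,t,x). J s t x) G" by blast
  have "path_homotopic (\<lambda>t x. a t (p t (b t x))) (J 1)"
    unfolding path_homotopic_def
  proof (intro exI[of _ J] conjI)
    show "\<forall>s\<in>{0..1}. contact_path (J s)" using J by blast
    show "\<exists>G. smooth_ext ({0..1} \<times> {0..1} \<times> Sph) (\<lambda>(s,t,x). J s t x) G" by (rule g)
  qed (simp_all add: J_def f_def)
  from cls_eqI[OF this] show ?t2 unfolding J1 .
qed

section \<open>Contact Hamiltonians\<close>

lemma lam0_bilinear: "bounded_bilinear lam0"
proof -
  have "bilinear (lam0 :: complex^'n \<Rightarrow> complex^'n \<Rightarrow> real)"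
    unfolding bilinear_def
    by (auto intro!: linearI simp: lam0_def algebra_simps add_divide_distrib diff_divide_distrib sum.distrib sum_subtractf sum_distrib_left sum_distrib_right)
  then show ?thesis by (simp add: bilinear_conv_bounded_bilinear)
qed

lemmas lam0_add_right = bounded_bilinear.add_right[OF lam0_bilinear]
lemmas lam0_scaleR_right = bounded_bilinear.scaleR_right[OF lam0_bilinear]
lemmas lam0_scaleR_left = bounded_bilinear.scaleR_left[OF lam0_bilinear]
lemmas lam0_minus_right = bounded_bilinear.minus_right[OF lam0_bilinear]
lemmas lam0_diff_right = bounded_bilinear.diff_right[OF lam0_bilinear]
lemmas lam0_minus_left = bounded_bilinear.minus_left[OF lam0_bilinear]

lemma lam0_zero_right: "lam0 z 0 = 0"
  using bounded_bilinear.zero_right[OF lam0_bilinear] .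

lemma lam0_self: "lam0 z z = 0"
  by (simp add: lam0_def algebra_simps)

lemma smooth_on_sgn: "smooth_on (- {0}) (sgn :: 'a::euclidean_space \<Rightarrow> 'a)"
proof -
  have "smooth_on (- {0::'a}) (\<lambda>y. inverse (sqrt (y \<bullet> y)))"
    by (intro smooth_on_compose[OF smooth_on_inverse] smooth_on_compose[OF smooth_on_sqrt]
        smooth_on_inner smooth_on_id) auto
  then have "smooth_on (- {0::'a}) (\<lambda>y. inverse (sqrt (y \<bullet> y)) *\<^sub>R y)"
    by (intro smooth_on_scaleR smooth_on_id) auto
  then show ?thesis by (rule smooth_on_cong) (simp add: sgn_div_norm norm_eq_sqrt_inner)
qed

lemma sgn_in_Sph: "z \<noteq> 0 \<Longrightarrow> sgn z \<in> Sph"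
  by (simp add: Sph_def norm_sgn)

text \<open>Normalisation changes a derivative by a scaling and a radial term, and the radial term
  is killed by \<open>lam0_self\<close>. So the contact condition and the sign of the Hamiltonian
  can be checked on homogeneous lifts.\<close>

lemma lam0_sgn_derivative:
  fixes y :: "complex^'n"
  assumes "y \<noteq> 0"
  shows "lam0 (sgn y) (frechet_derivative sgn (at y) u) = lam0 y u / (norm y)\<^sup>2"
proof -
  have d: "((\<lambda>y. inverse (norm y) *\<^sub>R y) has_derivative
     (\<lambda>u. inverse (norm y) *\<^sub>R u + (- (inverse (norm y) * (u \<bullet> sgn y) * inverse (norm y))) *\<^sub>R y)) (at y)"
    using assms by (auto intro!: derivative_eq_intros GDERIV_norm[unfolded gderiv_def])
  have "(sgn has_derivative (\<lambda>u. inverse (norm y) *\<^sub>R u + (- (inverse (norm y) * (u \<bullet> sgn y) * inverse (norm y))) *\<^sub>R y)) (at y)"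
    by (rule has_derivative_transform_within_open[OF d open_UNIV]) (auto simp: sgn_div_norm)
  then have "frechet_derivative sgn (at y) u =
      inverse (norm y) *\<^sub>R u + (- (inverse (norm y) * (u \<bullet> sgn y) * inverse (norm y))) *\<^sub>R y"
    using fun_cong[OF frechet_derivative_at[symmetric], of sgn _ y u] by simp
  then show ?thesis
    by (simp add: lam0_add_right lam0_scaleR_left lam0_scaleR_right lam0_self sgn_div_norm lam0_diff_right
        power2_eq_square divide_inverse)
qed

text \<open>\<open>ham\<close> uses the one-sided derivative at the ends of the unit interval. This
  computes it from a curve that is differentiable on both sides and agrees with the orbit only near
  \<open>t\<close>.\<close>

lemma ham_eqI:
  assumes "t \<in> {0..1}" "(c has_vector_derivative c') (at t)"
    "open S" "t \<in> S" "\<And>s. s \<in> {0..1} \<Longrightarrow> s \<in> S \<Longrightarrow> p s x = c s"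
  shows "ham p t x = lam0 (p t x) c'"
proof -
  have c: "(c has_vector_derivative c') (at t within {0..1})"
    using assms(2) has_vector_derivative_at_within by blast
  obtain e where e: "e > 0" "ball t e \<subseteq> S" using assms open_contains_ball by blast
  have "c s = p s x" if "s \<in> {0..1}" "dist s t < e" for s
  proof -
    have "s \<in> S" using e(2) that(2) by (auto simp: dist_commute)
    then show ?thesis using assms(5) that(1) by simp
  qed
  then have "((\<lambda>s. p s x) has_vector_derivative c') (at t within {0..1})"
    by (rule has_vector_derivative_transform_within[OF c e(1) assms(1)])
  then have "vector_derivative (\<lambda>s. p s x) (at t within {0..1}) = c'"
    using vector_derivative_within_cbox[of 0 1 t "\<lambda>s. p s x" c'] assms(1) by simp
  then show ?thesis by (simp add: ham_def)
qed

lemma smooth_ext_time_derivative: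
  assumes "smooth_ext ({0..1} \<times> Sph) f P" "t \<in> {0..1}" "x \<in> Sph"
  shows "((\<lambda>s. P (s, x)) has_vector_derivative frechet_derivative P (at (t,x)) (1,0)) (at t)"
proof -
  have d: "(P has_derivative frechet_derivative P (at (t,x))) (at (t,x))"
    using smooth_ext_has_derivative[OF assms(1)] assms by auto
  have "((\<lambda>s. (s, x)) has_derivative (\<lambda>s. (s, 0))) (at t)"
    by (intro has_derivative_Pair has_derivative_ident has_derivative_const)
  from has_derivative_compose[OF this, of P, OF d]
  have "((\<lambda>s. P (s, x)) has_derivative (\<lambda>s. frechet_derivative P (at (t,x)) (s, 0))) (at t)" .
  moreover have "(\<lambda>s. frechet_derivative P (at (t,x)) (s, 0)) = (\<lambda>s. s *\<^sub>R frechet_derivative P (at (t,x)) (1, 0))"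
  proof
    fix s
    show "frechet_derivative P (at (t,x)) (s, 0) = s *\<^sub>R frechet_derivative P (at (t,x)) (1, 0)"
      using linear_scale[OF has_derivative_linear[OF d], of s "(1,0)"] by simp
  qed
  ultimately show ?thesis unfolding has_vector_derivative_def by simp
qed

lemma ham_smooth_ext:
  assumes "extends_to p P" "t \<in> {0..1}" "x \<in> Sph"
  shows "ham p t x = lam0 (p t x) (frechet_derivative P (at (t,x)) (1,0))"
  by (rule ham_eqI[OF assms(2) smooth_ext_time_derivative[OF assms] open_UNIV])
    (use assms in \<open>auto simp: smooth_ext_def\<close>)

text \<open>Chain rule in time. The orbit of \<open>y\<close> under \<open>r\<close> has to follow
  the orbit of \<open>x\<close> under \<open>p\<close> only near \<open>t\<close>, which suits paths
  that perform different motions at different times.\<close>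

lemma ham_reparam:
  assumes p: "contact_family p" and b: "(\<beta> has_real_derivative b') (at t)"
    "\<And>t. t \<in> {0..1} \<Longrightarrow> \<beta> t \<in> {0..1}" and t: "t \<in> {0..1}" and x: "x \<in> Sph"
    and S: "open S" "t \<in> S" "\<And>s. s \<in> {0..1} \<Longrightarrow> s \<in> S \<Longrightarrow> r s y = p (\<beta> s) x"
  shows "ham r t y = b' * ham p (\<beta> t) x"
proof -
  obtain P where P: "extends_to p P"
    by (rule contact_family_smooth[OF p])
  have Pv: "P (s, x) = p s x" if "s \<in> {0..1}" for s
    using P that x by (auto simp: smooth_ext_def)
  have "((\<lambda>s. P (s, x)) has_vector_derivative frechet_derivative P (at (\<beta> t,x)) (1,0)) (at (\<beta> t))"
    by (rule smooth_ext_time_derivative[OF P b(2)[OF t] x])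
  from vector_diff_chain_at[OF b(1)[unfolded has_real_derivative_iff_has_vector_derivative] this]
  have d: "((\<lambda>s. P (\<beta> s, x)) has_vector_derivative b' *\<^sub>R frechet_derivative P (at (\<beta> t,x)) (1,0)) (at t)"
    by (simp add: o_def)
  have "ham r t y = lam0 (r t y) (b' *\<^sub>R frechet_derivative P (at (\<beta> t,x)) (1,0))"
    by (rule ham_eqI[OF t d S(1,2)]) (use S(3) Pv b(2) in auto)
  then show ?thesis
    using ham_smooth_ext[OF P b(2)[OF t] x] S(3)[OF t S(2)] by (simp add: lam0_scaleR_right)
qed

section \<open>Non-negative isotopies and their classes\<close>

definition nonneg_ham :: "(real \<Rightarrow> complex^'n \<Rightarrow> complex^'n) \<Rightarrow> bool" where
  "nonneg_ham p \<longleftrightarrow> (\<forall>t\<in>{0..1}. \<forall>x\<in>Sph. ham p t x \<ge> 0)"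

text \<open>Non-negativity is asked of some representative of the class: the pointwise composition
  of two non-negative isotopies is replaced by their concatenation, which is merely homotopic to
  it.\<close>

definition nonneg_cls :: "(real \<Rightarrow> complex^'n \<Rightarrow> complex^'n) \<Rightarrow> bool" where
  "nonneg_cls p \<longleftrightarrow> contact_path p \<and> (\<exists>r. contact_path r \<and> nonneg_ham r \<and> cls r = cls p)"

lemma affine_step_has_derivative:
  assumes "a \<ge> 0"
  shows "\<exists>D\<ge>0. ((\<lambda>t. smooth_step (a * t + b)) has_real_derivative D) (at t)"
proof -
  have "smooth_step differentiable (at (a * t + b))"
    using smooth_on_has_derivative[OF smooth_on_smooth_step] differentiable_def by blast
  then obtain D where D: "(smooth_step has_real_derivative D) (at (a * t + b))"
    using real_differentiable_def by blast
  have "((\<lambda>t. a * t + b) has_real_derivative a) (at t)" by (auto intro!: derivative_eq_intros)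
  from DERIV_chain2[OF D this]
  have "((\<lambda>t. smooth_step (a * t + b)) has_real_derivative D * a) (at t)" .
  moreover have "D * a \<ge> 0" using smooth_step_deriv_nonneg[OF D] assms by simp
  ultimately show ?thesis by blast
qed

text \<open>The concatenation moves along q first and along p afterwards; as the two motions happen at disjoint
  times, no information on the conformal factor of p is needed.\<close>

lemma nonneg_ham_concatenation:
  assumes p: "contact_path p" "nonneg_ham p" and q: "contact_path q" "nonneg_ham q"
  shows "\<exists>r. contact_path r \<and> nonneg_ham r \<and> cls r = cls (\<lambda>t x. p t (q t x))"
proof -
  \<comment> \<open>\<open>q\<close> moves during [0, 1/3] and \<open>p\<close> during [2/3, 1].
    Thanks to the pause every time has an open neighbourhood in which at most one of them
    moves.\<close>
  define b1 where "b1 t = smooth_step (3 * t + (-2))" for t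
  define b2 where "b2 t = smooth_step (3 * t + 0)" for t
  define r where "r t x = p (b1 t) (q (b2 t) x)" for t x
  have sb: "smooth_on UNIV b1" "smooth_on UNIV b2"
    unfolding b1_def b2_def by (rule smooth_on_affine_step)+
  have rng: "b1 t \<in> {0..1}" "b2 t \<in> {0..1}" for t
    using smooth_step_range by (auto simp: b1_def b2_def)
  have e: "b1 0 = 0" "b1 1 = 1" "b2 0 = 0" "b2 1 = 1"
    by (auto simp: b1_def b2_def smooth_step_0 smooth_step_1)
  note pc = contact_path_reparam[OF p(1) sb(1) rng(1) e(1)] cls_reparam[OF p(1) sb(1) rng(1) e(1,2)]
  note qc = contact_path_reparam[OF q(1) sb(2) rng(2) e(3)] cls_reparam[OF q(1) sb(2) rng(2) e(3,4)]
  have "contact_path r" unfolding r_def[abs_def] using contact_path_compose[OF pc(1) qc(1)] .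
  moreover have "cls r = cls (\<lambda>t x. p t (q t x))"
    unfolding r_def[abs_def]
    using cmult_cls[OF pc(1) qc(1)] cmult_cls[OF p(1) q(1)] pc(2) qc(2) by simp
  moreover have "ham r t x \<ge> 0" if t: "t \<in> {0..1}" and x: "x \<in> Sph" for t x
  proof (cases "t < 2/3")
    case True
    obtain D where D: "D \<ge> 0" "(b2 has_real_derivative D) (at t)"
      using affine_step_has_derivative[of 3 0 t] unfolding b2_def[abs_def] by auto
    have "r s x = q (b2 s) x" if "s \<in> {..<2/3}" for s
    proof -
      have "b1 s = 0" using that by (simp add: b1_def smooth_step_0)
      moreover have "q (b2 s) x \<in> Sph" using contact_family_Sph[OF contact_path_family[OF q(1)] rng(2) x] .
      ultimately show ?thesis using p(1) by (simp add: r_def contact_path_def)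
    qed
    then have "ham r t x = D * ham q (b2 t) x"
      by (intro ham_reparam[OF contact_path_family[OF q(1)] D(2) rng(2) t x, of "{..<2/3}"]) (use True in auto)
    then show ?thesis using D q(2) rng x by (auto simp: nonneg_ham_def)
  next
    case False
    obtain D where D: "D \<ge> 0" "(b1 has_real_derivative D) (at t)"
      using affine_step_has_derivative[of 3 "-2" t] unfolding b1_def[abs_def] by auto
    have q1: "q 1 x \<in> Sph" using contact_family_Sph[OF contact_path_family[OF q(1)] _ x] by auto
    have "r s x = p (b1 s) (q 1 x)" if "s \<in> {1/3<..}" for s
      using that by (simp add: r_def b2_def smooth_step_1)
    then have "ham r t x = D * ham p (b1 t) (q 1 x)"
      by (intro ham_reparam[OF contact_path_family[OF p(1)] D(2) rng(1) t q1, of "{1/3<..}"]) (use False in auto)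
    then show ?thesis using D p(2) rng q1 by (auto simp: nonneg_ham_def)
  qed
  ultimately show ?thesis by (auto simp: nonneg_ham_def)
qed

lemma nonneg_cls_compose:
  assumes "nonneg_cls p" "nonneg_cls q"
  shows "nonneg_cls (\<lambda>t x. p t (q t x))"
proof -
  obtain p' where p': "contact_path p'" "nonneg_ham p'" "cls p' = cls p" using assms nonneg_cls_def by blast
  obtain q' where q': "contact_path q'" "nonneg_ham q'" "cls q' = cls q" using assms nonneg_cls_def by blast
  have pq: "contact_path p" "contact_path q" using assms nonneg_cls_def by blast+
  have "cls (\<lambda>t x. p' t (q' t x)) = cls (\<lambda>t x. p t (q t x))"
    using cmult_cls[OF p'(1) q'(1)] cmult_cls[OF pq] p' q' by simp
  then show ?thesis
    using nonneg_ham_concatenation[OF p'(1,2) q'(1,2)] contact_path_compose[OF pq] by (simp add: nonneg_cls_def)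
qed

lemma nonneg_cls_cong: "nonneg_cls p \<Longrightarrow> contact_path q \<Longrightarrow> cls q = cls p \<Longrightarrow> nonneg_cls q"
  by (simp add: nonneg_cls_def)

lemma nonneg_ham_imp_cls: "contact_path p \<Longrightarrow> nonneg_ham p \<Longrightarrow> nonneg_cls p"
  by (auto simp: nonneg_cls_def)

lemma smooth_ext_snd:
  "smooth_ext A snd (snd :: 'a::euclidean_space \<times> 'b::euclidean_space \<Rightarrow> 'b)"
  by (rule smooth_ext_UNIV[OF smooth_on_snd[OF smooth_on_id[OF open_UNIV]]])

lemma contact_path_id: "contact_path (\<lambda>t (x::complex^'n). x)"
proof -
  have s: "smooth_ext ({0..1} \<times> Sph) (\<lambda>(t,x). x) (snd :: real \<times> (complex^'n) \<Rightarrow> complex^'n)"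
    using smooth_ext_snd[of "{0..1::real} \<times> Sph"] by (rule smooth_ext_cong) auto
  have "frechet_derivative (snd :: real \<times> (complex^'n) \<Rightarrow> complex^'n) (at y) = snd" for y
    using frechet_derivative_at[OF bounded_linear_imp_has_derivative[OF bounded_linear_snd]] by metis
  then have "\<exists>P. smooth_ext ({0..1} \<times> Sph) (\<lambda>(t,x). x) P \<and> (\<forall>t\<in>{0..1}. \<forall>x\<in>Sph. \<forall>v. inner x v = 0 \<and> lam0 x v = 0 \<longrightarrow>
            lam0 x (frechet_derivative P (at (t::real, x :: complex^'n)) (0,v)) = 0)"
    using s by (intro exI[of _ snd]) simp
  moreover have "smooth_ext Sph (inv_into Sph (\<lambda>x. x)) (\<lambda>x. x :: complex^'n)"
    by (rule smooth_ext_cong[OF smooth_ext_UNIV[OF smooth_on_id[OF open_UNIV]]])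
      (simp add: inv_into_f_f[of "\<lambda>x. x", simplified])
  ultimately show ?thesis unfolding contact_path_def by (auto simp: bij_betw_def)
qed

abbreviation joint_deriv :: "(real \<Rightarrow> 'a::real_normed_vector \<Rightarrow> 'b::real_normed_vector) \<Rightarrow> real \<Rightarrow> 'a \<Rightarrow> real \<times> 'a \<Rightarrow> 'b" where
  "joint_deriv F t x \<equiv> frechet_derivative (\<lambda>y. F (fst y) (snd y)) (at (t, x))"

text \<open>Isotopies are produced from maps of degree 1 on the punctured space. Oddness is
  homogeneity for c = -1, the normalised \<open>\<Psi>\<close> is the inverse because positive
  factors pass through both maps, and normalisation divides \<lambda>_0 by the squared norm.\<close>

lemma contact_path_homogeneous:
  fixes \<Phi> \<Psi> :: "real \<Rightarrow> complex^'n \<Rightarrow> complex^'n"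
  assumes W: "open W" "{0..1} \<subseteq> W"
    and smooth: "smooth_on (W \<times> - {0}) (\<lambda>y. \<Phi> (fst y) (snd y))" "smooth_on (W \<times> - {0}) (\<lambda>y. \<Psi> (fst y) (snd y))"
    and hom: "\<And>t x c. t \<in> {0..1} \<Longrightarrow> x \<noteq> 0 \<Longrightarrow> c \<noteq> 0 \<Longrightarrow> \<Phi> t (c *\<^sub>R x) = c *\<^sub>R \<Phi> t x"
      "\<And>t x c. t \<in> {0..1} \<Longrightarrow> x \<noteq> 0 \<Longrightarrow> c \<noteq> 0 \<Longrightarrow> \<Psi> t (c *\<^sub>R x) = c *\<^sub>R \<Psi> t x"
    and inv: "\<And>t x. t \<in> {0..1} \<Longrightarrow> x \<noteq> 0 \<Longrightarrow> \<Phi> t x \<noteq> 0 \<and> \<Psi> t (\<Phi> t x) = x"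
      "\<And>t x. t \<in> {0..1} \<Longrightarrow> x \<noteq> 0 \<Longrightarrow> \<Psi> t x \<noteq> 0 \<and> \<Phi> t (\<Psi> t x) = x"
    and id: "\<And>x. x \<noteq> 0 \<Longrightarrow> \<Phi> 0 x = x"
    and contact: "\<And>t x v. t \<in> {0..1} \<Longrightarrow> x \<in> Sph \<Longrightarrow> inner x v = 0 \<Longrightarrow> lam0 x v = 0 \<Longrightarrow>
        lam0 (\<Phi> t x) (joint_deriv \<Phi> t x (0,v)) = 0"
  shows "contact_path (\<lambda>t x. sgn (\<Phi> t x))"
    and "\<And>t x. t \<in> {0..1} \<Longrightarrow> x \<in> Sph \<Longrightarrow> ham (\<lambda>t x. sgn (\<Phi> t x)) t x =
       lam0 (\<Phi> t x) (joint_deriv \<Phi> t x (1,0)) / (norm (\<Phi> t x))\<^sup>2"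
proof -
  let ?F = "\<lambda>y. \<Phi> (fst y) (snd y)"
  let ?G = "\<lambda>y. \<Psi> (fst y) (snd y)"
  let ?A = "{0..1} \<times> Sph :: (real \<times> (complex^'n)) set"
  have S0: "x \<noteq> 0" if "x \<in> Sph" for x :: "complex^'n" using that by (auto simp: Sph_def)
  have A: "?A \<subseteq> W \<times> - {0}" using W S0 by auto
  have F: "smooth_ext ?A ?F ?F" "smooth_ext ?A ?G ?G"
    using smooth A smooth_extI by blast+
  have sg: "smooth_ext (- {0}) sgn (sgn :: complex^'n \<Rightarrow> complex^'n)"
    by (rule smooth_extI[OF smooth_on_sgn]) auto
  have R: "smooth_ext ?A (\<lambda>y. sgn (?F y)) (\<lambda>y. sgn (?F y))"
    by (rule smooth_ext_compose[OF sg F(1)]) (use inv(1) S0 in auto)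
  then have R': "smooth_ext ?A (\<lambda>(t,x). sgn (\<Phi> t x)) (\<lambda>y. sgn (?F y))"
    by (rule smooth_ext_cong) auto
  have fd: "lam0 (sgn (\<Phi> t x)) (frechet_derivative (\<lambda>y. sgn (?F y)) (at (t,x)) u) =
        lam0 (\<Phi> t x) (frechet_derivative ?F (at (t,x)) u) / (norm (\<Phi> t x))\<^sup>2"
    if "t \<in> {0..1}" "x \<in> Sph" for t x u
  proof -
    have n: "\<Phi> t x \<noteq> 0" using inv(1)[OF that(1) S0[OF that(2)]] by simp
    have d: "(?F has_derivative frechet_derivative ?F (at (t,x))) (at (t,x))"
      using smooth_ext_has_derivative[OF F(1)] that by auto
    have s: "(sgn has_derivative frechet_derivative sgn (at (\<Phi> t x))) (at (?F (t,x)))"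
      using smooth_on_has_derivative[OF smooth_on_sgn] n by simp
    from fun_cong[OF frechet_derivative_at[OF has_derivative_compose[OF d s]], of u]
    have "frechet_derivative (\<lambda>y. sgn (?F y)) (at (t,x)) u =
      frechet_derivative sgn (at (\<Phi> t x)) (frechet_derivative ?F (at (t,x)) u)" by simp
    then show ?thesis using lam0_sgn_derivative[OF n] by simp
  qed
  have sm: "\<Phi> t (sgn x) = inverse (norm x) *\<^sub>R \<Phi> t x" "\<Psi> t (sgn x) = inverse (norm x) *\<^sub>R \<Psi> t x"
    if "t \<in> {0..1}" "x \<noteq> 0" for t x using hom that by (auto simp: sgn_div_norm)
  have sg1: "sgn (inverse (norm y) *\<^sub>R x) = x" if "x \<in> Sph" "y \<noteq> 0" for x y :: "complex^'n"
    using that by (simp add: sgn_scaleR Sph_def sgn_div_norm)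
  have PF: "sgn (\<Psi> t (sgn (\<Phi> t x))) = x" "sgn (\<Phi> t (sgn (\<Psi> t x))) = x" if "t \<in> {0..1}" "x \<in> Sph" for t x
    using sm[OF that(1)] inv[OF that(1) S0[OF that(2)]] sg1[OF that(2)] by auto
  have S: "sgn (\<Phi> t x) \<in> Sph" "sgn (\<Psi> t x) \<in> Sph" if "t \<in> {0..1}" "x \<in> Sph" for t x
    using inv[OF that(1) S0[OF that(2)]] sgn_in_Sph by auto
  have bij: "bij_betw (\<lambda>x. sgn (\<Phi> t x)) Sph Sph" if "t \<in> {0..1}" for t
    by (rule bij_betw_byWitness[of _ "\<lambda>x. sgn (\<Psi> t x)"]) (use PF S that in auto)
  have "smooth_ext Sph (inv_into Sph (\<lambda>x. sgn (\<Phi> t x))) (\<lambda>x. sgn (?G (t, x)))" if t: "t \<in> {0..1}" for t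
  proof -
    have "smooth_ext Sph (\<lambda>x. (t, x)) (\<lambda>x::complex^'n. (t, x))"
      by (intro smooth_ext_UNIV smooth_on_Pair smooth_on_const smooth_on_id open_UNIV)
    from smooth_ext_compose[OF F(2) this]
    have "smooth_ext Sph (\<lambda>x. ?G (t, x)) (\<lambda>x. ?G (t, x))" using t by auto
    from smooth_ext_compose[OF sg this]
    have "smooth_ext Sph (\<lambda>x. sgn (?G (t, x))) (\<lambda>x. sgn (?G (t, x)))"
      using inv(2)[OF t S0] by auto
    then show ?thesis
    proof (rule smooth_ext_cong)
      fix x assume x: "x \<in> (Sph :: (complex^'n) set)"
      have "inv_into Sph (\<lambda>x. sgn (\<Phi> t x)) (sgn (\<Phi> t (sgn (\<Psi> t x)))) = sgn (\<Psi> t x)"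
        using inv_into_f_f[OF bij_betw_imp_inj_on[OF bij[OF t]] S(2)[OF t x]] by simp
      then show "sgn (?G (t, x)) = inv_into Sph (\<lambda>x. sgn (\<Phi> t x)) x" using PF(2)[OF t x] by simp
    qed
  qed
  moreover have "sgn (\<Phi> 0 x) = x" if "x \<in> Sph" for x
    using id[OF S0[OF that]] that by (simp add: Sph_def sgn_div_norm)
  moreover have "sgn (\<Phi> t (- x)) = - sgn (\<Phi> t x)" if "t \<in> {0..1}" "x \<in> Sph" for t x
    using hom(1)[OF that(1) S0[OF that(2)], of "-1"] by (simp add: sgn_minus)
  moreover have "lam0 (sgn (\<Phi> t x)) (frechet_derivative (\<lambda>y. sgn (?F y)) (at (t,x)) (0,v)) = 0"
    if "t \<in> {0..1}" "x \<in> Sph" "inner x v = 0 \<and> lam0 x v = 0" for t x v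
    using fd[OF that(1,2)] contact[OF that(1,2)] that(3) by simp
  ultimately show "contact_path (\<lambda>t x. sgn (\<Phi> t x))"
    unfolding contact_path_def using R' bij by blast
  show "ham (\<lambda>t x. sgn (\<Phi> t x)) t x =
       lam0 (\<Phi> t x) (frechet_derivative ?F (at (t,x)) (1,0)) / (norm (\<Phi> t x))\<^sup>2" if "t \<in> {0..1}" "x \<in> Sph" for t x
    using ham_smooth_ext[OF R' that] fd[OF that] by simp
qed

section \<open>Bi-invariant Lorentzian distances\<close>

locale bi_invariant_lorentzian =
  fixes d :: "(real \<Rightarrow> complex^'n \<Rightarrow> complex^'n) set \<Rightarrow> (real \<Rightarrow> complex^'n \<Rightarrow> complex^'n) set \<Rightarrow> ennreal"
  assumes pos: "\<forall>a\<in>UCont. \<forall>b\<in>UCont. d a b > 0 \<longleftrightarrow> nnsp_path_between a b"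
    and rev_tri: "\<forall>a\<in>UCont. \<forall>b\<in>UCont. \<forall>c\<in>UCont. cleq a b \<and> cleq b c \<longrightarrow> d a c \<ge> d a b + d b c"
    and biinv: "\<forall>l\<in>UCont. \<forall>r\<in>UCont. \<forall>a\<in>UCont. \<forall>b\<in>UCont.
                  d (cmult l (cmult a r)) (cmult l (cmult b r)) = d a b"
begin

definition d_id :: "(real \<Rightarrow> complex^'n \<Rightarrow> complex^'n) \<Rightarrow> ennreal" where
  "d_id p = d (cls (\<lambda>t x. x)) (cls p)"

lemma cls_UCont: "contact_path p \<Longrightarrow> cls p \<in> UCont"
  by (auto simp: UCont_def)

text \<open>Right translation by \<open>cls a\<close>; it reduces everything to distances from the
  identity.\<close>

lemma d_translate:
  assumes "contact_path p" "contact_path a"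
  shows "d (cls a) (cls (\<lambda>t x. p t (a t x))) = d_id p"
proof -
  have "d (cmult (cls (\<lambda>t x. x)) (cmult (cls (\<lambda>t x. x)) (cls a))) (cmult (cls (\<lambda>t x. x)) (cmult (cls p) (cls a)))
     = d (cls (\<lambda>t x. x)) (cls p)"
    using biinv cls_UCont[OF contact_path_id] cls_UCont[OF assms(1)] cls_UCont[OF assms(2)] by blast
  then show ?thesis
    by (simp add: d_id_def cmult_cls assms contact_path_id contact_path_compose)
qed

lemma d_id_pos:
  assumes "contact_path p" "nonneg_ham p" "t \<in> {0..1}" "x \<in> Sph" "ham p t x > 0"
  shows "d_id p > 0"
proof -
  have "nnsp_path_between (cls (\<lambda>t x. x)) (cls p)"
    unfolding nnsp_path_between_def using assms
    by (intro exI[of _ p]) (auto simp: cmult_cls contact_path_id nonneg_ham_def)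
  then show ?thesis
    unfolding d_id_def using pos cls_UCont[OF contact_path_id] cls_UCont[OF assms(1)] by blast
qed

lemma cleq_cls_compose:
  assumes "nonneg_cls p" "contact_path q"
  shows "cleq (cls q) (cls (\<lambda>t x. p t (q t x)))"
proof -
  obtain r where r: "contact_path r" "nonneg_ham r" "cls r = cls p" using assms nonneg_cls_def by blast
  have "contact_path p" using assms nonneg_cls_def by blast
  then have "cmult (cls r) (cls q) = cls (\<lambda>t x. p t (q t x))"
    using cmult_cls[of p q] assms(2) r(3) by simp
  then show ?thesis unfolding nonneg_path_between_def using r by (auto simp: nonneg_ham_def)
qed

text \<open>Reverse triangle inequality for id \<le> q \<le> p q; the second leg is brought back to
  the identity by right invariance.\<close>

lemma d_id_compose:
  assumes "nonneg_cls p" "nonneg_cls q"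
  shows "d_id (\<lambda>t x. p t (q t x)) \<ge> d_id q + d_id p"
proof -
  have pq: "contact_path p" "contact_path q" using assms nonneg_cls_def by blast+
  have "d (cls (\<lambda>t x. x)) (cls (\<lambda>t x. p t (q t x))) \<ge>
     d (cls (\<lambda>t x. x)) (cls q) + d (cls q) (cls (\<lambda>t x. p t (q t x)))"
    using rev_tri cls_UCont[OF contact_path_id] cls_UCont[OF pq(2)] cls_UCont[OF contact_path_compose[OF pq]]
      cleq_cls_compose[OF assms(2) contact_path_id] cleq_cls_compose[OF assms(1) pq(2)] by blast
  then show ?thesis using d_translate[OF pq] by (simp add: d_id_def)
qed

lemma d_id_power:
  assumes "nonneg_cls p"
  shows "nonneg_cls (\<lambda>t x. (p t ^^ Suc N) x) \<and> d_id (\<lambda>t x. (p t ^^ Suc N) x) \<ge> of_nat (Suc N) * d_id p"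
proof (induction N)
  case 0
  then show ?case using assms by (simp add: eta_contract_eq)
next
  case (Suc N)
  let ?q = "\<lambda>t x. (p t ^^ Suc N) x"
  note q = Suc[THEN conjunct1] Suc[THEN conjunct2]
  have e: "(\<lambda>t x. (p t ^^ Suc (Suc N)) x) = (\<lambda>t x. p t (?q t x))" by simp
  have "of_nat (Suc (Suc N)) * d_id p = of_nat (Suc N) * d_id p + d_id p"
    by (subst of_nat_Suc) (simp only: distrib_right mult_1_left add.commute)
  also have "\<dots> \<le> d_id ?q + d_id p" by (rule add_right_mono[OF q(2)])
  also have "\<dots> \<le> d_id (\<lambda>t x. p t (?q t x))" by (rule d_id_compose[OF assms q(1)])
  finally show ?case unfolding e using nonneg_cls_compose[OF assms q(1)] by (rule conjI[rotated])
qed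

text \<open>Bi-invariance concerns conjugation by classes in the cover, and \<open>cls_conj\<close>
  turns this into conjugation by the end maps.\<close>

lemma d_id_conj:
  assumes p: "contact_path p" and a: "contact_path a" and b: "contact_path b"
    and inv: "\<And>t x. t \<in> {0..1} \<Longrightarrow> x \<in> Sph \<Longrightarrow> a t (b t x) = x"
  shows "d_id (\<lambda>t x. a 1 (p t (b 1 x))) = d_id p"
proof -
  have "d (cmult (cls a) (cmult (cls (\<lambda>t x. x)) (cls b))) (cmult (cls a) (cmult (cls p) (cls b))) = d_id p"
    unfolding d_id_def using biinv cls_UCont[OF contact_path_id] cls_UCont[OF p] cls_UCont[OF a] cls_UCont[OF b] by blast
  moreover have "cmult (cls a) (cmult (cls (\<lambda>t x. x)) (cls b)) = cls (\<lambda>t x. x)"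
    using cls_cong[OF contact_path_compose[OF a b], of "\<lambda>t x. x"] inv
    by (simp add: cmult_cls a b contact_path_id)
  moreover have "cmult (cls a) (cmult (cls p) (cls b)) = cls (\<lambda>t x. a 1 (p t (b 1 x)))"
    using cls_conj(2)[OF p a b inv] by (simp add: cmult_cls a b p contact_path_compose)
  ultimately show ?thesis by (simp add: d_id_def)
qed

lemma d_id_infinite:
  assumes "d_id q > 0" "\<And>N. d_id p \<ge> of_nat (Suc N) * d_id q"
  shows "d_id p = \<infinity>"
proof (rule ccontr)
  assume "d_id p \<noteq> \<infinity>"
  then obtain a where a: "d_id p = ennreal a" "a \<ge> 0" by (cases "d_id p") auto
  \<comment> \<open>The case N = 0 makes \<open>d_id q\<close> finite too, so that the Archimedean
    property of the reals applies.\<close>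
  have "d_id q \<le> d_id p" using assms(2)[of 0] by simp
  then obtain b where b: "d_id q = ennreal b" "b \<ge> 0" using a by (cases "d_id q") (auto simp: top_unique)
  then have "b > 0" using assms(1) by (cases "b = 0") auto
  then obtain N where "a < real N * b" using reals_Archimedean3 by blast
  also have "\<dots> \<le> real (Suc N) * b" using b by (intro mult_right_mono) auto
  also have "\<dots> \<le> a"
  proof -
    have "ennreal (real (Suc N) * b) = of_nat (Suc N) * d_id q"
      using b by (simp only: ennreal_mult ennreal_of_nat_eq_real_of_nat of_nat_0_le_iff)
    also have "\<dots> \<le> ennreal a" using assms(2)[of N] a(1) by simp
    finally show ?thesis using a(2) by (simp add: ennreal_le_iff)
  qed
  finally show False by simp
qed

end

section \<open>Squeezing towards a point\<close>

definition herm :: "complex^'n \<Rightarrow> complex^'n \<Rightarrow> complex" where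
  "herm x y = (\<Sum>j\<in>UNIV. cnj (x $ j) * y $ j)"

definition wpart :: "complex^'n \<Rightarrow> complex^'n \<Rightarrow> complex^'n" where
  "wpart e z = z - herm e z *s e"

lemma lam0_herm: "lam0 z v = Im (herm z v) / 2"
  by (simp add: lam0_def herm_def)

lemma inner_herm: "inner z v = Re (herm z v)"
  by (simp add: inner_vec_def herm_def inner_complex_def)

lemma herm_add_right: "herm x (y + z) = herm x y + herm x z"
  by (simp add: herm_def algebra_simps sum.distrib)

lemma herm_add_left: "herm (x + y) z = herm x z + herm y z"
  by (simp add: herm_def algebra_simps sum.distrib)

lemma herm_smult_right: "herm x (c *s y) = c * herm x y"
  by (simp add: herm_def sum_distrib_left algebra_simps)

lemma herm_smult_left: "herm (c *s x) y = cnj c * herm x y"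
  by (simp add: herm_def sum_distrib_left algebra_simps)

lemma scaleR_smult: "r *\<^sub>R z = complex_of_real r *s z"
  by (simp add: vec_eq_iff complex_eq_iff)

lemma herm_scaleR_right: "herm x (r *\<^sub>R y) = r *\<^sub>R herm x y"
  by (simp add: scaleR_smult herm_smult_right scaleR_conv_of_real)

lemma herm_commute: "herm x y = cnj (herm y x)"
  by (simp add: herm_def mult.commute)

lemma herm_self: "herm x x = complex_of_real ((norm x)\<^sup>2)"
proof -
  have "Im (herm x x) = 0" using lam0_self[of x] by (simp add: lam0_herm)
  moreover have "Re (herm x x) = (norm x)\<^sup>2" by (metis inner_herm power2_norm_eq_inner)
  ultimately show ?thesis by (simp add: complex_eq_iff)
qed

lemma herm_linear: "bounded_linear (herm e)"
  by (intro linear_conv_bounded_linear[THEN iffD1] linearI) (simp_all add: herm_add_right herm_scaleR_right)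

lemma smult_bilinear: "bounded_bilinear (\<lambda>c (z::complex^'n). c *s z)"
proof -
  have "bilinear (\<lambda>c (z::complex^'n). c *s z)"
    unfolding bilinear_def
    by (auto intro!: linearI simp: vec_eq_iff algebra_simps)
  then show ?thesis by (simp add: bilinear_conv_bounded_bilinear)
qed

lemma wpart_linear: "bounded_linear (wpart e)"
  unfolding wpart_def
  by (intro bounded_linear_sub bounded_linear_ident
      bounded_linear_compose[OF bounded_bilinear.bounded_linear_left[OF smult_bilinear] herm_linear])

lemma Sph_nonzero: "x \<in> Sph \<Longrightarrow> x \<noteq> 0" by (auto simp: Sph_def)

lemma Sph_sgn: "x \<in> Sph \<Longrightarrow> sgn x = x" by (simp add: Sph_def sgn_div_norm)

lemma sgn_pos_scaleR: "c > 0 \<Longrightarrow> sgn (c *\<^sub>R x) = sgn (x :: 'a::real_normed_vector)"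
  by (simp add: sgn_scaleR)

locale unit_vector =
  fixes e :: "complex^'n"
  assumes e: "e \<in> Sph"
begin

abbreviation h where "h \<equiv> herm e"
abbreviation w where "w \<equiv> wpart e"

lemma h_e: "h e = 1" using e by (simp add: herm_self Sph_def)

lemma h_w: "h (w z) = 0"
  by (simp add: wpart_def linear_diff[OF bounded_linear.linear[OF herm_linear]] herm_smult_right h_e)

lemma decomp: "z = h z *s e + w z" by (simp add: wpart_def)

lemma h_comb: "h v = 0 \<Longrightarrow> h (c *s e + v) = c"
  by (simp add: herm_add_right herm_smult_right h_e)

lemma w_comb: "h v = 0 \<Longrightarrow> w (c *s e + v) = v"
  by (simp add: wpart_def h_comb)

lemma w_scaleR: "w (r *\<^sub>R z) = r *\<^sub>R w z"
  by (rule linear_scale[OF bounded_linear.linear[OF wpart_linear]])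

lemma h_smult_w: "h (c *s w z) = 0" by (simp add: herm_smult_right h_w)

lemma h_scaleR_w: "h (r *\<^sub>R w z) = 0" by (simp add: herm_scaleR_right h_w)

lemma herm_comb:
  assumes "h u = 0" "h v = 0"
  shows "herm (a *s e + u) (b *s e + v) = cnj a * b + herm u v"
proof -
  have "herm u e = 0" using assms herm_commute[of u e] by simp
  then show ?thesis using assms h_e
    by (simp add: herm_add_left herm_add_right herm_smult_left herm_smult_right)
qed

lemma herm_decomp: "herm y z = cnj (h y) * h z + herm (w y) (w z)"
  using herm_comb[OF h_w h_w, of "h y" y "h z" z] decomp[of y] decomp[of z] by simp

lemma norm_decomp: "(norm z)\<^sup>2 = (cmod (h z))\<^sup>2 + (norm (w z))\<^sup>2"
proof -
  have "complex_of_real ((norm z)\<^sup>2) = complex_of_real ((cmod (h z))\<^sup>2 + (norm (w z))\<^sup>2)"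
    using herm_decomp[of z z] complex_norm_square[of "h z"] by (simp add: herm_self mult.commute)
  then show ?thesis using of_real_eq_iff by blast
qed

lemma decomp_eqI: "h y = h z \<Longrightarrow> w y = w z \<Longrightarrow> y = z"
  using decomp by metis

definition dil :: "real \<Rightarrow> complex^'n \<Rightarrow> complex^'n" where
  "dil l z = Complex (Re (h z) / l) (l * Im (h z)) *s e + w z"

text \<open>The same projective map as \<open>dil l\<close>, multiplied by \<open>l\<close> to clear
  the denominator; it is polynomial in \<open>l\<close>.\<close>

definition shrink :: "real \<Rightarrow> complex^'n \<Rightarrow> complex^'n" where
  "shrink l z = Complex (Re (h z)) (l\<^sup>2 * Im (h z)) *s e + l *\<^sub>R w z"

lemma h_dil: "h (dil l z) = Complex (Re (h z) / l) (l * Im (h z))"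
  by (simp add: dil_def h_comb h_w)

lemma w_dil: "w (dil l z) = w z"
  by (simp add: dil_def w_comb h_w)

lemma h_shrink: "h (shrink l z) = Complex (Re (h z)) (l\<^sup>2 * Im (h z))"
  by (simp add: shrink_def h_comb h_scaleR_w)

lemma w_shrink: "w (shrink l z) = l *\<^sub>R w z"
  by (simp add: shrink_def w_comb h_scaleR_w)

lemma shrink_dil: "l \<noteq> 0 \<Longrightarrow> shrink l z = l *\<^sub>R dil l z"
  by (rule decomp_eqI)
    (auto simp: h_shrink w_shrink herm_scaleR_right h_dil w_scaleR w_dil complex_eq_iff power2_eq_square)

lemma dil_dil: "l \<noteq> 0 \<Longrightarrow> dil l (dil (inverse l) z) = z"
  by (rule decomp_eqI) (auto simp: h_dil w_dil complex_eq_iff field_simps)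

lemma dil_dil': "l \<noteq> 0 \<Longrightarrow> dil (inverse l) (dil l z) = z"
  using dil_dil[of "inverse l"] by simp

lemma dil_1: "dil 1 z = z"
  by (rule decomp_eqI) (auto simp: h_dil w_dil complex_eq_iff)

lemma dil_scaleR: "dil l (c *\<^sub>R z) = c *\<^sub>R dil l z"
  by (rule decomp_eqI) (auto simp: h_dil w_dil herm_scaleR_right w_scaleR complex_eq_iff)

lemma dil_add: "dil l (y + z) = dil l y + dil l z"
  by (rule decomp_eqI)
    (auto simp: h_dil w_dil herm_add_right linear_add[OF bounded_linear.linear[OF wpart_linear]] complex_eq_iff add_divide_distrib algebra_simps)

lemma dil_linear: "bounded_linear (dil l)"
  by (intro linear_conv_bounded_linear[THEN iffD1] linearI) (simp_all add: dil_add dil_scaleR)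

lemma dil_nonzero: "l \<noteq> 0 \<Longrightarrow> z \<noteq> 0 \<Longrightarrow> dil l z \<noteq> 0"
  using dil_dil' dil_scaleR[of _ 0 0] by (metis scaleR_zero_left)

text \<open>The factors 1/l and l cancel in the area form of the \<open>h\<close>-plane, and
  \<open>w\<close> is fixed.\<close>

lemma lam0_dil: "l \<noteq> 0 \<Longrightarrow> lam0 (dil l y) (dil l z) = lam0 y z"
  using herm_decomp[of y z] herm_decomp[of "dil l y" "dil l z"]
  by (simp add: lam0_herm h_dil w_dil)

lemma smooth_on_h: "smooth_on U f \<Longrightarrow> smooth_on U (\<lambda>x. h (f x))"
  by (rule smooth_on_linear_compose[OF herm_linear])

lemma smooth_on_w: "smooth_on U f \<Longrightarrow> smooth_on U (\<lambda>x. w (f x))"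
  by (rule smooth_on_linear_compose[OF wpart_linear])

end

lemma smooth_on_Re: "smooth_on U f \<Longrightarrow> smooth_on U (\<lambda>x. Re (f x))"
  by (rule smooth_on_linear_compose[OF bounded_linear_Re])

lemma smooth_on_Im: "smooth_on U f \<Longrightarrow> smooth_on U (\<lambda>x. Im (f x))"
  by (rule smooth_on_linear_compose[OF bounded_linear_Im])

lemma smooth_on_of_real: "smooth_on U f \<Longrightarrow> smooth_on U (\<lambda>x. complex_of_real (f x))"
  by (rule smooth_on_linear_compose[OF bounded_linear_of_real])

lemma smooth_on_Complex:
  assumes "smooth_on U f" "smooth_on U g"
  shows "smooth_on U (\<lambda>x. Complex (f x) (g x))"
proof -
  have "smooth_on U (\<lambda>x. complex_of_real (f x) + \<i> * complex_of_real (g x))"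
    by (intro smooth_on_add smooth_on_mult smooth_on_of_real smooth_on_const assms smooth_on_open[OF assms(1)])
  then show ?thesis by (simp add: Complex_eq)
qed

lemma smooth_on_smult:
  fixes g :: "'a::real_normed_vector \<Rightarrow> complex^'n"
  shows "smooth_on U f \<Longrightarrow> smooth_on U g \<Longrightarrow> smooth_on U (\<lambda>x. f x *s g x)"
  using smooth_on_bilinear[OF smult_bilinear] .

context unit_vector
begin

lemma smooth_on_shrink:
  "smooth_on U f \<Longrightarrow> smooth_on U g \<Longrightarrow> smooth_on U (\<lambda>x. shrink (f x) (g x))"
  unfolding shrink_def power2_eq_square
  by (intro smooth_on_add smooth_on_smult smooth_on_Complex smooth_on_mult smooth_on_scaleR smooth_on_Re smooth_on_Im
      smooth_on_h smooth_on_w smooth_on_const) (auto simp: smooth_on_open)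

text \<open>Bi-invariance is about elements of the universal cover, so the dilation is joined to the
  identity through dilations. The exponential keeps the factor positive, and \<mu> = ln l reaches
  \<open>dil l\<close> at time 1.\<close>

definition dil_path :: "real \<Rightarrow> real \<Rightarrow> complex^'n \<Rightarrow> complex^'n" where
  "dil_path \<mu> t x = sgn (dil (exp (\<mu> * t)) x)"

lemma contact_path_dil: "contact_path (dil_path \<mu>)"
proof -
  have sm: "smooth_on (UNIV \<times> - {0}) (\<lambda>y. dil (exp (\<nu> * fst y)) (snd y))" for \<nu> :: real
  proof -
    have o: "open (UNIV \<times> - {0} :: (real \<times> (complex^'n)) set)" by (intro open_Times) auto
    have ex: "smooth_on (UNIV \<times> - {0}) (\<lambda>y :: real \<times> (complex^'n). exp (\<kappa> * fst y))" for \<kappa> :: real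
      by (intro smooth_on_compose[OF smooth_on_exp] smooth_on_mult smooth_on_const smooth_on_fst smooth_on_id o) auto
    have "smooth_on (UNIV \<times> - {0}) (\<lambda>y. Complex (Re (h (snd y)) * exp ((- \<nu>) * fst y)) (exp (\<nu> * fst y) * Im (h (snd y))) *s e + w (snd y))"
      by (intro smooth_on_add smooth_on_smult smooth_on_Complex smooth_on_mult smooth_on_Re smooth_on_Im
          smooth_on_h smooth_on_w smooth_on_const smooth_on_snd smooth_on_id o ex)
    then show ?thesis
      by (rule smooth_on_cong) (simp add: dil_def exp_minus divide_inverse)
  qed
  have i: "dil (exp (\<nu> * t)) (dil (exp (- \<nu> * t)) z) = z" for \<nu> t z
    using dil_dil[of "exp (\<nu> * t)" z] by (simp add: exp_minus)
  show ?thesis unfolding dil_path_def[abs_def]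
  proof (rule contact_path_homogeneous(1)[OF open_UNIV subset_UNIV sm[of \<mu>] sm[of "- \<mu>"]])
    fix t :: real and x v :: "complex^'n" assume x: "x \<in> Sph" and v: "lam0 x v = 0"
    have xn: "(t, x) \<in> UNIV \<times> - {0}" using Sph_nonzero[OF x] by simp
    have d: "((\<lambda>y. dil (exp (\<mu> * fst y)) (snd y)) has_derivative
        frechet_derivative (\<lambda>y. dil (exp (\<mu> * fst y)) (snd y)) (at (t,x))) (at (t,x))"
      using smooth_on_has_derivative[OF sm xn] .
    \<comment> \<open>At a fixed time the map is linear, hence equal to its own space derivative.
      This is read off by differentiating along the line x + s v in two ways.\<close>
    have "((\<lambda>s. (t, x + s *\<^sub>R v)) has_derivative (\<lambda>s. (0, s *\<^sub>R v))) (at 0)"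
      by (auto intro!: derivative_eq_intros)
    from has_derivative_compose[OF this, of "\<lambda>y. dil (exp (\<mu> * fst y)) (snd y)"] d
    have 1: "((\<lambda>s. dil (exp (\<mu> * t)) (x + s *\<^sub>R v)) has_derivative
       (\<lambda>s. frechet_derivative (\<lambda>y. dil (exp (\<mu> * fst y)) (snd y)) (at (t,x)) (0, s *\<^sub>R v))) (at 0)" by simp
    have "((\<lambda>s. x + s *\<^sub>R v) has_derivative (\<lambda>s. s *\<^sub>R v)) (at 0)"
      by (auto intro!: derivative_eq_intros)
    from has_derivative_compose[OF this bounded_linear_imp_has_derivative[OF dil_linear]]
    have 2: "((\<lambda>s. dil (exp (\<mu> * t)) (x + s *\<^sub>R v)) has_derivative (\<lambda>s. dil (exp (\<mu> * t)) (s *\<^sub>R v))) (at 0)" .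
    from fun_cong[OF has_derivative_unique[OF 1 2], of 1]
    have "frechet_derivative (\<lambda>y. dil (exp (\<mu> * fst y)) (snd y)) (at (t,x)) (0, v) = dil (exp (\<mu> * t)) v" by simp
    then show "lam0 (dil (exp (\<mu> * t)) x) (frechet_derivative (\<lambda>y. dil (exp (\<mu> * fst y)) (snd y)) (at (t,x)) (0, v)) = 0"
      using v by (simp add: lam0_dil)
  qed (use i[of "- \<mu>"] i[of \<mu>] in \<open>auto simp: dil_scaleR dil_nonzero dil_1\<close>)
qed

lemma dil_path_inverse:
  assumes "x \<in> Sph"
  shows "dil_path \<mu> t (dil_path (- \<mu>) t x) = x"
proof -
  have "dil (exp (\<mu> * t)) (dil (exp (- \<mu> * t)) x) = x"
    using dil_dil[of "exp (\<mu> * t)" x] by (simp add: exp_minus)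
  moreover have "dil (exp (- \<mu> * t)) x \<noteq> 0" using dil_nonzero Sph_nonzero[OF assms] by simp
  ultimately show ?thesis using Sph_sgn[OF assms]
    by (simp add: dil_path_def sgn_div_norm[of "dil (exp (- (\<mu> * t))) x"] dil_scaleR sgn_pos_scaleR)
qed

lemma dil_path_1: "l > 0 \<Longrightarrow> dil_path (ln l) 1 x = sgn (dil l x)"
  "l > 0 \<Longrightarrow> dil_path (- ln l) 1 x = sgn (dil (inverse l) x)"
  by (simp_all add: dil_path_def exp_minus)

end

text \<open>Both arguments of \<lambda>_0 change sign at the antipode. Thus positivity has to be
  checked only where \<open>Re (h x) > 0\<close>.\<close>

lemma ham_odd:
  assumes p: "contact_path p" and t: "t \<in> {0..1}" and x: "x \<in> Sph"
  shows "ham p t (- x) = ham p t x"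
proof -
  obtain P where P: "extends_to p P"
    by (rule contact_family_smooth[OF contact_path_family[OF p]])
  have Pv: "P (s, x) = p s x" if "s \<in> {0..1}" for s
    using P that x by (auto simp: smooth_ext_def)
  have o: "p s (- x) = - p s x" if "s \<in> {0..1}" for s using p that x by (simp add: contact_path_def)
  have "ham p t (- x) = lam0 (p t (- x)) (- frechet_derivative P (at (t,x)) (1,0))"
    by (rule ham_eqI[OF t has_vector_derivative_minus[OF smooth_ext_time_derivative[OF P t x]] open_UNIV UNIV_I])
      (simp add: o Pv)
  then show ?thesis using ham_smooth_ext[OF P t x] o[OF t] by (simp add: lam0_minus_left lam0_minus_right)
qed

lemma contact_path_power: "contact_path p \<Longrightarrow> contact_path (\<lambda>t x. (p t ^^ N) x)"
proof (induction N)
  case 0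
  then show ?case using contact_path_id by simp
next
  case (Suc N)
  then show ?case using contact_path_compose[OF Suc.prems Suc.IH[OF Suc.prems]] by simp
qed

text \<open>\<open>\<Phi>\<close> and \<open>\<Psi>\<close> are the lifts to the symplectization of an isotopy near \<open>e\<close> and of its pointwise
  inverse. In the affine chart \<open>Re (h x) = 1\<close> the support condition describes a compact set.\<close>

locale local_isotopy = unit_vector e for e :: "complex^'n" +
  fixes \<Phi> \<Psi> :: "real \<Rightarrow> complex^'n \<Rightarrow> complex^'n" and W :: "real set"
  assumes W: "open W" "{0..1} \<subseteq> W"
    and smooth: "smooth_on (W \<times> - {0}) (\<lambda>y. \<Phi> (fst y) (snd y))" "smooth_on (W \<times> - {0}) (\<lambda>y. \<Psi> (fst y) (snd y))"
    and hom: "\<And>t x c. t \<in> {0..1} \<Longrightarrow> x \<noteq> 0 \<Longrightarrow> c \<noteq> 0 \<Longrightarrow> \<Phi> t (c *\<^sub>R x) = c *\<^sub>R \<Phi> t x"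
      "\<And>t x c. t \<in> {0..1} \<Longrightarrow> x \<noteq> 0 \<Longrightarrow> c \<noteq> 0 \<Longrightarrow> \<Psi> t (c *\<^sub>R x) = c *\<^sub>R \<Psi> t x"
    and inv: "\<And>t x. t \<in> {0..1} \<Longrightarrow> x \<noteq> 0 \<Longrightarrow> \<Phi> t x \<noteq> 0 \<and> \<Psi> t (\<Phi> t x) = x"
      "\<And>t x. t \<in> {0..1} \<Longrightarrow> x \<noteq> 0 \<Longrightarrow> \<Psi> t x \<noteq> 0 \<and> \<Phi> t (\<Psi> t x) = x"
    and id: "\<And>x. x \<noteq> 0 \<Longrightarrow> \<Phi> 0 x = x"
    and contact: "\<And>t x v. t \<in> {0..1} \<Longrightarrow> x \<in> Sph \<Longrightarrow> inner x v = 0 \<Longrightarrow> lam0 x v = 0 \<Longrightarrow>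
        lam0 (\<Phi> t x) (joint_deriv \<Phi> t x (0,v)) = 0"
      "\<And>t x v. t \<in> {0..1} \<Longrightarrow> x \<in> Sph \<Longrightarrow> inner x v = 0 \<Longrightarrow> lam0 x v = 0 \<Longrightarrow>
        lam0 (\<Psi> t x) (joint_deriv \<Psi> t x (0,v)) = 0"
    and nonneg: "\<And>t x. t \<in> {0..1} \<Longrightarrow> x \<in> Sph \<Longrightarrow>
        lam0 (\<Phi> t x) (joint_deriv \<Phi> t x (1,0)) \<ge> 0"
    and somewhere_pos: "\<exists>t\<in>{0..1}. \<exists>x\<in>Sph.
        lam0 (\<Phi> t x) (joint_deriv \<Phi> t x (1,0)) > 0"
    and support: "\<And>t x. t \<in> {0..1} \<Longrightarrow> x \<noteq> 0 \<Longrightarrow>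
        \<not> (Re (h x) \<noteq> 0 \<and> \<bar>Im (h x)\<bar> \<le> \<bar>Re (h x)\<bar> \<and> norm (w x) \<le> \<bar>Re (h x)\<bar>) \<Longrightarrow> \<Psi> t x = x"
    and Re_pos: "\<And>t x. t \<in> {0..1} \<Longrightarrow> x \<noteq> 0 \<Longrightarrow> Re (h x) > 0 \<Longrightarrow> Re (h (\<Psi> t x)) > 0"
begin

definition \<phi> :: "real \<Rightarrow> complex^'n \<Rightarrow> complex^'n" where "\<phi> t x = sgn (\<Phi> t x)"
definition \<phi>i :: "real \<Rightarrow> complex^'n \<Rightarrow> complex^'n" where "\<phi>i t x = sgn (\<Psi> t x)"

lemma inverse_id: "x \<noteq> 0 \<Longrightarrow> \<Psi> 0 x = x"
  using inv(1)[of 0 x] id[of x] by simp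

lemma contact_path_\<phi>: "contact_path \<phi>" "contact_path \<phi>i"
proof -
  show "contact_path \<phi>" unfolding \<phi>_def[abs_def]
    by (rule contact_path_homogeneous(1)[where \<Phi>=\<Phi> and \<Psi>=\<Psi> and W=W])
      (rule W smooth hom inv id contact; assumption)+
  show "contact_path \<phi>i" unfolding \<phi>i_def[abs_def]
    by (rule contact_path_homogeneous(1)[where \<Phi>=\<Psi> and \<Psi>=\<Phi> and W=W])
      (rule W smooth hom inv inverse_id contact; assumption)+
qed

lemma ham_\<phi>:
  assumes "t \<in> {0..1}" "x \<in> Sph"
  shows "ham \<phi> t x = lam0 (\<Phi> t x) (joint_deriv \<Phi> t x (1,0)) / (norm (\<Phi> t x))\<^sup>2"
  unfolding \<phi>_def[abs_def]
  by (rule contact_path_homogeneous(2)[where \<Phi>=\<Phi> and \<Psi>=\<Psi> and W=W])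
    (rule assms W smooth hom inv id contact; assumption)+

lemma nonneg_ham_\<phi>: "nonneg_ham \<phi>"
  by (auto simp: nonneg_ham_def ham_\<phi> nonneg)

lemma \<phi>_somewhere_pos: "\<exists>t\<in>{0..1}. \<exists>x\<in>Sph. ham \<phi> t x > 0"
proof -
  obtain t x where tx: "t \<in> {0..1}" "x \<in> Sph"
    "lam0 (\<Phi> t x) (joint_deriv \<Phi> t x (1,0)) > 0" using somewhere_pos by blast
  then have "ham \<phi> t x > 0" using inv(1)[of t x] Sph_nonzero[of x] by (simp add: ham_\<phi>)
  then show ?thesis using tx by blast
qed

lemma \<phi>i_\<phi>:
  assumes "t \<in> {0..1}" "x \<in> Sph"
  shows "\<phi>i t (\<phi> t x) = x"
proof -
  have "\<Phi> t x \<noteq> 0" using inv(1)[OF assms(1) Sph_nonzero[OF assms(2)]] by blast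
  then show ?thesis using inv(1)[OF assms(1) Sph_nonzero[OF assms(2)]] hom(2)[OF assms(1), of "\<Phi> t x" "inverse (norm (\<Phi> t x))"]
     Sph_sgn[OF assms(2)] by (simp add: \<phi>_def \<phi>i_def sgn_div_norm[of "\<Phi> t x"] sgn_pos_scaleR)
qed

text \<open>The squeezed isotopy: \<phi> conjugated by the normalised dilation, written with end
  maps of \<open>dil_path\<close> to fit \<open>d_id_conj\<close>.\<close>

definition \<omega> :: "real \<Rightarrow> real \<Rightarrow> complex^'n \<Rightarrow> complex^'n" where
  "\<omega> l t x = dil_path (ln l) 1 (\<phi> t (dil_path (- ln l) 1 x))"
definition \<omega>i :: "real \<Rightarrow> real \<Rightarrow> complex^'n \<Rightarrow> complex^'n" where
  "\<omega>i l t x = dil_path (ln l) 1 (\<phi>i t (dil_path (- ln l) 1 x))"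

lemma contact_path_\<omega>: "contact_path (\<omega> l)" "contact_path (\<omega>i l)"
  using cls_conj(1)[OF contact_path_\<phi>(1) contact_path_dil contact_path_dil dil_path_inverse]
    cls_conj(1)[OF contact_path_\<phi>(2) contact_path_dil contact_path_dil dil_path_inverse]
  by (simp_all add: \<omega>_def[abs_def] \<omega>i_def[abs_def])

lemma dil_path_Sph: "x \<in> Sph \<Longrightarrow> dil_path \<mu> 1 x \<in> Sph"
  using contact_family_Sph[OF contact_path_family[OF contact_path_dil], of 1] by simp

lemma \<phi>_Sph: "t \<in> {0..1} \<Longrightarrow> x \<in> Sph \<Longrightarrow> \<phi> t x \<in> Sph" "t \<in> {0..1} \<Longrightarrow> x \<in> Sph \<Longrightarrow> \<phi>i t x \<in> Sph"
  using contact_family_Sph[OF contact_path_family] contact_path_\<phi> by blast+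

lemma \<omega>_Sph: "t \<in> {0..1} \<Longrightarrow> x \<in> Sph \<Longrightarrow> \<omega> l t x \<in> Sph" "t \<in> {0..1} \<Longrightarrow> x \<in> Sph \<Longrightarrow> \<omega>i l t x \<in> Sph"
  using contact_family_Sph[OF contact_path_family] contact_path_\<omega> by blast+

lemma \<omega>i_\<omega>: "t \<in> {0..1} \<Longrightarrow> x \<in> Sph \<Longrightarrow> \<omega>i l t (\<omega> l t x) = x"
  using dil_path_inverse[of _ "- ln l" 1] dil_path_inverse[of x "ln l" 1]
  by (simp add: \<omega>_def \<omega>i_def \<phi>_Sph dil_path_Sph \<phi>i_\<phi>)

lemma \<omega>i_power_\<omega>:
  assumes "t \<in> {0..1}"
  shows "x \<in> Sph \<Longrightarrow> (\<omega>i l t ^^ N) ((\<omega> l t ^^ N) x) = x"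
proof (induction N arbitrary: x)
  case (Suc N)
  have "(\<omega> l t ^^ M) x \<in> Sph" for M using Suc.prems \<omega>_Sph(1)[OF assms] by (induction M) auto
  then show ?case using Suc.IH[OF Suc.prems] \<omega>i_\<omega>[OF assms] by (simp add: funpow_swap1[of "\<omega>i l t"])
qed simp

text \<open>Dilations preserve \<lambda>_0, so conjugation changes the Hamiltonian only by a
  positive normalising factor.\<close>

lemma nonneg_ham_\<omega>:
  assumes l: "l > 0"
  shows "nonneg_ham (\<omega> l)"
  unfolding nonneg_ham_def
proof (intro ballI)
  fix t x assume t: "t \<in> {0..1::real}" and x: "x \<in> (Sph :: (complex^'n) set)"
  obtain P where P: "extends_to \<phi> P"
    by (rule contact_family_smooth[OF contact_path_family[OF contact_path_\<phi>(1)]])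
  define y where "y = dil_path (- ln l) 1 x"
  have y: "y \<in> Sph" using dil_path_Sph x by (simp add: y_def)
  have Pv: "P (s, y) = \<phi> s y" if "s \<in> {0..1}" for s
    using P that y by (auto simp: smooth_ext_def)
  let ?D = "frechet_derivative P (at (t,y)) (1,0)"
  have n: "\<phi> t y \<noteq> 0" using \<phi>_Sph(1)[OF t y] Sph_nonzero by blast
  then have n: "dil l (\<phi> t y) \<noteq> 0" using dil_nonzero[of l] l by auto
  have d1: "((\<lambda>s. P (s, y)) has_derivative (\<lambda>s. s *\<^sub>R ?D)) (at t)"
    using smooth_ext_time_derivative[OF P t y] by (simp add: has_vector_derivative_def)
  have d2: "((\<lambda>s. dil l (P (s, y))) has_derivative (\<lambda>s. s *\<^sub>R dil l ?D)) (at t)"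
    using has_derivative_compose[OF d1 bounded_linear_imp_has_derivative[OF dil_linear[of l]]] by (simp add: dil_scaleR)
  have d3: "(sgn has_derivative frechet_derivative sgn (at (dil l (P (t, y))))) (at (dil l (P (t, y))))"
    using smooth_on_has_derivative[OF smooth_on_sgn] n Pv[OF t] by simp
  have "((\<lambda>s. sgn (dil l (P (s, y)))) has_vector_derivative frechet_derivative sgn (at (dil l (P (t,y)))) (dil l ?D)) (at t)"
    using has_derivative_compose[OF d2 d3] linear_scale[OF has_derivative_linear[OF d3]]
    by (simp add: has_vector_derivative_def)
  then have "ham (\<omega> l) t x = lam0 (\<omega> l t x) (frechet_derivative sgn (at (dil l (P (t,y)))) (dil l ?D))"
    by (rule ham_eqI[OF t _ open_UNIV UNIV_I]) (simp add: \<omega>_def y_def[symmetric] Pv dil_path_1 l)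
  also have "\<dots> = lam0 (\<phi> t y) ?D / (norm (dil l (\<phi> t y)))\<^sup>2"
    using lam0_sgn_derivative[OF n] lam0_dil[of l] l Pv[OF t] by (simp add: \<omega>_def y_def[symmetric] dil_path_1)
  also have "\<dots> \<ge> 0"
    using nonneg_ham_\<phi> t y unfolding ham_smooth_ext[OF P t y, symmetric]
    by (intro divide_nonneg_nonneg) (auto simp: nonneg_ham_def)
  finally show "ham (\<omega> l) t x \<ge> 0" .
qed

lemma \<Psi>_power_nonzero: "t \<in> {0..1} \<Longrightarrow> x \<noteq> 0 \<Longrightarrow> (\<Psi> t ^^ N) x \<noteq> 0"
  by (induction N) (use inv(2) in auto)

lemma \<Psi>_power_hom: "t \<in> {0..1} \<Longrightarrow> x \<noteq> 0 \<Longrightarrow> c \<noteq> 0 \<Longrightarrow> (\<Psi> t ^^ N) (c *\<^sub>R x) = c *\<^sub>R (\<Psi> t ^^ N) x"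
  by (induction N) (auto simp: hom(2) \<Psi>_power_nonzero)

lemma \<Psi>_power_Re_pos: "t \<in> {0..1} \<Longrightarrow> x \<noteq> 0 \<Longrightarrow> Re (h x) > 0 \<Longrightarrow> Re (h ((\<Psi> t ^^ N) x)) > 0"
  by (induction N) (auto simp: Re_pos \<Psi>_power_nonzero)

text \<open>By homogeneity all intermediate normalisations can be postponed to the end, and the
  dilations between consecutive factors cancel.\<close>

lemma \<omega>i_power:
  assumes t: "t \<in> {0..1}" and l: "l > 0" and x: "x \<in> Sph"
  shows "(\<omega>i l t ^^ N) x = sgn (dil l ((\<Psi> t ^^ N) (dil (inverse l) x)))"
proof (induction N)
  case 0
  then show ?case using dil_dil[of l x] l Sph_sgn[OF x] by simp
next
  case (Suc N)
  let ?y = "(\<Psi> t ^^ N) (dil (inverse l) x)"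
  have y: "?y \<noteq> 0" using \<Psi>_power_nonzero[OF t] dil_nonzero Sph_nonzero[OF x] l by simp
  then have dy: "dil l ?y \<noteq> 0" using dil_nonzero l by simp
  have Py: "\<Psi> t ?y \<noteq> 0" using inv(2)[OF t y] by simp
  have "dil_path (- ln l) 1 (sgn (dil l ?y)) = sgn (dil (inverse l) (sgn (dil l ?y)))" using dil_path_1(2)[OF l] .
  also have "\<dots> = sgn ?y"
    using dy dil_dil'[of l ?y] l by (simp add: sgn_div_norm[of "dil l ?y"] dil_scaleR sgn_pos_scaleR)
  finally have "\<omega>i l t (sgn (dil l ?y)) = dil_path (ln l) 1 (\<phi>i t (sgn ?y))" by (simp add: \<omega>i_def)
  also have "\<phi>i t (sgn ?y) = sgn (\<Psi> t ?y)"
    using y hom(2)[OF t y, of "inverse (norm ?y)"] by (simp add: \<phi>i_def sgn_div_norm[of ?y] sgn_pos_scaleR)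
  also have "dil_path (ln l) 1 (sgn (\<Psi> t ?y)) = sgn (dil l (\<Psi> t ?y))"
    using Py l by (simp add: dil_path_1 sgn_div_norm[of "\<Psi> t ?y"] dil_scaleR sgn_pos_scaleR)
  finally show ?case using Suc by simp
qed

text \<open>That \<open>\<Psi>\<close> keeps points away from 0 is known for times in the unit
  interval, so the iterates are treated as maps with a smooth extension.\<close>

lemma \<Psi>_power_smooth: "\<exists>G. smooth_ext ({0..1} \<times> - {0}) (\<lambda>y. (\<Psi> (fst y) ^^ N) (snd y)) G"
proof (induction N)
  case 0
  then show ?case using smooth_ext_snd[of "{0..1} \<times> - {0}"] by (intro exI[of _ snd]) simp
next
  case (Suc N)
  then obtain G where "smooth_ext ({0..1} \<times> - {0}) (\<lambda>y. (\<Psi> (fst y) ^^ N) (snd y)) G" ..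
  then have "smooth_ext ({0..1} \<times> - {0}) (\<lambda>y. (fst y, (\<Psi> (fst y) ^^ N) (snd y))) (\<lambda>y. (fst y, G y))"
    by (intro smooth_ext_Pair[OF smooth_ext_UNIV[OF smooth_on_fst[OF smooth_on_id[OF open_UNIV]]]])
  note N = this
  have 1: "smooth_ext ({0..1} \<times> - {0}) (\<lambda>y. \<Psi> (fst y) (snd y)) (\<lambda>y. \<Psi> (fst y) (snd y))"
    by (rule smooth_extI[OF smooth(2)]) (use W in auto)
  have "smooth_ext ({0..1} \<times> - {0}) (\<lambda>y. \<Psi> (fst (fst y, (\<Psi> (fst y) ^^ N) (snd y))) (snd (fst y, (\<Psi> (fst y) ^^ N) (snd y))))
    (\<lambda>y. \<Psi> (fst (fst y, G y)) (snd (fst y, G y)))"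
    by (rule smooth_ext_compose[OF 1 N]) (auto simp: \<Psi>_power_nonzero)
  then have "smooth_ext ({0..1} \<times> - {0}) (\<lambda>y. (\<Psi> (fst y) ^^ Suc N) (snd y)) (\<lambda>y. \<Psi> (fst y) (G y))" by simp
  then show ?case by blast
qed

text \<open>The slice \<open>Re (h z) = 1\<close> of the cone in \<open>support\<close>: every point
  moved by \<open>\<Psi>\<close> has a real multiple here. Compactness makes the estimate below
  uniform.\<close>

definition core :: "(complex^'n) set" where
  "core = {z. Re (h z) = 1 \<and> \<bar>Im (h z)\<bar> \<le> 1 \<and> norm (w z) \<le> 1}"

lemma compact_core: "compact core"
proof -
  have ch: "continuous_on UNIV h" "continuous_on UNIV w"
    using linear_continuous_on herm_linear wpart_linear by blast+
  have "closed core" unfolding core_def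
    by (intro closed_Collect_conj closed_Collect_eq closed_Collect_le continuous_intros ch)
  moreover have "norm z \<le> 3" if "z \<in> core" for z
  proof -
    have "cmod (h z) \<le> \<bar>Re (h z)\<bar> + \<bar>Im (h z)\<bar>" by (rule cmod_le)
    also have "\<dots> \<le> 2" using that by (simp add: core_def)
    finally have "(cmod (h z))\<^sup>2 \<le> 2\<^sup>2" by (intro power_mono) auto
    moreover have "(norm (w z))\<^sup>2 \<le> 1\<^sup>2" using that by (intro power_mono) (auto simp: core_def)
    ultimately have "(norm z)\<^sup>2 \<le> 3\<^sup>2" using norm_decomp[of z] by simp
    then show ?thesis by (rule power2_le_imp_le) simp
  qed
  then have "bounded core" by (auto simp: bounded_iff)
  ultimately show ?thesis by (simp add: compact_eq_bounded_closed)
qed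

lemma core_nonzero: "z \<in> core \<Longrightarrow> z \<noteq> 0"
  by (auto simp: core_def linear_0[OF bounded_linear.linear[OF herm_linear]])

text \<open>The real part along \<open>e\<close> is not scaled, so this holds for all
  \<open>l\<close> including 0. It is the purpose of the condition \<open>Re_pos\<close>.\<close>

lemma shrink_nonzero:
  assumes "Re (h z) > 0"
  shows "shrink l z \<noteq> 0"
proof
  assume "shrink l z = 0"
  then have "h (shrink l z) = 0" by (simp add: linear_0[OF bounded_linear.linear[OF herm_linear]])
  then show False using assms by (simp add: h_shrink complex_eq_iff)
qed

text \<open>The dilated point is scaled to have real part 1 along \<open>e\<close>. This costs a
  positive factor, which \<open>sgn\<close> forgets; once \<open>z\<close> is given,
  \<open>l\<close> enters only through \<open>shrink\<close>.\<close>

lemma \<omega>i_power_core: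
  assumes t: "t \<in> {0..1}" and l: "l > 0" and x: "x \<in> Sph" and Re: "Re (h x) > 0"
    and z: "z = inverse (l * Re (h x)) *\<^sub>R dil (inverse l) x"
  shows "(\<omega>i l t ^^ N) x = sgn (shrink l ((\<Psi> t ^^ N) z))"
proof -
  define c where "c = inverse (l * Re (h x))"
  have c: "c > 0" using l Re by (simp add: c_def)
  have y: "dil (inverse l) x \<noteq> 0" using dil_nonzero Sph_nonzero[OF x] l by simp
  have "shrink l ((\<Psi> t ^^ N) z) = (l * c) *\<^sub>R dil l ((\<Psi> t ^^ N) (dil (inverse l) x))"
    using \<Psi>_power_hom[OF t y, of c] c l unfolding z c_def[symmetric] by (simp add: shrink_dil dil_scaleR)
  then show ?thesis using \<omega>i_power[OF t l x] c l by (simp add: sgn_pos_scaleR)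
qed

text \<open>Rescaling by shrink makes sense down to l = 0, where the conjugated isotopy becomes the
  constant e. So the Hamiltonian of the composition extends continuously to l = 0, with value that of p at e.\<close>

lemma nonneg_ham_displaced:
  assumes p: "contact_path p" "nonneg_ham p"
    and ab: "0 \<le> a" "a < b" "b \<le> 1" and pos: "\<And>t. t \<in> {a..b} \<Longrightarrow> ham p t e > 0"
    and \<beta>: "smooth_on UNIV \<beta>" "\<And>t. \<beta> t \<in> {0..1}" "\<And>t. t \<le> a \<Longrightarrow> \<beta> t = 0" "\<And>t. t \<ge> b \<Longrightarrow> \<beta> t = 1"
  shows "\<exists>l>0. nonneg_ham (\<lambda>t x. p t ((\<omega>i l (\<beta> t) ^^ N) x))"
proof -
  obtain P where P: "extends_to p P"
    by (rule contact_family_smooth[OF contact_path_family[OF p(1)]])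
  obtain G where G: "smooth_ext ({0..1} \<times> - {0}) (\<lambda>y. (\<Psi> (fst y) ^^ N) (snd y)) G"
    using \<Psi>_power_smooth by blast
  let ?A = "UNIV \<times> {0..1} \<times> core :: (real \<times> real \<times> (complex^'n)) set"
  \<comment> \<open>The parameters are the scale, the time and a point of \<open>core\<close>. In
    them the displaced path is \<open>j\<close>, smooth also across scale 0.\<close>
  define f where "f y = (\<Psi> (\<beta> (fst (snd y))) ^^ N) (snd (snd y))" for y :: "real \<times> real \<times> (complex^'n)"
  define j where "j y = p (fst (snd y)) (sgn (shrink (fst y) (f y)))" for y
  define J where "J y = P (fst (snd y), sgn (shrink (fst y) (G (\<beta> (fst (snd y)), snd (snd y)))))" for y
  have f0: "f y \<noteq> 0" "Re (h (f y)) > 0" if "y \<in> ?A" for y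
    using that core_nonzero \<beta>(2) \<Psi>_power_nonzero \<Psi>_power_Re_pos unfolding f_def
    by (auto simp: core_def mem_Times_iff)
  have s0: "shrink (fst y) (f y) \<noteq> 0" if "y \<in> ?A" for y
    using shrink_nonzero[OF f0(2)[OF that]] .
  have J: "smooth_ext ?A j J"
  proof -
    have "smooth_on UNIV (\<lambda>y :: real \<times> real \<times> (complex^'n). (\<beta> (fst (snd y)), snd (snd y)))"
      by (intro smooth_on_Pair smooth_on_fst smooth_on_snd smooth_on_id smooth_on_compose[OF \<beta>(1)] open_UNIV UNIV_I)
    note sb = smooth_ext_UNIV[OF this]
    have "smooth_ext ?A (\<lambda>y. (\<Psi> (fst (\<beta> (fst (snd y)), snd (snd y))) ^^ N) (snd (\<beta> (fst (snd y)), snd (snd y)))) (\<lambda>y. G (\<beta> (fst (snd y)), snd (snd y)))"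
      by (rule smooth_ext_compose[OF G sb]) (use core_nonzero \<beta>(2) in \<open>auto simp: mem_Times_iff\<close>)
    then have "smooth_ext ?A f (\<lambda>y. G (\<beta> (fst (snd y)), snd (snd y)))" by (simp add: f_def[abs_def])
    then have "smooth_ext ?A (\<lambda>y. (fst y, f y)) (\<lambda>y. (fst y, G (\<beta> (fst (snd y)), snd (snd y))))"
      by (rule smooth_ext_Pair[OF smooth_ext_UNIV[OF smooth_on_fst[OF smooth_on_id[OF open_UNIV]]]])
    note sp = this
    have sh: "smooth_ext UNIV (\<lambda>y. shrink (fst y) (snd y)) (\<lambda>y. shrink (fst y) (snd y))"
      by (intro smooth_ext_UNIV smooth_on_shrink smooth_on_fst smooth_on_snd smooth_on_id open_UNIV)
    have "smooth_ext ?A (\<lambda>y. shrink (fst y) (f y)) (\<lambda>y. shrink (fst y) (G (\<beta> (fst (snd y)), snd (snd y))))"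
      using smooth_ext_compose[OF sh sp] by simp
    from smooth_ext_compose[OF smooth_extI[OF smooth_on_sgn order_refl] this]
    have "smooth_ext ?A (\<lambda>y. sgn (shrink (fst y) (f y))) (\<lambda>y. sgn (shrink (fst y) (G (\<beta> (fst (snd y)), snd (snd y)))))"
      using s0 by simp
    then have "smooth_ext ?A (\<lambda>y. (fst (snd y), sgn (shrink (fst y) (f y)))) (\<lambda>y. (fst (snd y), sgn (shrink (fst y) (G (\<beta> (fst (snd y)), snd (snd y))))))"
      by (rule smooth_ext_Pair[OF smooth_ext_UNIV[OF smooth_on_fst[OF smooth_on_snd[OF smooth_on_id[OF open_UNIV]]]]])
    from smooth_ext_compose[OF P this]
    have "smooth_ext ?A (\<lambda>y. (\<lambda>(t,x). p t x) (fst (snd y), sgn (shrink (fst y) (f y)))) J"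
      unfolding J_def[abs_def] using sgn_in_Sph[OF s0] by (simp add: mem_Times_iff)
    then show ?thesis by (rule smooth_ext_cong) (simp add: j_def)
  qed
  \<comment> \<open>The Hamiltonian of the displaced path in these parameters; the direction (0,1,0)
    is time.\<close>
  define R where "R y = lam0 (J y) (frechet_derivative J (at y) (0,1,0))" for y
  obtain U where U: "open U" "?A \<subseteq> U" "smooth_on U J" "\<forall>y\<in>?A. J y = j y"
    using J unfolding smooth_ext_def by blast
  have R: "continuous_on U R"
    unfolding R_def
    by (intro bounded_bilinear.continuous_on[OF lam0_bilinear] smooth_on_continuous_on
        smooth_on_frechet_derivative U(3))
  have hamR: "ham r t x = R (l, t, z)" if "t \<in> {0..1}" "z \<in> core" "\<And>s. s \<in> {0..1} \<Longrightarrow> r s x = j (l, s, z)"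
    for r :: "real \<Rightarrow> complex^'n \<Rightarrow> complex^'n" and t l z x
  proof -
    have A: "(l, t, z) \<in> ?A" using that by simp
    have d: "(J has_derivative frechet_derivative J (at (l,t,z))) (at (l,t,z))"
      by (rule smooth_on_has_derivative[OF U(3)]) (use A U in blast)
    have "((\<lambda>s. (l, s, z)) has_derivative (\<lambda>s. (0, s, 0))) (at t)"
      by (intro has_derivative_Pair has_derivative_ident has_derivative_const)
    from has_derivative_compose[OF this, of J, OF d]
    have 1: "((\<lambda>s. J (l, s, z)) has_derivative (\<lambda>s. frechet_derivative J (at (l,t,z)) (0, s, 0))) (at t)" .
    have 2: "frechet_derivative J (at (l,t,z)) (0, s, 0) = s *\<^sub>R frechet_derivative J (at (l,t,z)) (0, 1, 0)" for s
      using linear_scale[OF has_derivative_linear[OF d], of s "(0,1,0)"] by simp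
    have "((\<lambda>s. J (l, s, z)) has_vector_derivative frechet_derivative J (at (l,t,z)) (0,1,0)) (at t)"
      using 1 unfolding has_vector_derivative_def 2[symmetric] .
    moreover have "r s x = J (l, s, z)" if "s \<in> {0..1}" for s
      using U(4) \<open>z \<in> core\<close> \<open>\<And>s. s \<in> {0..1} \<Longrightarrow> r s x = j (l, s, z)\<close> that by simp
    ultimately show ?thesis
      using ham_eqI[OF that(1) _ open_UNIV UNIV_I, of "\<lambda>s. J (l, s, z)" _ r x] that(1) by (simp add: R_def)
  qed
  have R0: "R (0, t, z) > 0" if t: "t \<in> {a..b}" and z: "z \<in> core" for t z
  proof -
    have "p s e = j (0, s, z)" if "s \<in> {0..1}" for s
    proof -
      have "Re (h (f (0, s, z))) > 0" using f0[of "(0, s, z)"] that z by simp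
      \<comment> \<open>At scale 0 all of \<open>core\<close> collapses to the ray of
        \<open>e\<close>, so the displaced path becomes the orbit of \<open>e\<close> under
        \<open>p\<close>.\<close>
      moreover have "shrink 0 (f (0, s, z)) = Re (h (f (0, s, z))) *\<^sub>R e"
        by (rule decomp_eqI) (simp_all add: h_shrink w_shrink herm_scaleR_right w_scaleR h_e complex_eq_iff wpart_def[of e e])
      ultimately show ?thesis using Sph_sgn[OF e] by (simp add: j_def sgn_pos_scaleR)
    qed
    then have "ham p t e = R (0, t, z)" using hamR[of t z p e 0] t z ab by simp
    then show ?thesis using pos[OF t] by simp
  qed
  \<comment> \<open>\<open>R\<close> is positive on a compact set at scale 0, hence on a uniform
    neighbourhood of it; a single small \<open>l\<close> therefore serves all times in [a, b] and
    all of \<open>core\<close>.\<close>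
  have "open (R -` {0<..} \<inter> U)"
    using R U(1) by (simp add: continuous_on_open_vimage)
  moreover have "{0} \<times> {a..b} \<times> core \<subseteq> R -` {0<..} \<inter> U" using R0 U(2) ab by auto
  moreover have "compact ({0::real} \<times> {a..b} \<times> core)" by (intro compact_Times compact_core) auto
  ultimately obtain \<epsilon> where \<epsilon>: "\<epsilon> > 0" "(\<Union>y\<in>{0} \<times> {a..b} \<times> core. ball y \<epsilon>) \<subseteq> R -` {0<..} \<inter> U"
    using compact_subset_open_imp_ball_epsilon_subset by metis
  define l where "l = \<epsilon> / 2"
  have l: "l > 0" using \<epsilon> by (simp add: l_def)
  have Rl: "R (l, t, z) > 0" if "t \<in> {a..b}" "z \<in> core" for t z
  proof -
    have "(l, t, z) \<in> ball (0, t, z) \<epsilon>" using \<epsilon>(1) by (simp add: l_def dist_Pair_Pair)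
    then show ?thesis using \<epsilon>(2) that by blast
  qed
  define r where "r t x = p t ((\<omega>i l (\<beta> t) ^^ N) x)" for t x
  have rc: "contact_path r" unfolding r_def[abs_def]
    by (rule contact_path_compose[OF p(1) contact_path_reparam[OF contact_path_power[OF contact_path_\<omega>(2)] \<beta>(1,2,3)]])
      (use ab in auto)
  have S: "(\<omega>i l t ^^ N) x \<in> Sph" if "t \<in> {0..1}" "x \<in> Sph" for t x
    using that \<omega>_Sph(2)[OF that(1)] by (induction N) auto
  \<comment> \<open>Near times at which the displacement of \<open>x\<close> is constant, only
    \<open>p\<close> moves. This covers times outside [a, b] and points outside the support.\<close>
  have const: "ham r t x \<ge> 0" if "t \<in> {0..1}" "x \<in> Sph" "y \<in> Sph" "open S" "t \<in> S"
    "\<And>s. s \<in> {0..1} \<Longrightarrow> s \<in> S \<Longrightarrow> (\<omega>i l (\<beta> s) ^^ N) x = y" for t x y S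
    using ham_reparam[OF contact_path_family[OF p(1)] DERIV_ident _ that(1,3,4,5), of r x] p(2) that
    by (simp add: r_def nonneg_ham_def)
  have main: "ham r t x \<ge> 0" if t: "t \<in> {a..b}" and x: "x \<in> Sph" and Re: "Re (h x) > 0"
    and supp: "\<bar>Im (h (dil (inverse l) x))\<bar> \<le> \<bar>Re (h (dil (inverse l) x))\<bar>"
       "norm (w (dil (inverse l) x)) \<le> \<bar>Re (h (dil (inverse l) x))\<bar>" for t x
  proof -
    define z where "z = inverse (l * Re (h x)) *\<^sub>R dil (inverse l) x"
    have "Re (h (dil (inverse l) x)) = l * Re (h x)" by (simp add: h_dil divide_inverse)
    then have z: "z \<in> core" using supp l Re
      by (auto simp: z_def core_def herm_scaleR_right w_scaleR h_dil w_dil field_simps abs_mult)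
    have "r s x = j (l, s, z)" if "s \<in> {0..1}" for s
      using \<omega>i_power_core[OF \<beta>(2) l x Re z_def] by (simp add: r_def j_def f_def)
    then have "ham r t x = R (l, t, z)" using hamR[of t z r x l] t z ab by simp
    then show ?thesis using Rl[OF t z] by simp
  qed
  have "ham r t x \<ge> 0" if t: "t \<in> {0..1}" and x: "x \<in> Sph" for t x
  proof -
    consider "t < a" | "t > b" | "t \<in> {a..b}" by fastforce
    then show ?thesis
    proof cases
      case 1
      then show ?thesis
        using const[OF t x S[of 0 x], of "{..<a}"] x \<beta>(3) by simp
    next
      case 2
      then show ?thesis
        using const[OF t x S[of 1 x], of "{b<..}"] x \<beta>(4) by simp
    next
      case 3
      define y where "y = dil (inverse l) x"
      have y0: "y \<noteq> 0" using dil_nonzero Sph_nonzero[OF x] l by (simp add: y_def)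
      have Rey: "Re (h y) = l * Re (h x)" by (simp add: y_def h_dil divide_inverse)
      show ?thesis
      proof (cases "Re (h y) \<noteq> 0 \<and> \<bar>Im (h y)\<bar> \<le> \<bar>Re (h y)\<bar> \<and> norm (w y) \<le> \<bar>Re (h y)\<bar>")
        case False
        have "(\<Psi> s ^^ M) y = y" if "s \<in> {0..1}" for s M
          using support[OF that y0 False] by (induction M) auto
        then have "(\<omega>i l (\<beta> s) ^^ N) x = x" for s
          using \<omega>i_power[OF \<beta>(2) l x, of N s] dil_dil[of l x] l Sph_sgn[OF x] \<beta>(2)[of s] by (simp add: y_def)
        then show ?thesis using const[OF t x x open_UNIV] by simp
      next
        case True
        then have "Re (h x) \<noteq> 0" using Rey by auto
        \<comment> \<open>Either \<open>x\<close> or its antipode has a positive multiple in the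
          chart, and both have the same Hamiltonian.\<close>
        then consider "Re (h x) > 0" | "Re (h (- x)) > 0"
          using herm_scaleR_right[of e "-1" x] by fastforce
        then show ?thesis
        proof cases
          case 1
          then show ?thesis using main[OF 3 x 1] True by (simp add: y_def)
        next
          case 2
          have "- x \<in> Sph" using x by (simp add: Sph_def)
          moreover have "dil (inverse l) (- x) = - y" using dil_scaleR[of "inverse l" "-1" x] by (simp add: y_def)
          moreover have "h (- y) = - h y" "w (- y) = - w y"
            using herm_scaleR_right[of e "-1" y] w_scaleR[of "-1" y] by simp_all
          ultimately have "ham r t (- x) \<ge> 0" using main[OF 3 _ 2] True by simp
          then show ?thesis using ham_odd[OF rc t x] by simp
        qed
      qed
    qed
  qed
  then show ?thesis using l unfolding nonneg_ham_def r_def by blast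
qed

end

context bi_invariant_lorentzian
begin

text \<open>The displacement acts before \<open>p\<close>, and \<open>ham p t e\<close> is the value
  of the Hamiltonian at \<open>p t e\<close>, labelled by its source \<open>e\<close>. Hence one
  isotopy localised at the fixed point \<open>e\<close> serves all times of the interval.\<close>

lemma d_id_infinite_of_local_isotopy:
  assumes "local_isotopy e \<Phi> \<Psi> W" and p: "contact_path p" "nonneg_ham p" and t0: "t0 \<in> {0..1}" "ham p t0 e > 0"
  shows "d_id p = \<infinity>"
proof -
  interpret local_isotopy e \<Phi> \<Psi> W by fact
  obtain P where P: "extends_to p P"
    by (rule contact_family_smooth[OF contact_path_family[OF p(1)]])
  obtain U where U: "{0..1} \<times> Sph \<subseteq> U" "smooth_on U P" "\<forall>y\<in>{0..1} \<times> Sph. P y = (\<lambda>(t,x). p t x) y"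
    using P unfolding smooth_ext_def by blast
  have "continuous_on U (\<lambda>y. lam0 (P y) (frechet_derivative P (at y) (1,0)))"
    by (intro bounded_bilinear.continuous_on[OF lam0_bilinear] smooth_on_continuous_on
        smooth_on_frechet_derivative U(2))
  moreover have "continuous_on {0..1} (\<lambda>t::real. (t, e))" by (intro continuous_intros)
  moreover have "(\<lambda>t::real. (t, e)) ` {0..1} \<subseteq> U" using U(1) e by auto
  ultimately have "continuous_on {0..1} (\<lambda>t. lam0 (P (t, e)) (frechet_derivative P (at (t, e)) (1,0)))"
    using continuous_on_compose2 by blast
  then have "continuous_on {0..1} (\<lambda>t. ham p t e)"
    by (rule continuous_on_eq) (use ham_smooth_ext[OF P _ e] U(3) e in auto)
  then obtain \<delta> where \<delta>: "\<delta> > 0" "\<And>t. t \<in> {0..1} \<Longrightarrow> dist t t0 < \<delta> \<Longrightarrow> dist (ham p t e) (ham p t0 e) < ham p t0 e"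
    using t0 unfolding continuous_on_iff by meson
  \<comment> \<open>The interval is clipped because \<open>t0\<close> may be an end of
    [0, 1].\<close>
  define a where "a = max 0 (t0 - \<delta>/2)"
  define b where "b = min 1 (t0 + \<delta>/2)"
  have ab: "0 \<le> a" "a < b" "b \<le> 1" using \<delta>(1) t0(1) by (auto simp: a_def b_def)
  have pos: "ham p t e > 0" if "t \<in> {a..b}" for t
  proof -
    have "dist (ham p t e) (ham p t0 e) < ham p t0 e"
      by (rule \<delta>(2)) (use that \<delta>(1) in \<open>auto simp: a_def b_def dist_real_def\<close>)
    then show ?thesis by (simp add: dist_real_def)
  qed
  define \<beta> where "\<beta> t = smooth_step (inverse (b - a) * t + (- a * inverse (b - a)))" for t
  have \<beta>: "smooth_on UNIV \<beta>" "\<And>t. \<beta> t \<in> {0..1}" "\<And>t. t \<le> a \<Longrightarrow> \<beta> t = 0" "\<And>t. t \<ge> b \<Longrightarrow> \<beta> t = 1"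
  proof -
    show "smooth_on UNIV \<beta>" unfolding \<beta>_def[abs_def] by (rule smooth_on_affine_step)
    show "\<beta> t \<in> {0..1}" for t using smooth_step_range by (simp add: \<beta>_def)
    have e: "inverse (b - a) * t + (- a * inverse (b - a)) = (t - a) / (b - a)" for t
      by (simp add: divide_inverse algebra_simps)
    show "\<beta> t = 0" if "t \<le> a" for t unfolding \<beta>_def e
      by (rule smooth_step_0) (use that ab in \<open>simp add: divide_le_0_iff\<close>)
    show "\<beta> t = 1" if "t \<ge> b" for t unfolding \<beta>_def e
      by (rule smooth_step_1) (use that ab in simp)
  qed
  have \<beta>01: "\<beta> 0 = 0" "\<beta> 1 = 1" using \<beta>(3,4) ab by auto
  have pos\<phi>: "d_id \<phi> > 0" using d_id_pos[OF contact_path_\<phi>(1) nonneg_ham_\<phi>] \<phi>_somewhere_pos by blast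
  show ?thesis
  proof (rule d_id_infinite[OF pos\<phi>])
    fix N
    \<comment> \<open>The scale depends on \<open>N\<close>, but \<open>d_id (\<omega> l)\<close>
      does not depend on the scale.\<close>
    obtain l where l: "l > 0" "nonneg_ham (\<lambda>t x. p t ((\<omega>i l (\<beta> t) ^^ Suc N) x))"
      using nonneg_ham_displaced[OF p ab pos \<beta>] by blast
    let ?\<omega>N = "\<lambda>t x. (\<omega> l t ^^ Suc N) x"
    let ?\<psi> = "\<lambda>t. ?\<omega>N (\<beta> t)"
    let ?r = "\<lambda>t x. p t ((\<omega>i l (\<beta> t) ^^ Suc N) x)"
    have \<omega>: "nonneg_cls (\<omega> l)" using nonneg_ham_imp_cls[OF contact_path_\<omega>(1) nonneg_ham_\<omega>[OF l(1)]] .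
    have d_id\<omega>: "d_id (\<omega> l) = d_id \<phi>"
      unfolding \<omega>_def[abs_def] by (rule d_id_conj[OF contact_path_\<phi>(1) contact_path_dil contact_path_dil dil_path_inverse])
    have \<psi>c: "contact_path ?\<psi>"
      by (rule contact_path_reparam[OF contact_path_power[OF contact_path_\<omega>(1)] \<beta>(1,2) \<beta>01(1)])
    have cls\<psi>: "cls ?\<psi> = cls ?\<omega>N"
      by (rule cls_reparam[OF contact_path_power[OF contact_path_\<omega>(1)] \<beta>(1,2) \<beta>01])
    have \<psi>: "nonneg_cls ?\<psi>"
      by (rule nonneg_cls_cong[OF conjunct1[OF d_id_power[OF \<omega>]] \<psi>c cls\<psi>])
    have rc: "contact_path ?r"
      by (rule contact_path_compose[OF p(1) contact_path_reparam[OF contact_path_power[OF contact_path_\<omega>(2)] \<beta>(1,2) \<beta>01(1)]])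
    have r: "nonneg_cls ?r" by (rule nonneg_ham_imp_cls[OF rc l(2)])
    \<comment> \<open>Undoing the displacement gives \<open>p\<close> back at every time, so
      \<open>d_id p\<close> dominates the distance of the N-th power.\<close>
    have "cls p = cls (\<lambda>t x. ?r t (?\<psi> t x))"
      by (rule cls_cong[OF p(1)]) (simp add: \<omega>i_power_\<omega>[OF \<beta>(2)] del: funpow.simps)
    then have "d_id p = d_id (\<lambda>t x. ?r t (?\<psi> t x))" unfolding d_id_def by simp
    also have "\<dots> \<ge> d_id ?\<psi> + d_id ?r" by (rule d_id_compose[OF r \<psi>])
    finally have "d_id ?\<psi> \<le> d_id p" by (rule order_trans[rotated]) simp
    moreover have "d_id ?\<psi> = d_id ?\<omega>N" unfolding d_id_def cls\<psi> ..
    moreover have "of_nat (Suc N) * d_id (\<omega> l) \<le> d_id ?\<omega>N" using conjunct2[OF d_id_power[OF \<omega>]] .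
    ultimately show "of_nat (Suc N) * d_id \<phi> \<le> d_id p" unfolding d_id\<omega> by (metis order_trans)
  qed
qed

end

section \<open>A localised isotopy in higher dimensions\<close>

lemma cis_has_vector_derivative:
  assumes "(f has_real_derivative f') (at s)"
  shows "((\<lambda>s. cis (f s)) has_vector_derivative (\<i> * of_real f' * cis (f s))) (at s)"
proof -
  have "((\<lambda>s. of_real (cos (f s)) + \<i> * of_real (sin (f s))) has_vector_derivative
     (of_real (- sin (f s) * f') + \<i> * of_real (cos (f s) * f'))) (at s)"
    by (intro has_vector_derivative_add has_vector_derivative_mult_right has_vector_derivative_of_real
        DERIV_chain2[OF DERIV_cos assms] DERIV_chain2[OF DERIV_sin assms])
  moreover have "(\<lambda>s. of_real (cos (f s)) + \<i> * of_real (sin (f s))) = (\<lambda>s. cis (f s))"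
    by (auto simp: complex_eq_iff)
  moreover have "of_real (- sin (f s) * f') + \<i> * of_real (cos (f s) * f') = \<i> * of_real f' * cis (f s)"
    by (auto simp: complex_eq_iff)
  ultimately show ?thesis by metis
qed

text \<open>A Hamiltonian on the plane as a function of the squared radius, supported where r \<le>
  1. Its derivative \<open>speed\<close> is the angular velocity of the rotation that it
  generates.\<close>

definition profile :: "real \<Rightarrow> real" where "profile r = flatE 0 (1 - r)"
definition speed :: "real \<Rightarrow> real" where "speed r = - flatE 2 (1 - r)"
definition speed' :: "real \<Rightarrow> real" where "speed' r = flatE 4 (1 - r) - 2 * flatE 3 (1 - r)"

lemma profile_derivative: "(profile has_real_derivative speed r) (at r)"
  and speed_derivative: "(speed has_real_derivative speed' r) (at r)"
proof -
  have d: "((\<lambda>r. 1 - r) has_real_derivative -1) (at r)" by (auto intro!: derivative_eq_intros)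
  have "(flatE 0 has_real_derivative flatE 2 (1 - r)) (at (1 - r))"
    using flatE_has_derivative[of 0 "1 - r"] by (simp add: numeral_2_eq_2)
  from DERIV_chain2[OF this d] show "(profile has_real_derivative speed r) (at r)"
    by (simp add: profile_def[abs_def] speed_def)
  have "(flatE 2 has_real_derivative flatE 4 (1 - r) - 2 * flatE 3 (1 - r)) (at (1 - r))"
    using flatE_has_derivative[of 2 "1 - r"] by (simp add: eval_nat_numeral)
  from DERIV_minus[OF DERIV_chain2[OF this d]] show "(speed has_real_derivative speed' r) (at r)"
    by (simp add: speed_def[abs_def] speed'_def)
qed

lemma smooth_on_profile: "smooth_on UNIV profile" and smooth_on_speed: "smooth_on UNIV speed"
proof -
  have f: "smooth_on UNIV (\<lambda>r. flatE n (1 - r))" for n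
    by (intro smooth_on_compose[OF smooth_on_flatE] smooth_on_diff smooth_on_const smooth_on_id) auto
  show "smooth_on UNIV profile" "smooth_on UNIV speed"
    using f[of 0] smooth_on_minus[OF f[of 2]] by (simp_all add: profile_def[abs_def] speed_def[abs_def])
qed

lemma profile_speed_zero: "r \<ge> 1 \<Longrightarrow> profile r = 0" "r \<ge> 1 \<Longrightarrow> speed r = 0"
  by (simp_all add: profile_def speed_def flatE_zero)

lemma profile_nonneg: "profile r \<ge> 0" and profile_pos: "profile 0 > 0"
  by (simp_all add: profile_def flatE_nonneg flatE_pos)

context unit_vector
begin

text \<open>
  The quantity \<open>norm (w z)\<close> is preserved, the point \<open>h z / norm (w z)\<close> of the plane is rotated about \<open>c\<close> by an
  angle depending on its distance to \<open>c\<close>, and \<open>w z\<close> is multiplied by a phase. The 1-form \<open>lam0\<close> is preserved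
  exactly if \<open>phase\<close> is a primitive of the defect of the planar rotation; this determines the formula.
  It is the flow of the Hamiltonian \<open>(norm (w z))\<^sup>2 * profile (rad c z) / 2\<close>.
\<close>

definition offset :: "real \<Rightarrow> complex^'n \<Rightarrow> complex" where
  "offset c z = inverse (norm (w z)) *\<^sub>R h z - of_real c"

definition rad :: "real \<Rightarrow> complex^'n \<Rightarrow> real" where
  "rad c z = offset c z \<bullet> offset c z"

definition rot :: "real \<Rightarrow> real \<Rightarrow> complex^'n \<Rightarrow> complex" where
  "rot c t z = cis (t * speed (rad c z)) * offset c z"

definition phase :: "real \<Rightarrow> real \<Rightarrow> complex^'n \<Rightarrow> real" where
  "phase c t z = c * Im (offset c z) - c * Im (rot c t z) - t * (rad c z * speed (rad c z) - profile (rad c z))"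

definition twist :: "real \<Rightarrow> real \<Rightarrow> complex^'n \<Rightarrow> complex^'n" where
  "twist c t z = (norm (w z) *\<^sub>R (of_real c + rot c t z)) *s e + cis (phase c t z) *s w z"

lemma h_twist: "h (twist c t z) = norm (w z) *\<^sub>R (of_real c + rot c t z)"
  by (simp add: twist_def h_comb h_smult_w)

lemma w_twist: "w (twist c t z) = cis (phase c t z) *s w z"
  by (simp add: twist_def w_comb h_smult_w)

lemma norm_smult: "norm (a *s (z::complex^'m)) = cmod a * norm z"
proof -
  have "herm (a *s z) (a *s z) = (a * cnj a) * herm z z" by (simp add: herm_smult_left herm_smult_right)
  then have "complex_of_real ((norm (a *s z))\<^sup>2) = complex_of_real ((cmod a * norm z)\<^sup>2)"
    unfolding herm_self complex_norm_square[symmetric] by (simp add: power_mult_distrib)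
  then have "(norm (a *s z))\<^sup>2 = (cmod a * norm z)\<^sup>2" using of_real_eq_iff by blast
  then show ?thesis by (rule power2_eq_imp_eq) auto
qed

lemma norm_w_twist: "norm (w (twist c t z)) = norm (w z)"
  by (simp add: w_twist norm_smult)

lemma offset_twist: "w z \<noteq> 0 \<Longrightarrow> offset c (twist c t z) = rot c t z"
  by (simp add: offset_def norm_w_twist h_twist)

lemma rad_cmod: "rad c z = (cmod (offset c z))\<^sup>2"
  by (simp add: rad_def power2_norm_eq_inner)

lemma cmod_rot: "cmod (rot c t z) = cmod (offset c z)"
  by (simp add: rot_def norm_mult)

lemma rad_twist: "w z \<noteq> 0 \<Longrightarrow> rad c (twist c t z) = rad c z"
  by (simp add: rad_cmod offset_twist cmod_rot)

text \<open>The twist keeps the distance to the centre, hence the rotation angle, so the opposite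
  time undoes it.\<close>

lemma rot_twist: "w z \<noteq> 0 \<Longrightarrow> rot c (- t) (twist c t z) = offset c z"
proof -
  assume "w z \<noteq> 0"
  then have "rot c (- t) (twist c t z) = (cis (- (t * speed (rad c z))) * cis (t * speed (rad c z))) * offset c z"
    by (simp add: rot_def offset_twist rad_twist)
  then show ?thesis by (simp add: cis_mult)
qed

lemma phase_twist: "w z \<noteq> 0 \<Longrightarrow> phase c (- t) (twist c t z) = - phase c t z"
  by (simp add: phase_def rot_twist offset_twist rad_twist algebra_simps)

lemma h_offset: "w z \<noteq> 0 \<Longrightarrow> norm (w z) *\<^sub>R (of_real c + offset c z) = h z"
  by (simp add: offset_def)

lemma twist_inverse:
  assumes "w z \<noteq> 0"
  shows "twist c (- t) (twist c t z) = z"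
proof (rule decomp_eqI)
  show "h (twist c (- t) (twist c t z)) = h z"
    by (simp add: h_twist[of c "- t"] norm_w_twist rot_twist[OF assms] h_offset[OF assms])
  have "w (twist c (- t) (twist c t z)) = (cis (- phase c t z) * cis (phase c t z)) *s w z"
    by (simp add: w_twist phase_twist[OF assms] vector_smult_assoc)
  then show "w (twist c (- t) (twist c t z)) = w z" by (simp add: cis_mult)
qed

lemma twist_id:
  assumes "w z \<noteq> 0" "rad c z \<ge> 1"
  shows "twist c t z = z"
proof (rule decomp_eqI)
  have r: "rot c t z = offset c z" using assms by (simp add: rot_def profile_speed_zero)
  show "h (twist c t z) = h z" using h_offset[OF assms(1)] by (simp add: h_twist r)
  have "phase c t z = 0" using assms by (simp add: phase_def r profile_speed_zero)
  then show "w (twist c t z) = w z" by (simp add: w_twist)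
qed

lemma smooth_on_norm_w:
  assumes "smooth_on U f" "\<And>x. x \<in> U \<Longrightarrow> w (f x) \<noteq> 0"
  shows "smooth_on U (\<lambda>x. norm (w (f x)))"
proof -
  have "smooth_on U (\<lambda>x. sqrt (w (f x) \<bullet> w (f x)))"
    by (intro smooth_on_compose[OF smooth_on_sqrt] smooth_on_inner smooth_on_w assms(1)) (use assms in auto)
  then show ?thesis by (simp add: norm_eq_sqrt_inner)
qed

lemma smooth_on_cis: "smooth_on U f \<Longrightarrow> smooth_on U (\<lambda>x. cis (f x))"
  unfolding cis.ctr
  by (intro smooth_on_Complex smooth_on_compose[OF smooth_on_cos] smooth_on_compose[OF smooth_on_sin]) auto

lemma smooth_on_twist:
  assumes "smooth_on U g" "smooth_on U f" "\<And>x. x \<in> U \<Longrightarrow> w (f x) \<noteq> 0"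
  shows "smooth_on U (\<lambda>x. twist c (g x) (f x))"
proof -
  note U = smooth_on_open[OF assms(1)]
  have n: "smooth_on U (\<lambda>x. norm (w (f x)))" by (rule smooth_on_norm_w[OF assms(2,3)])
  have ni: "smooth_on U (\<lambda>x. inverse (norm (w (f x))))"
    by (rule smooth_on_compose[OF smooth_on_inverse n]) (use assms(3) in auto)
  have u: "smooth_on U (\<lambda>x. offset c (f x))" unfolding offset_def
    by (intro smooth_on_diff smooth_on_scaleR ni smooth_on_h assms(2) smooth_on_const U)
  have r: "smooth_on U (\<lambda>x. rad c (f x))" unfolding rad_def
    by (intro smooth_on_inner u)
  have k: "smooth_on U (\<lambda>x. speed (rad c (f x)))" by (rule smooth_on_compose[OF smooth_on_speed r]) simp
  have G: "smooth_on U (\<lambda>x. profile (rad c (f x)))" by (rule smooth_on_compose[OF smooth_on_profile r]) simp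
  have R: "smooth_on U (\<lambda>x. rot c (g x) (f x))" unfolding rot_def
    by (intro smooth_on_mult smooth_on_cis assms(1) k u)
  have T: "smooth_on U (\<lambda>x. phase c (g x) (f x))" unfolding phase_def
    by (intro smooth_on_diff smooth_on_mult smooth_on_const U smooth_on_Im u R assms(1) r k G)
  show ?thesis unfolding twist_def
    by (intro smooth_on_add smooth_on_smult smooth_on_scaleR n smooth_on_const U R smooth_on_cis T smooth_on_w assms(2))
qed

text \<open>Here u is the offset, E the rotation, and primes are derivatives along a curve. Rotating
  adds \<open>c * Im R' + \<nu>' * r\<close> in place of \<open>c * Im u'\<close>, and the
  derivative \<tau>' of the phase compensates everything except the Hamiltonian term
  \<open>G * dt\<close>.\<close>

lemma twist_algebra:
  fixes u u' E :: complex
  assumes E: "cmod E = 1" and r: "r = u \<bullet> u"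
    and R': "R' = E * (u' + \<i> * of_real \<nu>' * u)" and \<nu>': "\<nu>' = dt * k + t * k'"
    and \<tau>': "\<tau>' = c * Im u' - c * Im R' - dt * (r * k - G) - t * (r * k')"
  shows "Im (cnj (of_real c + E * u) * R') + \<tau>' = Im (cnj (of_real c + u) * u') + G * dt"
proof -
  have EE: "cnj E * E = 1" using E complex_norm_square[of E] by (simp add: mult.commute)
  have offset: "cnj u * u = of_real r" by (simp add: r complex_eq_iff inner_complex_def)
  have "cnj (of_real c + E * u) * R' = of_real c * R' + (cnj E * E) * (cnj u * u' + \<i> * of_real \<nu>' * (cnj u * u))"
    by (simp add: R' algebra_simps)
  then have "Im (cnj (of_real c + E * u) * R') = c * Im R' + Im (cnj u * u') + \<nu>' * r"
    by (simp add: EE offset)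
  then show ?thesis by (simp add: \<tau>' \<nu>' algebra_simps)
qed

text \<open>Time and space are treated together: dt = 0 gives invariance of \<lambda>_0, and v = 0
  with dt = 1 gives the Hamiltonian of the lift.\<close>

lemma twist_derivative:
  assumes w0: "w z \<noteq> 0"
  shows "lam0 (twist c t z) (joint_deriv (twist c) t z (dt,v))
    = lam0 z v + (norm (w z))\<^sup>2 * profile (rad c z) * dt / 2"
proof -
  \<comment> \<open>Everything is differentiated along one line in time and space, so rules in one
    real variable suffice.\<close>
  define zz where "zz s = z + s *\<^sub>R v" for s
  define tt where "tt s = t + s * dt" for s
  have [simp]: "zz 0 = z" "tt 0 = t" by (simp_all add: zz_def tt_def)
  have dt: "(tt has_real_derivative dt) (at 0)" unfolding tt_def by (auto intro!: derivative_eq_intros)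
  have dz: "(zz has_vector_derivative v) (at 0)" unfolding zz_def by (auto intro!: derivative_eq_intros)
  have dh: "((\<lambda>s. h (zz s)) has_vector_derivative h v) (at 0)"
    by (rule bounded_linear.has_vector_derivative[OF herm_linear dz])
  have dw: "((\<lambda>s. w (zz s)) has_vector_derivative w v) (at 0)"
    by (rule bounded_linear.has_vector_derivative[OF wpart_linear dz])
  define q where "q = norm (w z)"
  have q0: "q \<noteq> 0" using w0 by (simp add: q_def)
  define q' where "q' = w v \<bullet> sgn (w z)"
  have "(norm has_derivative (\<lambda>h. h \<bullet> sgn (w z))) (at (w (zz 0)))"
    using GDERIV_norm[OF w0] by (simp add: gderiv_def)
  from has_derivative_compose[OF dw[unfolded has_vector_derivative_def] this]
  have dq: "((\<lambda>s. norm (w (zz s))) has_real_derivative q') (at 0)"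
    by (simp add: has_field_derivative_def q'_def mult.commute[of q'] mult_commute_abs)
  define U where "U = offset c z"
  define U' where "U' = (- (inverse q * q' * inverse q)) *\<^sub>R h z + inverse q *\<^sub>R h v"
  have dqi: "((\<lambda>s. inverse (norm (w (zz s)))) has_real_derivative - (inverse q * q' * inverse q)) (at 0)"
    using DERIV_inverse'[OF dq] q0 by (simp add: q_def)
  have dU: "((\<lambda>s. offset c (zz s)) has_vector_derivative U') (at 0)"
    unfolding offset_def
    using has_vector_derivative_diff[OF has_vector_derivative_scaleR[OF dqi dh] has_vector_derivative_const]
    by (simp add: U'_def q_def add.commute)
  define r where "r = rad c z"
  define r' where "r' = U \<bullet> U' + U' \<bullet> U"
  have dr: "((\<lambda>s. rad c (zz s)) has_real_derivative r') (at 0)"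
    unfolding rad_def has_real_derivative_iff_has_vector_derivative
    using bounded_bilinear.has_vector_derivative[OF bounded_bilinear_inner dU dU] by (simp add: r'_def U_def)
  have dk: "((\<lambda>s. speed (rad c (zz s))) has_real_derivative speed' r * r') (at 0)"
    using DERIV_chain2[OF speed_derivative dr] by (simp add: r_def)
  have dG: "((\<lambda>s. profile (rad c (zz s))) has_real_derivative speed r * r') (at 0)"
    using DERIV_chain2[OF profile_derivative dr] by (simp add: r_def)
  define k' where "k' = speed' r * r'"
  define \<nu>' where "\<nu>' = dt * speed r + t * k'"
  have d\<nu>: "((\<lambda>s. tt s * speed (rad c (zz s))) has_real_derivative \<nu>') (at 0)"
    using DERIV_mult[OF dt dk] by (simp add: \<nu>'_def r_def k'_def algebra_simps)
  define E where "E = cis (t * speed r)"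
  define R' where "R' = E * (U' + \<i> * of_real \<nu>' * U)"
  have dR: "((\<lambda>s. rot c (tt s) (zz s)) has_vector_derivative R') (at 0)"
    unfolding rot_def
    using has_vector_derivative_mult[OF cis_has_vector_derivative[OF d\<nu>] dU]
    by (simp add: R'_def E_def r_def U_def algebra_simps)
  define \<tau>' where "\<tau>' = c * Im U' - c * Im R' - dt * (r * speed r - profile r) - t * (r * k')"
  have d\<tau>: "((\<lambda>s. phase c (tt s) (zz s)) has_real_derivative \<tau>') (at 0)"
  proof -
    have dIm: "((\<lambda>s. Im (f s)) has_real_derivative Im f') (at 0)" if "(f has_vector_derivative f') (at 0)" for f f'
      using bounded_linear.has_vector_derivative[OF bounded_linear_Im that]
      by (simp add: has_real_derivative_iff_has_vector_derivative)
    \<comment> \<open>As \<open>speed\<close> is the derivative of \<open>profile\<close>, the two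
      terms in which r' multiplies \<open>speed\<close> cancel and only \<open>r * k'\<close>
      survives.\<close>
    have "((\<lambda>s. phase c (tt s) (zz s)) has_real_derivative
      c * Im U' - c * Im R' - (dt * (rad c (zz 0) * speed (rad c (zz 0)) - profile (rad c (zz 0))) +
        (r' * speed (rad c (zz 0)) + (speed' r * r') * rad c (zz 0) - speed r * r') * tt 0)) (at 0)"
      unfolding phase_def
      by (intro DERIV_diff DERIV_cmult dIm dU dR DERIV_mult dt dr dk dG)
    then show ?thesis by (simp add: \<tau>'_def r_def k'_def algebra_simps)
  qed
  define a where "a = q *\<^sub>R (of_real c + E * U)"
  define a' where "a' = q' *\<^sub>R (of_real c + E * U) + q *\<^sub>R R'"
  have rotz: "rot c t z = E * U" by (simp add: rot_def E_def r_def U_def)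
  have da: "((\<lambda>s. norm (w (zz s)) *\<^sub>R (of_real c + rot c (tt s) (zz s))) has_vector_derivative a') (at 0)"
    using has_vector_derivative_scaleR[OF dq has_vector_derivative_add[OF has_vector_derivative_const dR, of "of_real c"]]
    by (simp add: a'_def rotz q_def add.commute)
  define \<tau> where "\<tau> = phase c t z"
  have db: "((\<lambda>s. cis (phase c (tt s) (zz s))) has_vector_derivative (\<i> * of_real \<tau>' * cis \<tau>)) (at 0)"
    using cis_has_vector_derivative[OF d\<tau>] by (simp add: \<tau>_def)
  let ?T' = "a' *s e + (cis \<tau> *s w v + (\<i> * of_real \<tau>' * cis \<tau>) *s w z)"
  have "((\<lambda>s. twist c (tt s) (zz s)) has_vector_derivative (a *s 0 + a' *s e + (cis \<tau> *s w v + (\<i> * of_real \<tau>' * cis \<tau>) *s w z))) (at 0)"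
    unfolding twist_def
    using has_vector_derivative_add[OF
        bounded_bilinear.has_vector_derivative[OF smult_bilinear da has_vector_derivative_const, of e]
        bounded_bilinear.has_vector_derivative[OF smult_bilinear db dw]]
    by (simp add: a_def \<tau>_def rotz q_def)
  then have d1: "((\<lambda>s. twist c (tt s) (zz s)) has_vector_derivative ?T') (at 0)" by simp
  have o: "open {y::real \<times> (complex^'n). w (snd y) \<noteq> 0}"
    by (intro open_Collect_neq continuous_intros continuous_on_compose2[OF linear_continuous_on[OF wpart_linear]]) auto
  have "smooth_on {y. w (snd y) \<noteq> 0} (\<lambda>y. twist c (fst y) (snd y))"
    by (intro smooth_on_twist smooth_on_fst smooth_on_snd smooth_on_id o) auto
  from smooth_on_has_derivative[OF this, of "(t,z)"] w0
  have d: "((\<lambda>y. twist c (fst y) (snd y)) has_derivative joint_deriv (twist c) t z) (at (tt 0, zz 0))"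
    by simp
  have "((\<lambda>s. (tt s, zz s)) has_derivative (\<lambda>s. (s * dt, s *\<^sub>R v))) (at 0)"
    using dt dz by (intro has_derivative_Pair) (simp_all add: has_field_derivative_def has_vector_derivative_def mult_commute_abs)
  from has_derivative_compose[OF this d]
  have "((\<lambda>s. twist c (tt s) (zz s)) has_derivative
     (\<lambda>s. joint_deriv (twist c) t z (s * dt, s *\<^sub>R v))) (at 0)" by simp
  from fun_cong[OF has_derivative_unique[OF this d1[unfolded has_vector_derivative_def]], of 1]
  have fd: "joint_deriv (twist c) t z (dt, v) = ?T'" by simp
  have tw: "twist c t z = a *s e + cis \<tau> *s w z" by (simp add: twist_def a_def \<tau>_def rotz q_def)
  have cc: "cnj (cis \<tau>) * cis \<tau> = 1" using complex_norm_square[of "cis \<tau>"] by (simp add: mult.commute)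
  have h0: "h (cis \<tau> *s w v + (\<i> * of_real \<tau>' * cis \<tau>) *s w z) = 0" by (simp add: herm_add_right h_smult_w)
  have hzq: "h z = q *\<^sub>R (of_real c + U)" using h_offset[OF w0, of c] by (simp add: q_def U_def)
  have hvq: "h v = q' *\<^sub>R (of_real c + U) + q *\<^sub>R U'"
    using q0 by (simp add: U'_def hzq scaleR_conv_of_real field_simps)
  \<comment> \<open>The part of a derivative that is parallel to the vector spans no area. So the
    change q' of the norm drops out, and only the factor q^2 remains.\<close>
  have ImS: "Im (cnj (x *\<^sub>R A) * (y *\<^sub>R A + x *\<^sub>R B)) = x\<^sup>2 * Im (cnj A * B)" for x y :: real and A B :: complex
    by (simp add: scaleR_conv_of_real algebra_simps power2_eq_square)
  have alg: "Im (cnj (of_real c + E * U) * R') + \<tau>' = Im (cnj (of_real c + U) * U') + profile r * dt"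
    by (rule twist_algebra[OF _ _ R'_def \<nu>'_def \<tau>'_def]) (simp_all add: E_def r_def rad_def U_def)
  have "Im (herm (twist c t z) ?T') = Im (cnj a * a') + Im (herm (cis \<tau> *s w z) (cis \<tau> *s w v + (\<i> * of_real \<tau>' * cis \<tau>) *s w z))"
    unfolding tw herm_comb[OF h_smult_w h0] by simp
  also have "herm (cis \<tau> *s w z) (cis \<tau> *s w v + (\<i> * of_real \<tau>' * cis \<tau>) *s w z) =
      (cnj (cis \<tau>) * cis \<tau>) * (herm (w z) (w v) + \<i> * of_real \<tau>' * of_real (q\<^sup>2))"
    by (simp only: herm_add_right herm_smult_left herm_smult_right herm_self q_def) (simp add: algebra_simps)
  also have "Im (cnj a * a') + Im \<dots> = q\<^sup>2 * (Im (cnj (of_real c + E * U) * R') + \<tau>') + Im (herm (w z) (w v))"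
    unfolding cc a_def a'_def ImS by (simp add: algebra_simps)
  also have "\<dots> = Im (cnj (h z) * h v) + Im (herm (w z) (w v)) + q\<^sup>2 * profile r * dt"
    unfolding alg hzq hvq ImS by (simp add: algebra_simps)
  also have "\<dots> = Im (herm z v) + q\<^sup>2 * profile r * dt" using herm_decomp[of z v] by simp
  finally show ?thesis unfolding fd lam0_herm by (simp add: q_def r_def)
qed

end

context unit_vector
begin

text \<open>The map must commute with the antipode, so the twist is performed around \<open>2\<close> and around \<open>- 2\<close>.\<close>

definition side :: "complex^'n \<Rightarrow> real" where
  "side z = (if Re (h z) \<ge> 0 then 2 else - 2)"

text \<open>As \<open>w z\<close> tends to 0 with \<open>h z\<close> away from 0, the point
  \<open>h z / norm (w z)\<close> escapes to infinity, far from the unit discs about 2 and -2; so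
  the identity is the right continuation.\<close>

definition loc :: "real \<Rightarrow> complex^'n \<Rightarrow> complex^'n" where
  "loc t z = (if w z = 0 then z else twist (side z) t z)"

lemma offset_sel: "Re (offset c z) = Re (h z) / norm (w z) - c" "Im (offset c z) = Im (h z) / norm (w z)"
  by (simp_all add: offset_def divide_inverse mult.commute)

text \<open>The unit discs about 2 and -2 lie in |Re| > 1 and |Im| < 1. This is why the centres have
  modulus 2: the support falls into the cone required by \<open>local_isotopy\<close>.\<close>

lemma rad_less_1:
  assumes w: "w z \<noteq> 0" and r: "rad (side z) z < 1"
  shows "norm (w z) < \<bar>Re (h z)\<bar>" "\<bar>Im (h z)\<bar> < norm (w z)"
proof -
  have "(cmod (offset (side z) z))\<^sup>2 < 1\<^sup>2" using r by (simp add: rad_cmod)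
  then have c: "cmod (offset (side z) z) < 1" by (rule power2_less_imp_less) simp
  have R: "\<bar>Re (h z) / norm (w z) - side z\<bar> < 1" "\<bar>Im (h z) / norm (w z)\<bar> < 1"
    using abs_Re_le_cmod[of "offset (side z) z"] abs_Im_le_cmod[of "offset (side z) z"] c by (simp_all add: offset_sel)
  then show "\<bar>Im (h z)\<bar> < norm (w z)" using w by (simp add: field_simps)
  have "\<bar>Re (h z) / norm (w z)\<bar> > 1"
    using R(1) by (auto simp: side_def split: if_splits)
  then show "norm (w z) < \<bar>Re (h z)\<bar>" using w by (simp add: field_simps)
qed

lemma loc_id:
  assumes "\<not> (norm (w z) < \<bar>Re (h z)\<bar> \<and> \<bar>Im (h z)\<bar> < norm (w z))"
  shows "loc t z = z"
proof (cases "w z = 0")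
  case False
  then have "rad (side z) z \<ge> 1" using assms rad_less_1[OF False] by (meson not_le)
  then show ?thesis using twist_id[OF False] by (simp add: loc_def)
qed (simp add: loc_def)

text \<open>The rotated point stays in the unit disc about c, which does not reach the imaginary
  axis; hence the twist cannot change sides.\<close>

lemma Re_twist:
  assumes w: "w z \<noteq> 0" and r: "rad c z < 1" and c: "c = 2 \<or> c = - 2"
  shows "Re (h (twist c t z)) * c > 0"
proof -
  have "(cmod (offset c z))\<^sup>2 < 1\<^sup>2" using r by (simp add: rad_cmod)
  then have "cmod (offset c z) < 1" by (rule power2_less_imp_less) simp
  then have "\<bar>Re (rot c t z)\<bar> < 1" using abs_Re_le_cmod[of "rot c t z"] by (simp add: cmod_rot)
  then have "(c + Re (rot c t z)) * c > 0" using c by auto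
  then have "norm (w z) * ((c + Re (rot c t z)) * c) > 0" using w by simp
  then show ?thesis by (simp add: h_twist mult.assoc)
qed

lemma side_twist:
  assumes w: "w z \<noteq> 0" and r: "rad (side z) z < 1"
  shows "side (twist (side z) t z) = side z"
proof -
  have c: "side z = 2 \<or> side z = - 2" by (simp add: side_def)
  from Re_twist[OF w r c, of t] c show ?thesis
    unfolding side_def[of "twist (side z) t z"] by (auto simp: zero_less_mult_iff mult_less_0_iff)
qed

lemma loc_inverse: "loc (- t) (loc t z) = z"
proof (cases "w z = 0 \<or> rad (side z) z \<ge> 1")
  case True
  then have "loc s z = z" for s using twist_id[of z "side z" s] by (auto simp: loc_def)
  then show ?thesis by simp
next
  case False
  then have r: "rad (side z) z < 1" "w z \<noteq> 0" by auto
  have "norm (w (twist (side z) t z)) = norm (w z)" by (rule norm_w_twist)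
  then have "w (twist (side z) t z) \<noteq> 0" using r by auto
  then show ?thesis using side_twist[OF r(2,1)] twist_inverse[OF r(2)] r by (simp add: loc_def)
qed

lemma loc_zero: "loc 0 z = z"
proof (cases "w z = 0")
  case False
  have r: "rot c 0 z = offset c z" for c by (simp add: rot_def)
  have t: "phase c 0 z = 0" for c by (simp add: phase_def r)
  have "twist c 0 z = z" for c
    by (rule decomp_eqI) (simp_all add: h_twist w_twist h_offset[OF False] r t)
  then show ?thesis by (simp add: loc_def)
qed (simp add: loc_def)

lemma loc_nonzero: "z \<noteq> 0 \<Longrightarrow> loc t z \<noteq> 0"
proof
  assume "z \<noteq> 0" "loc t z = 0"
  then have "loc (- t) 0 = z" using loc_inverse[of t z] by simp
  moreover have "w 0 = 0" by (rule linear_0[OF bounded_linear.linear[OF wpart_linear]])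
  then have "loc (- t) 0 = 0" by (simp add: loc_def)
  ultimately show False using \<open>z \<noteq> 0\<close> by simp
qed

text \<open>A negative factor exchanges the two centres. Then \<open>c\<close>,
  \<open>offset\<close> and \<open>rot\<close> all change sign, while \<open>rad\<close> and
  \<open>phase\<close> do not, since \<open>phase\<close> contains only products of two of them and
  functions of \<open>rad\<close>.\<close>

lemma loc_hom:
  assumes a: "a \<noteq> 0"
  shows "loc t (a *\<^sub>R z) = a *\<^sub>R loc t z"
proof (cases "w z = 0 \<or> Re (h z) = 0")
  \<comment> \<open>\<open>side\<close> is not odd where \<open>Re (h z) = 0\<close>, but there
    \<open>loc\<close> is the identity.\<close>
  case True
  then have "loc t z = z" by (intro loc_id) auto
  moreover have "loc t (a *\<^sub>R z) = a *\<^sub>R z"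
    by (rule loc_id) (use True in \<open>auto simp: w_scaleR herm_scaleR_right\<close>)
  ultimately show ?thesis by simp
next
  case False
  have sd: "side (a *\<^sub>R z) = sgn a * side z"
    using False a by (auto simp: side_def herm_scaleR_right sgn_real_def zero_le_mult_iff mult_le_0_iff)
  have sa: "sgn a * sgn a = 1" "inverse \<bar>a\<bar> * a = sgn a" "\<bar>a\<bar> * sgn a = a" "sgn a = 1 \<or> sgn a = - 1"
    using a by (auto simp: sgn_real_def)
  define c where "c = side z"
  have u: "offset (sgn a * c) (a *\<^sub>R z) = sgn a *\<^sub>R offset c z"
  proof -
    have "offset (sgn a * c) (a *\<^sub>R z) = (inverse (norm (w z)) * (inverse \<bar>a\<bar> * a)) *\<^sub>R h z - sgn a *\<^sub>R of_real c"
      by (simp add: offset_def w_scaleR herm_scaleR_right complex_eq_iff)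
    then show ?thesis unfolding sa(2) by (simp add: offset_def scaleR_diff_right mult.commute)
  qed
  have r: "rad (sgn a * c) (a *\<^sub>R z) = rad c z"
    using sa(1) by (simp add: rad_def u mult.assoc[symmetric])
  have R: "rot (sgn a * c) t (a *\<^sub>R z) = sgn a *\<^sub>R rot c t z" by (simp add: rot_def u r)
  have T: "phase (sgn a * c) t (a *\<^sub>R z) = phase c t z"
    using sa(4) by (auto simp: phase_def u r R)
  have "twist (sgn a * c) t (a *\<^sub>R z) = a *\<^sub>R twist c t z"
  proof (rule decomp_eqI)
    have "h (twist (sgn a * c) t (a *\<^sub>R z)) = (\<bar>a\<bar> * norm (w z)) *\<^sub>R (of_real (sgn a * c) + sgn a *\<^sub>R rot c t z)"
      by (simp add: h_twist R w_scaleR)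
    also have "\<dots> = (\<bar>a\<bar> * sgn a) *\<^sub>R (norm (w z) *\<^sub>R (of_real c + rot c t z))"
      by (simp add: scaleR_conv_of_real algebra_simps)
    finally show "h (twist (sgn a * c) t (a *\<^sub>R z)) = h (a *\<^sub>R twist c t z)"
      unfolding sa(3) by (simp add: h_twist herm_scaleR_right)
    have "w (twist (sgn a * c) t (a *\<^sub>R z)) = cis (phase c t z) *s (a *\<^sub>R w z)"
      by (simp only: w_twist T w_scaleR)
    also have "\<dots> = a *\<^sub>R (cis (phase c t z) *s w z)" by (simp add: vec_eq_iff)
    finally show "w (twist (sgn a * c) t (a *\<^sub>R z)) = w (a *\<^sub>R twist c t z)"
      by (simp only: w_twist w_scaleR)
  qed
  then show ?thesis using False a sd by (simp add: loc_def w_scaleR c_def)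
qed

lemma continuous_h_w: "continuous_on S (\<lambda>y :: real \<times> (complex^'n). h (snd y))"
    "continuous_on S (\<lambda>y :: real \<times> (complex^'n). w (snd y))"
  by (rule continuous_on_compose2[OF linear_continuous_on[OF herm_linear, of UNIV] continuous_on_snd[OF continuous_on_id]], simp)
    (rule continuous_on_compose2[OF linear_continuous_on[OF wpart_linear, of UNIV] continuous_on_snd[OF continuous_on_id]], simp)

text \<open>An open region where \<open>loc\<close> is the identity, in terms of
  \<open>h z / norm (w z)\<close>: |Re| < 1, |Im| > 1 or |Re| > 3. Multiplied out, the conditions
  also make sense for \<open>w z = 0\<close>, and together with the sets \<open>near\<close> they
  cover all non-zero points.\<close>

definition away :: "(real \<times> (complex^'n)) set" where
  "away = {y. \<bar>Re (h (snd y))\<bar> < norm (w (snd y))} \<union> {y. norm (w (snd y)) < \<bar>Im (h (snd y))\<bar>}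
     \<union> {y. 3 * norm (w (snd y)) < \<bar>Re (h (snd y))\<bar>}"

definition near :: "real \<Rightarrow> (real \<times> (complex^'n)) set" where
  "near c = {y. w (snd y) \<noteq> 0} \<inter> {y. Re (h (snd y)) * c > 0}"

lemma open_away: "open away"
  unfolding away_def by (intro open_Un open_Collect_less continuous_intros continuous_h_w)

lemma open_near: "open (near c)"
  unfolding near_def by (intro open_Int open_Collect_less open_Collect_neq continuous_intros continuous_h_w)

lemma away_loc: "y \<in> away \<Longrightarrow> loc t (snd y) = snd y"
proof (cases "w (snd y) = 0")
  case False
  assume y: "y \<in> away"
  let ?z = "snd y"
  have "rad (side ?z) ?z \<ge> 1"
  proof (rule ccontr)
    assume "\<not> rad (side ?z) ?z \<ge> 1"
    then have r: "rad (side ?z) ?z < 1" by simp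
    have "(cmod (offset (side ?z) ?z))\<^sup>2 < 1\<^sup>2" using r by (simp add: rad_cmod)
    then have "cmod (offset (side ?z) ?z) < 1" by (rule power2_less_imp_less) simp
    then have "\<bar>Re (h ?z) / norm (w ?z) - side ?z\<bar> < 1"
      using abs_Re_le_cmod[of "offset (side ?z) ?z"] by (simp add: offset_sel)
    then have "\<bar>Re (h ?z) / norm (w ?z)\<bar> < 3" by (auto simp: side_def split: if_splits)
    then have "\<bar>Re (h ?z)\<bar> < 3 * norm (w ?z)" using False by (simp add: field_simps)
    then show False using y rad_less_1[OF False r] by (auto simp: away_def)
  qed
  then show ?thesis using twist_id[OF False] by (simp add: loc_def)
qed (simp add: loc_def)

lemma near_loc: "y \<in> near c \<Longrightarrow> c = 2 \<or> c = - 2 \<Longrightarrow> loc t (snd y) = twist c t (snd y)"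
  by (auto simp: near_def loc_def side_def)

lemma away_near:
  assumes "z \<noteq> 0"
  shows "(t, z) \<in> away \<or> (t, z) \<in> near (side z)"
proof (cases "w z = 0")
  case True
  then have "h z \<noteq> 0" using assms decomp[of z] by auto
  then have "(t, z) \<in> away" using True by (auto simp: away_def complex_eq_iff)
  then show ?thesis by simp
next
  case False
  then show ?thesis by (cases "Re (h z) = 0") (auto simp: away_def near_def side_def)
qed

lemma loc_smooth: "smooth_on (UNIV \<times> - {0}) (\<lambda>y. loc (fst y) (snd y))"
proof (rule smooth_on_local)
  show "open (UNIV \<times> - {0} :: (real \<times> (complex^'n)) set)" by (intro open_Times) auto
  fix y :: "real \<times> (complex^'n)" assume "y \<in> UNIV \<times> - {0}"
  then have "snd y \<noteq> 0" by (simp add: mem_Times_iff)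
  from away_near[OF this, of "fst y"] consider "y \<in> away" | "y \<in> near (side (snd y))"
    unfolding prod.collapse by blast
  then show "\<exists>V. y \<in> V \<and> smooth_on V (\<lambda>y. loc (fst y) (snd y))"
  proof cases
    case 1
    have "smooth_on away (\<lambda>y. loc (fst y) (snd y))"
      by (rule smooth_on_cong[OF smooth_on_snd[OF smooth_on_id[OF open_away]]]) (simp add: away_loc)
    then show ?thesis using 1 by blast
  next
    case 2
    define c where "c = side (snd y)"
    have c: "c = 2 \<or> c = - 2" by (simp add: c_def side_def)
    have "smooth_on (near c) (\<lambda>y. twist c (fst y) (snd y))"
      by (intro smooth_on_twist smooth_on_fst smooth_on_snd smooth_on_id open_near) (simp add: near_def)
    then have "smooth_on (near c) (\<lambda>y. loc (fst y) (snd y))"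
      by (rule smooth_on_cong) (simp add: near_loc c)
    then show ?thesis using 2 c_def by blast
  qed
qed

text \<open>The time 0 is a dummy, as \<open>away\<close> restricts only the point. The zero branch
  also covers \<open>w z = 0\<close>, where \<open>rad\<close> has no geometric meaning.\<close>

definition loc_ham :: "complex^'n \<Rightarrow> real" where
  "loc_ham z = (if (0, z) \<in> away then 0 else (norm (w z))\<^sup>2 * profile (rad (side z) z) / 2)"

lemma loc_derivative:
  assumes z: "z \<noteq> 0"
  shows "lam0 (loc t z) (joint_deriv loc t z (dt,v)) = lam0 z v + loc_ham z * dt"
proof -
  let ?L = "\<lambda>y. loc (fst y) (snd y)"
  show ?thesis
  proof (cases "(t, z) \<in> away")
    case True
    have "(?L has_derivative snd) (at (t, z))"
      by (rule has_derivative_transform_within_open[OF bounded_linear_imp_has_derivative[OF bounded_linear_snd] open_away True])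
        (simp add: away_loc)
    from frechet_derivative_at[OF this, symmetric] have "frechet_derivative ?L (at (t,z)) = snd" .
    moreover have "(0, z) \<in> away" using True by (simp add: away_def)
    ultimately show ?thesis using away_loc[OF True] by (simp add: loc_ham_def)
  next
    case False
    define c where "c = side z"
    have c: "c = 2 \<or> c = - 2" by (simp add: c_def side_def)
    have n: "(t, z) \<in> near c" using away_near[OF z, of t] False by (simp add: c_def)
    then have w0: "w z \<noteq> 0" by (simp add: near_def)
    have "smooth_on (near c) (\<lambda>y. twist c (fst y) (snd y))"
      by (intro smooth_on_twist smooth_on_fst smooth_on_snd smooth_on_id open_near) (simp add: near_def)
    from smooth_on_has_derivative[OF this n]
    have "(?L has_derivative joint_deriv (twist c) t z) (at (t, z))"
      by (rule has_derivative_transform_within_open[OF _ open_near n]) (simp add: near_loc[OF _ c])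
    from frechet_derivative_at[OF this, symmetric]
    have "frechet_derivative ?L (at (t,z)) = joint_deriv (twist c) t z" .
    moreover have "(0, z) \<notin> away" using False by (simp add: away_def)
    ultimately show ?thesis using twist_derivative[OF w0, of c t dt v] near_loc[OF n c, of t]
      by (simp add: loc_ham_def c_def)
  qed
qed

lemma local_isotopy_loc:
  assumes "w z0 \<noteq> 0"
  shows "local_isotopy e loc (\<lambda>t. loc (- t)) UNIV"
proof unfold_locales
  let ?A = "UNIV \<times> - {0} :: (real \<times> (complex^'n)) set"
  have oA: "open ?A" by (intro open_Times) auto
  show "smooth_on ?A (\<lambda>y. loc (fst y) (snd y))" by (rule loc_smooth)
  have m: "smooth_on ?A (\<lambda>y. (- fst y, snd y))"
    by (intro smooth_on_Pair smooth_on_minus smooth_on_fst smooth_on_snd smooth_on_id oA)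
  show "smooth_on ?A (\<lambda>y. loc (- fst y) (snd y))"
    using smooth_on_compose[OF loc_smooth m] by auto
  show "loc t (c *\<^sub>R x) = c *\<^sub>R loc t x" "loc (- t) (c *\<^sub>R x) = c *\<^sub>R loc (- t) x" if "c \<noteq> 0" for t c x
    using loc_hom[OF that] by auto
  show "loc t x \<noteq> 0 \<and> loc (- t) (loc t x) = x" "loc (- t) x \<noteq> 0 \<and> loc t (loc (- t) x) = x" if "x \<noteq> 0" for t x
    using loc_nonzero[OF that] loc_inverse[of t x] loc_inverse[of "- t" x] by auto
  show "loc 0 x = x" for x by (rule loc_zero)
  show "lam0 (loc t x) (joint_deriv loc t x (0,v)) = 0"
    if "x \<in> Sph" "lam0 x v = 0" for t x v
    using loc_derivative[OF Sph_nonzero[OF that(1)]] that(2) by simp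
  show "lam0 (loc (- t) x) (frechet_derivative (\<lambda>y. loc (- fst y) (snd y)) (at (t,x)) (0,v)) = 0"
    if "x \<in> Sph" "lam0 x v = 0" for t x v
  proof -
    have x0: "x \<noteq> 0" using Sph_nonzero[OF that(1)] .
    have "((\<lambda>y :: real \<times> (complex^'n). (- fst y, snd y)) has_derivative (\<lambda>y. (- fst y, snd y))) (at (t, x))"
      by (auto intro!: derivative_eq_intros)
    moreover have "((\<lambda>y. loc (fst y) (snd y)) has_derivative joint_deriv loc (- t) x)
        (at ((\<lambda>y. (- fst y, snd y)) (t, x)))"
      using smooth_on_has_derivative[OF loc_smooth, of "(- t, x)"] x0 by simp
    ultimately have "((\<lambda>y. loc (- fst y) (snd y)) has_derivative
        (\<lambda>y. joint_deriv loc (- t) x (- fst y, snd y))) (at (t, x))"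
      using has_derivative_compose[of "\<lambda>y. (- fst y, snd y)" _ "(t, x)" UNIV "\<lambda>y. loc (fst y) (snd y)"] by simp
    from fun_cong[OF frechet_derivative_at[OF this], of "(0,v)"]
    have "frechet_derivative (\<lambda>y. loc (- fst y) (snd y)) (at (t,x)) (0,v) =
       joint_deriv loc (- t) x (0,v)" by simp
    then show ?thesis using loc_derivative[OF x0, of "- t" 0 v] that(2) by simp
  qed
  have lh: "loc_ham x \<ge> 0" for x using profile_nonneg by (simp add: loc_ham_def)
  show "lam0 (loc t x) (joint_deriv loc t x (1,0)) \<ge> 0"
    if "x \<in> Sph" for t x
    using loc_derivative[OF Sph_nonzero[OF that], of t 1 0] lh[of x] by (simp add: lam0_zero_right)
  show "\<exists>t\<in>{0..1}. \<exists>x\<in>Sph. lam0 (loc t x) (joint_deriv loc t x (1,0)) > 0"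
  proof -
    define q where "q = norm (w z0)"
    have q: "q > 0" using assms by (simp add: q_def)
    \<comment> \<open>The centre of a disc: \<open>h z / norm (w z) = 2\<close>, where the offset is
      0 and the profile is positive.\<close>
    define z where "z = complex_of_real (2 * q) *s e + w z0"
    have hz: "h z = of_real (2 * q)" and wz: "w z = w z0"
      using h_comb[OF h_w, of "complex_of_real (2 * q)" z0] w_comb[OF h_w, of "complex_of_real (2 * q)" z0] by (simp_all only: z_def)
    have z0: "z \<noteq> 0" using wz assms linear_0[OF bounded_linear.linear[OF wpart_linear], of e] by auto
    define x where "x = sgn z"
    define a where "a = inverse (norm z)"
    have a: "a > 0" using z0 by (simp add: a_def)
    have xa: "x = a *\<^sub>R z" by (simp add: x_def a_def sgn_div_norm)
    have hx: "h x = of_real (a * (2 * q))" and wx: "w x = a *\<^sub>R w z0"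
      by (simp_all add: xa herm_scaleR_right hz w_scaleR wz complex_eq_iff)
    have nx: "norm (w x) = a * q" using a by (simp add: wx q_def)
    have s: "side x = 2" using a q by (simp add: side_def hx)
    have "offset 2 x = 0" using a q unfolding offset_def hx nx by (simp add: complex_eq_iff field_simps)
    then have r: "rad (side x) x = 0" by (simp add: s rad_def)
    have "(0, x) \<notin> away" using mult_pos_pos[OF a q] unfolding away_def by (simp add: hx nx)
    then have "loc_ham x > 0" using a q profile_pos by (simp add: loc_ham_def r nx)
    moreover have "x \<in> Sph" unfolding x_def by (rule sgn_in_Sph[OF z0])
    ultimately have "lam0 (loc 0 x) (joint_deriv loc 0 x (1,0)) > 0"
      using loc_derivative[OF Sph_nonzero, of x 0 1 0] by (simp add: lam0_zero_right)
    then show ?thesis using \<open>x \<in> Sph\<close> by (intro bexI[of _ 0] bexI[of _ x]) auto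
  qed
  show "loc (- t) x = x"
    if "\<not> (Re (h x) \<noteq> 0 \<and> \<bar>Im (h x)\<bar> \<le> \<bar>Re (h x)\<bar> \<and> norm (w x) \<le> \<bar>Re (h x)\<bar>)" for t x
    by (rule loc_id) (use that norm_ge_zero[of "w x"] in auto)
  show "Re (h (loc (- t) x)) > 0" if "Re (h x) > 0" for t x
  proof (cases "w x = 0 \<or> rad (side x) x \<ge> 1")
    case True
    then have "loc (- t) x = x" using twist_id[of x "side x" "- t"] by (auto simp: loc_def)
    then show ?thesis using that by simp
  next
    case False
    then have "Re (h (twist (side x) (- t) x)) * side x > 0"
      by (intro Re_twist) (auto simp: side_def)
    then show ?thesis using that False by (simp add: loc_def side_def zero_less_mult_iff)
  qed
qed (use e in auto)

end

section \<open>A localised isotopy of the projective line\<close>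

text \<open>The factor 1/16 brings the slope below 1/4, so that \<open>push t\<close> stays strictly
  increasing for all times in (-1, 2).\<close>

definition bump :: "real \<Rightarrow> real" where "bump x = flatE 0 (1 - x * x) / 16"
definition bump' :: "real \<Rightarrow> real" where "bump' x = - x * flatE 2 (1 - x * x) / 8"

lemma smooth_on_bump: "smooth_on UNIV bump" and smooth_on_bump': "smooth_on UNIV bump'"
proof -
  have f: "smooth_on UNIV (\<lambda>x. flatE n (1 - x * x))" for n
    by (intro smooth_on_compose[OF smooth_on_flatE] smooth_on_diff smooth_on_mult smooth_on_const smooth_on_id) auto
  have "smooth_on UNIV (\<lambda>x. flatE 0 (1 - x * x) * (1/16))"
    "smooth_on UNIV (\<lambda>x. (- x * flatE 2 (1 - x * x)) * (1/8))"
    by (intro smooth_on_mult smooth_on_minus f smooth_on_const smooth_on_id open_UNIV)+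
  then show "smooth_on UNIV bump" "smooth_on UNIV bump'"
    by (simp_all add: bump_def[abs_def] bump'_def[abs_def])
qed

lemma bump_derivative: "(bump has_real_derivative bump' x) (at x)"
proof -
  have d: "((\<lambda>x. 1 - x * x) has_real_derivative - (2 * x)) (at x)" by (auto intro!: derivative_eq_intros)
  have "(flatE 0 has_real_derivative flatE 2 (1 - x * x)) (at (1 - x * x))"
    using flatE_has_derivative[of 0 "1 - x * x"] by (simp add: numeral_2_eq_2)
  from DERIV_cdivide[OF DERIV_chain2[OF this d], of 16] show ?thesis
    by (simp add: bump_def[abs_def] bump'_def)
qed

lemma bump_nonneg: "bump x \<ge> 0" and bump_pos: "bump 0 > 0"
  by (simp_all add: bump_def flatE_nonneg flatE_pos)

lemma bump_zero: "\<bar>x\<bar> \<ge> 1 \<Longrightarrow> bump x = 0"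
  using abs_le_square_iff[of 1 x] by (simp add: bump_def flatE_zero power2_eq_square)

lemma bump'_bound: "\<bar>bump' x\<bar> \<le> 1/4"
proof (cases "\<bar>x\<bar> \<ge> 1")
  case True
  then show ?thesis using abs_le_square_iff[of 1 x] by (simp add: bump'_def flatE_zero power2_eq_square)
next
  case False
  have fl: "flatE 2 y \<le> 2" for y
  proof (cases "y > 0")
    case True
    \<comment> \<open>The quadratic term of the exponential series alone bounds u^2 exp (-u) by 2
      for u = 1/y.\<close>
    have "1 + inverse y + (inverse y)\<^sup>2 / 2 \<le> exp (inverse y)"
      using True by (intro exp_lower_Taylor_quadratic) simp
    then have "(inverse y)\<^sup>2 / 2 \<le> exp (inverse y)" using True by (smt (verit) inverse_positive_iff_positive)
    then show ?thesis using True by (simp add: flatE_def exp_minus field_simps)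
  qed (simp add: flatE_def)
  have "\<bar>bump' x\<bar> = \<bar>x\<bar> * flatE 2 (1 - x * x) / 8" using flatE_nonneg by (simp add: bump'_def abs_mult)
  also have "\<dots> \<le> 1 * 2 / 8" using False fl flatE_nonneg by (intro divide_right_mono mult_mono) auto
  finally show ?thesis by simp
qed

definition push :: "real \<Rightarrow> real \<Rightarrow> real" where "push t x = x + t * bump x"
definition pull :: "real \<Rightarrow> real \<Rightarrow> real" where "pull t = inv (push t)"

text \<open>The time interval is an open neighbourhood of [0, 1], as \<open>local_isotopy\<close>
  demands. There |t| < 2, so the perturbation of the slope is at most 1/2.\<close>

lemma push_slope: "t \<in> {-1<..<2} \<Longrightarrow> 1 + t * bump' x > 0"
proof -
  assume "t \<in> {-1<..<2}"
  then have "\<bar>t * bump' x\<bar> \<le> 2 * (1/4)"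
    unfolding abs_mult using bump'_bound by (intro mult_mono) auto
  then show ?thesis by linarith
qed

lemma push_derivative: "(push t has_real_derivative 1 + t * bump' x) (at x)"
  unfolding push_def[abs_def] using DERIV_add[OF DERIV_ident DERIV_cmult[OF bump_derivative]] .

lemma bij_push:
  assumes t: "t \<in> {-1<..<2}"
  shows "bij (push t)"
proof -
  have mono: "push t x < push t y" if "x < y" for x y
    by (rule DERIV_pos_imp_increasing[OF that]) (use push_derivative push_slope[OF t] in blast)
  have inj: "inj (push t)"
  proof (rule injI)
    fix x y assume "push t x = push t y"
    then show "x = y" using mono[of x y] mono[of y x] by (cases x y rule: linorder_cases) auto
  qed
  have "\<exists>x. push t x = y" for y
  proof -
    define M where "M = \<bar>y\<bar> + 1"
    have "push t (- M) = - M" "push t M = M" by (simp_all add: push_def M_def bump_zero)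
    then have "push t (- M) \<le> y" "y \<le> push t M" by (auto simp: M_def)
    moreover have "isCont (push t) x" for x using push_derivative DERIV_isCont by blast
    ultimately have "\<exists>x\<ge>- M. x \<le> M \<and> push t x = y" by (intro IVT) (auto simp: M_def)
    then show ?thesis by blast
  qed
  then have "surj (push t)" unfolding surj_def by metis
  then show ?thesis using inj by (simp add: bij_def)
qed

lemma push_pull: "t \<in> {-1<..<2} \<Longrightarrow> push t (pull t x) = x"
  and pull_push: "t \<in> {-1<..<2} \<Longrightarrow> pull t (push t x) = x"
  using bij_push[of t] unfolding pull_def bij_def by (simp_all add: surj_f_inv_f inv_f_f)

lemma push_id: "\<bar>x\<bar> \<ge> 1 \<Longrightarrow> push t x = x" by (simp add: push_def bump_zero)

lemma pull_id: "t \<in> {-1<..<2} \<Longrightarrow> \<bar>x\<bar> \<ge> 1 \<Longrightarrow> pull t x = x"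
  using pull_push[of t x] by (simp add: push_id)

text \<open>Inverse function theorem for the map (t, x) \<mapsto> (t, push t x); carrying the time
  along gives differentiability in both variables jointly.\<close>

lemma pull_has_derivative:
  assumes t: "t \<in> {-1<..<2}"
  shows "((\<lambda>y. pull (fst y) (snd y)) has_derivative
    (\<lambda>v. (snd v - fst v * bump (pull t x)) * inverse (1 + t * bump' (pull t x)))) (at (t, x))"
proof -
  let ?W = "{-1<..<2} \<times> UNIV :: (real \<times> real) set"
  let ?F = "\<lambda>y. (fst y, push (fst y) (snd y)) :: real \<times> real"
  let ?G = "\<lambda>y. (fst y, pull (fst y) (snd y)) :: real \<times> real"
  define z where "z = pull t x"
  have o: "open ?W" by (intro open_Times) auto
  have dF: "(?F has_derivative (\<lambda>v. (fst v, snd v + (fst v * bump (snd y) + fst y * (snd v * bump' (snd y)))))) (at y)" for y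
  proof -
    have "((\<lambda>y::real\<times>real. bump (snd y)) has_derivative (\<lambda>v. snd v * bump' (snd y))) (at y)"
      using has_derivative_compose[OF has_derivative_snd[OF has_derivative_ident]
          has_field_derivative_imp_has_derivative[OF bump_derivative[of "snd y"]]]
      by (simp add: mult.commute)
    then show ?thesis unfolding push_def
      by (auto intro!: derivative_eq_intros)
  qed
  have "continuous_on ?W ?F"
    using dF has_derivative_continuous by (intro continuous_at_imp_continuous_on) blast
  moreover have "?G (?F y) = y" if "y \<in> ?W" for y
    using that pull_push[of "fst y" "snd y"] by (auto simp: mem_Times_iff)
  moreover have "(\<lambda>v. (fst v, snd v + (fst v * bump z + t * (snd v * bump' z)))) \<circ>
     (\<lambda>v. (fst v, (snd v - fst v * bump z) * inverse (1 + t * bump' z))) = id"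
  proof
    fix v :: "real \<times> real"
    let ?s = "1 + t * bump' z" and ?y = "snd v - fst v * bump z"
    have "?y * inverse ?s + t * (?y * inverse ?s * bump' z) = ?y * (inverse ?s * ?s)" by (simp add: algebra_simps)
    also have "inverse ?s * ?s = 1" using push_slope[OF t, of z] by (intro left_inverse) simp
    finally show "((\<lambda>v. (fst v, snd v + (fst v * bump z + t * (snd v * bump' z)))) \<circ>
     (\<lambda>v. (fst v, (snd v - fst v * bump z) * inverse (1 + t * bump' z)))) v = id v"
      by (simp add: prod_eq_iff)
  qed
  ultimately have "(?G has_derivative (\<lambda>v. (fst v, (snd v - fst v * bump z) * inverse (1 + t * bump' z)))) (at (?F (t, z)))"
    using has_derivative_inverse_strong[of ?W "(t, z)" ?F ?G] o dF[of "(t, z)"] t by auto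
  moreover have "?F (t, z) = (t, x)" using push_pull[OF t] by (simp add: z_def)
  ultimately have "(?G has_derivative (\<lambda>v. (fst v, (snd v - fst v * bump z) * inverse (1 + t * bump' z)))) (at (t, x))"
    by simp
  from has_derivative_snd[OF this] show ?thesis by (simp add: z_def)
qed

text \<open>Bootstrapping: the derivative of \<open>pull\<close> is a smooth expression in the time
  and \<open>pull\<close> itself, so class C^k yields class C^(k+1).\<close>

lemma smooth_on_pull: "smooth_on ({-1<..<2} \<times> UNIV) (\<lambda>y. pull (fst y) (snd y))"
proof (rule smooth_onI)
  let ?W = "{-1<..<2} \<times> UNIV :: (real \<times> real) set"
  show o: "open ?W" by (intro open_Times) auto
  show "Ck_on k ?W (\<lambda>y. pull (fst y) (snd y))" for k
  proof (induction k)
    case 0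
    have "isCont (\<lambda>y. pull (fst y) (snd y)) y" if "y \<in> ?W" for y
      using has_derivative_continuous[OF pull_has_derivative[of "fst y" "snd y"]] that by (simp add: mem_Times_iff)
    then show ?case by (simp add: continuous_at_imp_continuous_on)
  next
    case (Suc k)
    let ?p = "\<lambda>y :: real \<times> real. pull (fst y) (snd y)"
    show ?case
    proof (rule Ck_on_SucI[OF o])
      show "(?p has_derivative (\<lambda>v. (snd v - fst v * bump (?p y)) * inverse (1 + fst y * bump' (?p y)))) (at y)"
        if "y \<in> ?W" for y
        using pull_has_derivative[of "fst y" "snd y"] that by (simp add: mem_Times_iff)
      fix v :: "real \<times> real"
      have b: "Ck_on k ?W (\<lambda>y. bump (?p y))" "Ck_on k ?W (\<lambda>y. bump' (?p y))"
        using Ck_on_compose[OF o open_UNIV _ Suc] smooth_on_bump smooth_on_bump' by (auto simp: smooth_on_def)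
      have f: "Ck_on k ?W fst" by (rule Ck_on_bounded_linear[OF o bounded_linear_fst])
      have i: "Ck_on k ?W (\<lambda>y. inverse (1 + fst y * bump' (?p y)))"
      proof (rule Ck_on_compose[OF o, where V="- {0}" and g=inverse and f="\<lambda>y. 1 + fst y * bump' (?p y)"])
        show "(\<lambda>y. 1 + fst y * bump' (?p y)) ` ?W \<subseteq> - {0}"
        proof (rule image_subsetI)
          fix y assume "y \<in> ?W"
          then show "1 + fst y * bump' (?p y) \<in> - {0}" using push_slope[of "fst y" "?p y"] by (simp add: mem_Times_iff)
        qed
        show "Ck_on k ?W (\<lambda>y. 1 + fst y * bump' (?p y))"
          by (intro Ck_on_add Ck_on_const Ck_on_bilinear[OF _ bounded_bilinear_mult] o b f)
        show "Ck_on k (- {0}) (inverse :: real \<Rightarrow> real)" using smooth_on_inverse by (simp add: smooth_on_def)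
      qed auto
      have "Ck_on k ?W (\<lambda>y. (snd v + (- fst v) * bump (?p y)) * inverse (1 + fst y * bump' (?p y)))"
        by (intro Ck_on_add Ck_on_const Ck_on_bilinear[OF _ bounded_bilinear_mult] o b i)
      then show "Ck_on k ?W (\<lambda>y. (snd v - fst v * bump (?p y)) * inverse (1 + fst y * bump' (?p y)))" by simp
    qed
  qed
qed

lemma smooth_on_push: "smooth_on ({-1<..<2} \<times> UNIV) (\<lambda>y. push (fst y) (snd y))"
proof -
  have o: "open ({-1<..<2} \<times> UNIV :: (real \<times> real) set)" by (intro open_Times) auto
  show ?thesis unfolding push_def
    by (intro smooth_on_add smooth_on_mult smooth_on_fst smooth_on_snd smooth_on_id smooth_on_compose[OF smooth_on_bump] o UNIV_I)
qed

lemma herm_zero_left: "herm 0 z = 0" by (simp add: herm_def)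

context unit_vector
begin

text \<open>Applies \<open>g t\<close> in the chart Im / Re of the projective line and keeps Re,
  which makes the lift homogeneous. On Re = 0, the point at infinity of the chart, the identity is
  the continuation for a \<open>g\<close> supported in [-1, 1].\<close>

definition slide :: "(real \<Rightarrow> real \<Rightarrow> real) \<Rightarrow> real \<Rightarrow> complex^'n \<Rightarrow> complex^'n" where
  "slide g t z = (if Re (h z) = 0 then z
     else Complex (Re (h z)) (Re (h z) * g t (Im (h z) / Re (h z))) *s e)"

end

text \<open>The case n = 1: \<open>e\<close> spans the whole space over the complex numbers.\<close>

locale unit_vector_1 = unit_vector e for e :: "complex^'n" +
  assumes w0: "\<And>z. w z = 0"
begin

lemma z_h: "z = h z *s e" using decomp[of z] w0 by simp

lemma h_smult_e: "h (c *s e) = c" by (simp add: herm_smult_right h_e)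

lemma h_eqI: "h y = h z \<Longrightarrow> y = z" using z_h by metis

lemma h_nonzero: "z \<noteq> 0 \<Longrightarrow> h z \<noteq> 0" using z_h[of z] by auto

lemma h_slide: "h (slide g t z) = (if Re (h z) = 0 then h z
     else Complex (Re (h z)) (Re (h z) * g t (Im (h z) / Re (h z))))"
  by (simp add: slide_def h_smult_e)

lemma slide_id:
  assumes "\<And>x. \<bar>x\<bar> \<ge> 1 \<Longrightarrow> g t x = x" "\<bar>Im (h z)\<bar> \<ge> \<bar>Re (h z)\<bar>"
  shows "slide g t z = z"
proof (rule h_eqI, cases "Re (h z) = 0")
  case False
  then have "\<bar>Im (h z) / Re (h z)\<bar> \<ge> 1" using assms(2) by simp
  then show "h (slide g t z) = h z" using assms(1) False by (simp add: h_slide complex_eq_iff)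
qed (simp add: h_slide)

lemma slide_inverse:
  assumes "\<And>x. f t (g t x) = x"
  shows "slide f t (slide g t z) = z"
  by (rule h_eqI) (auto simp: h_slide assms complex_eq_iff)

lemma slide_nonzero: "z \<noteq> 0 \<Longrightarrow> slide g t z \<noteq> 0"
proof
  assume z: "z \<noteq> 0" and "slide g t z = 0"
  then have "h (slide g t z) = 0" by (simp add: linear_0[OF bounded_linear.linear[OF herm_linear]])
  then show False using h_nonzero[OF z] by (auto simp: h_slide complex_eq_iff split: if_splits)
qed

lemma slide_hom: "a \<noteq> 0 \<Longrightarrow> slide g t (a *\<^sub>R z) = a *\<^sub>R slide g t z"
  by (rule h_eqI) (auto simp: h_slide herm_scaleR_right complex_eq_iff)

lemma slide_smooth:
  assumes g: "smooth_on ({-1<..<2} \<times> UNIV) (\<lambda>y. g (fst y) (snd y))"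
    and id: "\<And>t x. t \<in> {-1<..<2} \<Longrightarrow> \<bar>x\<bar> \<ge> 1 \<Longrightarrow> g t x = x"
  shows "smooth_on ({-1<..<2} \<times> - {0}) (\<lambda>y. slide g (fst y) (snd y))"
proof (rule smooth_on_local)
  show "open ({-1<..<2} \<times> - {0} :: (real \<times> (complex^'n)) set)" by (intro open_Times) auto
  let ?T = "{-1<..<2} \<times> UNIV :: (real \<times> (complex^'n)) set"
  have oT: "open ?T" by (intro open_Times) auto
  \<comment> \<open>On the first set the formula in the chart is smooth; on the second one
    \<open>slide\<close> is the identity. They cover all non-zero points.\<close>
  let ?V1 = "?T \<inter> {y. Re (h (snd y)) \<noteq> 0}"
  let ?V2 = "?T \<inter> {y. \<bar>Re (h (snd y))\<bar> < \<bar>Im (h (snd y))\<bar>}"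
  have o1: "open ?V1" by (intro open_Int oT open_Collect_neq continuous_intros continuous_h_w)
  have o2: "open ?V2" by (intro open_Int oT open_Collect_less continuous_intros continuous_h_w)
  have R: "smooth_on ?V1 (\<lambda>y. Re (h (snd y)))" "smooth_on ?V1 (\<lambda>y. Im (h (snd y)))"
    by (intro smooth_on_Re smooth_on_Im smooth_on_h smooth_on_snd smooth_on_id o1)+
  have i: "smooth_on ?V1 (\<lambda>y. inverse (Re (h (snd y))))"
    by (rule smooth_on_compose[OF smooth_on_inverse R(1)]) simp
  have "smooth_on ?V1 (\<lambda>y. (fst y, Im (h (snd y)) * inverse (Re (h (snd y)))))"
    by (intro smooth_on_Pair smooth_on_fst smooth_on_id o1 smooth_on_mult R i)
  from smooth_on_compose[OF g this]
  have "smooth_on ?V1 (\<lambda>y. g (fst y) (Im (h (snd y)) * inverse (Re (h (snd y)))))" by auto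
  then have "smooth_on ?V1 (\<lambda>y. Complex (Re (h (snd y))) (Re (h (snd y)) * g (fst y) (Im (h (snd y)) * inverse (Re (h (snd y))))) *s e)"
    by (intro smooth_on_smult smooth_on_Complex smooth_on_mult R smooth_on_const o1)
  then have s1: "smooth_on ?V1 (\<lambda>y. slide g (fst y) (snd y))"
    by (rule smooth_on_cong) (simp add: slide_def divide_inverse)
  have s2: "smooth_on ?V2 (\<lambda>y. slide g (fst y) (snd y))"
    by (rule smooth_on_cong[OF smooth_on_snd[OF smooth_on_id[OF o2]]])
      (use id in \<open>auto intro!: slide_id[symmetric] simp: mem_Times_iff\<close>)
  fix y :: "real \<times> (complex^'n)" assume y: "y \<in> {-1<..<2} \<times> - {0}"
  then have "h (snd y) \<noteq> 0" using h_nonzero by (simp add: mem_Times_iff)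
  then have "y \<in> ?V1 \<or> y \<in> ?V2" using y by (auto simp: mem_Times_iff complex_eq_iff)
  then show "\<exists>V. y \<in> V \<and> smooth_on V (\<lambda>y. slide g (fst y) (snd y))"
  proof
    assume "y \<in> ?V1" then show ?thesis using s1 by (intro exI[of _ ?V1] conjI)
  next
    assume "y \<in> ?V2" then show ?thesis using s2 by (intro exI[of _ ?V2] conjI)
  qed
qed

text \<open>On the circle the contact planes are zero: a vector on which both the inner product and
  \<lambda>_0 with \<open>x\<close> vanish has Hermitian product 0 with \<open>x\<close>, hence is
  0.\<close>

lemma slide_contact:
  assumes "smooth_on ({-1<..<2} \<times> - {0}) (\<lambda>y. slide g (fst y) (snd y))" "t \<in> {0..1}" "x \<in> Sph" "inner x v = 0" "lam0 x v = 0"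
  shows "lam0 (slide g t x) (joint_deriv (slide g) t x (0,v)) = 0"
proof -
  have "herm x v = 0" using assms(4,5) by (simp add: inner_herm lam0_herm complex_eq_iff)
  then have "cnj (h x) * h v = 0" using herm_decomp[of x v] by (simp add: w0 herm_zero_left)
  then have "h v = 0" using h_nonzero[OF Sph_nonzero[OF assms(3)]] by simp
  then have v: "v = 0" using h_nonzero by blast
  have "((\<lambda>y. slide g (fst y) (snd y)) has_derivative joint_deriv (slide g) t x) (at (t,x))"
    by (rule smooth_on_has_derivative[OF assms(1)]) (use assms(2) Sph_nonzero[OF assms(3)] in auto)
  from linear_0[OF has_derivative_linear[OF this]]
  show ?thesis by (simp add: v lam0_zero_right zero_prod_def[symmetric])
qed

lemma slide_ham:
  assumes sm: "smooth_on ({-1<..<2} \<times> - {0}) (\<lambda>y. slide push (fst y) (snd y))" and t: "t \<in> {0..1}" and x: "x \<noteq> 0"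
  shows "lam0 (slide push t x) (joint_deriv (slide push) t x (1,0))
    = (Re (h x))\<^sup>2 * bump (Im (h x) / Re (h x)) / 2"
proof -
  let ?b = "bump (Im (h x) / Re (h x))"
  let ?L = "\<lambda>y. slide push (fst y) (snd y)"
  \<comment> \<open>The lift is affine in time, so its velocity can be read off. Where
    \<open>Re (h x) = 0\<close> the quotient has the default value 0, and the factor
    \<open>Re (h x)\<close> removes the term.\<close>
  have eq: "slide push s x = h x *s e + s *\<^sub>R (Complex 0 (Re (h x) * ?b) *s e)" for s
  proof (rule h_eqI)
    show "h (slide push s x) = h (h x *s e + s *\<^sub>R (Complex 0 (Re (h x) * ?b) *s e))"
      by (cases "Re (h x) = 0")
        (simp_all add: h_slide herm_add_right herm_scaleR_right h_smult_e complex_eq_iff push_def field_simps)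
  qed
  have "(?L has_derivative frechet_derivative ?L (at (t,x))) (at (t,x))"
    by (rule smooth_on_has_derivative[OF sm]) (use t x in auto)
  moreover have "((\<lambda>s. (s, x)) has_derivative (\<lambda>s. (s, 0))) (at t)"
    by (intro has_derivative_Pair has_derivative_ident has_derivative_const)
  ultimately have "((\<lambda>s. slide push s x) has_derivative (\<lambda>s. frechet_derivative ?L (at (t,x)) (s, 0))) (at t)"
    using has_derivative_compose[of "\<lambda>s. (s, x)" _ t UNIV ?L] by simp
  moreover have "((\<lambda>s. slide push s x) has_derivative (\<lambda>s. s *\<^sub>R (Complex 0 (Re (h x) * ?b) *s e))) (at t)"
    unfolding eq by (auto intro!: derivative_eq_intros)
  ultimately have "frechet_derivative ?L (at (t,x)) (1, 0) = Complex 0 (Re (h x) * ?b) *s e"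
    using fun_cong[OF has_derivative_unique, of _ _ _ _ 1] by (metis (no_types, lifting) scaleR_one)
  moreover have "herm (slide push t x) (Complex 0 (Re (h x) * ?b) *s e) = cnj (h (slide push t x)) * Complex 0 (Re (h x) * ?b)"
    using herm_decomp[of "slide push t x"] by (simp add: w0 h_smult_e herm_zero_left)
  ultimately show ?thesis by (simp add: lam0_herm h_slide power2_eq_square)
qed

lemma local_isotopy_slide: "local_isotopy e (slide push) (slide pull) {-1<..<2}"
proof -
  have s1: "smooth_on ({-1<..<2} \<times> - {0}) (\<lambda>y. slide push (fst y) (snd y))"
    by (rule slide_smooth[OF smooth_on_push push_id])
  have s2: "smooth_on ({-1<..<2} \<times> - {0}) (\<lambda>y. slide pull (fst y) (snd y))"
    by (rule slide_smooth[OF smooth_on_pull pull_id])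
  have T: "t \<in> {-1<..<2}" if "t \<in> {0..1}" for t :: real using that by auto
  show ?thesis
  proof unfold_locales
    show "smooth_on ({-1<..<2} \<times> - {0}) (\<lambda>y. slide push (fst y) (snd y))" by (rule s1)
    show "smooth_on ({-1<..<2} \<times> - {0}) (\<lambda>y. slide pull (fst y) (snd y))" by (rule s2)
    show "slide push t (c *\<^sub>R x) = c *\<^sub>R slide push t x" "slide pull t (c *\<^sub>R x) = c *\<^sub>R slide pull t x" if "c \<noteq> 0" for t c x
      using slide_hom[OF that] by auto
    show "slide push t x \<noteq> 0 \<and> slide pull t (slide push t x) = x"
      "slide pull t x \<noteq> 0 \<and> slide push t (slide pull t x) = x" if "t \<in> {0..1}" "x \<noteq> 0" for t x
      using slide_nonzero[OF that(2)] slide_inverse[of pull t push] slide_inverse[of push t pull]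
        push_pull[OF T[OF that(1)]] pull_push[OF T[OF that(1)]] by auto
    show "slide push 0 x = x" for x
      by (rule h_eqI) (simp add: h_slide push_def complex_eq_iff)
    show "lam0 (slide push t x) (joint_deriv (slide push) t x (0,v)) = 0"
      if "t \<in> {0..1}" "x \<in> Sph" "inner x v = 0" "lam0 x v = 0" for t x v
      by (rule slide_contact[OF s1 that])
    show "lam0 (slide pull t x) (joint_deriv (slide pull) t x (0,v)) = 0"
      if "t \<in> {0..1}" "x \<in> Sph" "inner x v = 0" "lam0 x v = 0" for t x v
      by (rule slide_contact[OF s2 that])
    show "lam0 (slide push t x) (joint_deriv (slide push) t x (1,0)) \<ge> 0"
      if "t \<in> {0..1}" "x \<in> Sph" for t x
      unfolding slide_ham[OF s1 that(1) Sph_nonzero[OF that(2)]] using bump_nonneg by simp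
    have "lam0 (slide push 0 e) (joint_deriv (slide push) 0 e (1,0)) > 0"
      using slide_ham[OF s1 _ Sph_nonzero[OF e], of 0] bump_pos by (simp add: h_e)
    then show "\<exists>t\<in>{0..1}. \<exists>x\<in>Sph. lam0 (slide push t x) (joint_deriv (slide push) t x (1,0)) > 0"
      using e by (intro bexI[of _ 0] bexI[of _ e]) auto
    show "slide pull t x = x"
      if "t \<in> {0..1}" "\<not> (Re (h x) \<noteq> 0 \<and> \<bar>Im (h x)\<bar> \<le> \<bar>Re (h x)\<bar> \<and> norm (w x) \<le> \<bar>Re (h x)\<bar>)" for t x
      by (rule slide_id[where g=pull, OF pull_id[OF T[OF that(1)]]]) (use that(2) w0[of x] in auto)
    show "Re (h (slide pull t x)) > 0" if "Re (h x) > 0" for t x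
      using that by (simp add: h_slide)
  qed auto
qed

end

section \<open>The theorem\<close>

text \<open>The dichotomy is n \<ge> 2 against n = 1: a non-zero \<open>w z\<close> is needed to
  have a plane and a phase for the twist.\<close>

lemma ex_local_isotopy:
  assumes "e \<in> Sph"
  shows "\<exists>\<Phi> \<Psi> W. local_isotopy e \<Phi> \<Psi> W"
proof -
  interpret unit_vector e by unfold_locales fact
  show ?thesis
  proof (cases "\<exists>z. w z \<noteq> 0")
    case True
    then show ?thesis using local_isotopy_loc by blast
  next
    case False
    then interpret unit_vector_1 e by unfold_locales blast
    show ?thesis using local_isotopy_slide by blast
  qed
qed

theorem theorem5:
  fixes d :: "(real \<Rightarrow> complex^'n \<Rightarrow> complex^'n) set \<Rightarrow> (real \<Rightarrow> complex^'n \<Rightarrow> complex^'n) set \<Rightarrow> ennreal"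
  assumes pos: "\<forall>a\<in>UCont. \<forall>b\<in>UCont. d a b > 0 \<longleftrightarrow> nnsp_path_between a b"
    and rev_tri: "\<forall>a\<in>UCont. \<forall>b\<in>UCont. \<forall>c\<in>UCont. cleq a b \<and> cleq b c \<longrightarrow> d a c \<ge> d a b + d b c"
    and biinv: "\<forall>l\<in>UCont. \<forall>r\<in>UCont. \<forall>a\<in>UCont. \<forall>b\<in>UCont.
                  d (cmult l (cmult a r)) (cmult l (cmult b r)) = d a b"
  shows "\<forall>a\<in>UCont. \<forall>b\<in>UCont. (nnsp_path_between a b \<longrightarrow> d a b = \<infinity>) \<and>
                              (\<not> nnsp_path_between a b \<longrightarrow> d a b = 0)"
proof (intro ballI conjI impI)
  interpret bi_invariant_lorentzian d using pos rev_tri biinv by unfold_locales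
  fix a b :: "(real \<Rightarrow> complex^'n \<Rightarrow> complex^'n) set" assume ab: "a \<in> UCont" "b \<in> UCont"
  {
    assume "\<not> nnsp_path_between a b"
    then have "\<not> d a b > 0" using pos ab by blast
    then show "d a b = 0" by (simp add: zero_less_iff_neq_zero)
  }
  assume "nnsp_path_between a b"
  then obtain p t x where p: "contact_path p" "\<forall>t\<in>{0..1}. \<forall>x\<in>Sph. ham p t x \<ge> 0"
    and tx: "t \<in> {0..1}" "x \<in> Sph" "ham p t x > 0" and b: "cmult (cls p) a = b"
    unfolding nnsp_path_between_def by blast
  obtain q where q: "contact_path q" "a = cls q" using ab(1) unfolding UCont_iff by blast
  \<comment> \<open>The isotopy is localised at the very point at which the Hamiltonian of
    \<open>p\<close> is positive.\<close>
  obtain \<Phi> \<Psi> W where "local_isotopy x \<Phi> \<Psi> W" using ex_local_isotopy[OF tx(2)] by blast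
  then have "d_id p = \<infinity>"
    by (rule d_id_infinite_of_local_isotopy[OF _ p(1) _ tx(1,3)]) (use p(2) in \<open>simp add: nonneg_ham_def\<close>)
  moreover have "b = cls (\<lambda>t x. p t (q t x))" using b q cmult_cls[OF p(1) q(1)] by simp
  ultimately show "d a b = \<infinity>" using d_translate[OF p(1) q(1)] q(2) by simp
qed

end
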